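(* Let $\mathcal C$ be a rigid C*-tensor category with simple unit $\mathbbm 1$ and at most countably many isomorphism classes of simple objects. Then $\mathbbm 1$ is an order unit for the tube cone $\Sigma^2\mathcal C$, that is, for every self-adjoint element $a=a^*\in\mathbb C[\mathcal C]$ there exists a scalar $R>0$ such that $a+R\mathbbm 1\in\Sigma^2\mathcal C$.
   Context: Conventions: C*-tensor categories are strict, essentially small, and closed under finite direct sums and passage to sub-objects. $\mathcal C(x,y)$ is the space of morphisms from $x$ to $y$. Rigid means every object $X$ has a conjugate $\overline X$ with $R\in\mathcal C(\mathbbm 1,\overline X\otimes X)$, $\overline R\in\mathcal C(\mathbbm 1,X\otimes\overline X)$ such that $(1_{\overline X}\otimes\overline R^* )(R\otimes 1_{\overline X})=1_{\overline X}$ and $(1_X\otimes R^* )(\overline R\otimes 1_X)=1_X$; the pair $(R,\overline R)$ is standard if $R^*(1\otimes f)R=\overline R^*(f\otimes 1)\overline R$ for all $f\in\mathrm{End}(X)$. Standard solutions $(R_X,\overline R_X)$ are fixed for all objects (fixed for irreducibles and extended by naturality). $\mathrm{Irr}$ is a fixed set of representatives of the isomorphism classes of simple objects (with $\mathbbm 1\in \mathrm{Irr}$); simple objects are not distinguished from their classes. Fusion algebra: $\mathbb C[\mathcal C]$ is the unital $*$-algebra with linear basis $\mathrm{Irr}$, product $x\cdot y=\sum_{z\in\mathrm{Irr}}\dim\mathcal C(z,x\otimes y)\,z$, involution the conjugate-linear extension of $x^*=\overline x$, and unit $\mathbbm 1$. Tube algebra: $\mathcal A=\bigoplus_{x,y\in\mathrm{Irr}}\mathcal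 A_{x,y}$, $\mathcal A_{x,y}=\bigoplus_{w\in\mathrm{Irr}}\mathcal A^w_{x,y}$, $\mathcal A^w_{x,y}=\mathcal C(w\otimes x,y\otimes w)$. For an object $z$ and $\gamma\in\mathcal C(z\otimes x,y\otimes z)$, let $\Psi^z_{x,y}(\gamma)\in\mathcal A_{x,y}$ be the element with $w$-component $\sum_{\alpha}(1_y\otimes\alpha^* )\gamma(\alpha\otimes 1_x)$, where $\alpha$ runs over an orthonormal basis of $\mathcal C(w,z)$ for the inner product $\tau^*\sigma=\langle\sigma,\tau\rangle 1_w$. Every element of $\mathcal A_{x,y}$ is of this form for some $z,\gamma$. $\mathcal A$ is a $*$-algebra via the (well-defined) operations $\Psi^{z_1}_{x_1,y_1}(\gamma_1)\cdot\Psi^{z_2}_{x_2,y_2}(\gamma_2)=\delta_{x_1=y_2}\Psi^{z_1\otimes z_2}_{x_2,y_1}\big((\gamma_1\otimes 1_{z_2})(1_{z_1}\otimes\gamma_2)\big)\in\mathcal A_{x_2,y_1}$ and $\Psi^z_{x,y}(\gamma)^*=\Psi^{\overline z}_{y,x}\big((R_z^*\otimes 1_x\otimes 1_{\overline z})(1_{\overline z}\otimes\gamma^*\otimes 1_{\overline z})(1_{\overline z}\otimes 1_y\otimes\overline R_z)\big)\in\mathcal A_{y,x}$. The map $w\mapsto\Psi^w_{\mathbbm 1,\mathbbm 1}(1_w)$ ($w\in\mathrm{Irr}$) is a unital $*$-isomorphism $\mathbb C[\mathcal C]\cong\mathcal A_{\mathbbm 1,\mathbbm 1}$, used as an identification.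 Tube cone: $\Sigma^2\mathcal C=\{\sum_{i=1}^n a_ia_i^*: n\in\mathbb N,\ a_i\in\mathcal A_{x_i,\mathbbm 1}\text{ for some }x_i\in\mathrm{Irr}\}\subseteq\mathbb C[\mathcal C]$. *)

theory Defs
  imports Complex_Main "HOL-Library.Countable_Set"
begin

text \<open>
  The data of a small C*-tensor category. All morphism spaces \<open>Hom x y\<close> are complex
  subspaces of one ambient normed space \<open>'m\<close>, whose addition, zero and norm they inherit; no
  relation between different morphism spaces is imposed. This is no restriction: for \<open>'m\<close> one can
  take the algebraic direct sum of all morphism spaces with the \<open>l\<^sup>1\<close>-norm, on which composition,
  adjoint and tensor product extend (bi)additively. Composition is written in the usual order, so
  \<open>g \<cdot> f\<close> is defined for \<open>f \<in> Hom x y\<close> and \<open>g \<in> Hom y z\<close>.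
\<close>

record ('o, 'm) tensor_cat =
  Ob    :: "'o set"
  Hom   :: "'o \<Rightarrow> 'o \<Rightarrow> 'm set"
  ident :: "'o \<Rightarrow> 'm"
  comp  :: "'m \<Rightarrow> 'm \<Rightarrow> 'm"  (infixl "\<cdot>\<index>" 70)
  scale :: "complex \<Rightarrow> 'm \<Rightarrow> 'm"  (infixr "\<odot>\<index>" 75)
  adj   :: "'m \<Rightarrow> 'm"
  unit  :: "'o"  ("\<one>\<index>")
  otens :: "'o \<Rightarrow> 'o \<Rightarrow> 'o"  (infixr "\<otimes>\<index>" 80)
  mtens :: "'m \<Rightarrow> 'm \<Rightarrow> 'm"  (infixr "\<boxtimes>\<index>" 80)

locale tensor_cat_data =
  fixes C :: "('o, 'm::real_normed_vector) tensor_cat" (structure)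
begin

abbreviation hom :: "'o \<Rightarrow> 'o \<Rightarrow> 'm set" where "hom \<equiv> Hom C"
abbreviation idm :: "'o \<Rightarrow> 'm" where "idm \<equiv> ident C"
abbreviation star :: "'m \<Rightarrow> 'm" where "star \<equiv> adj C"

definition iso :: "'o \<Rightarrow> 'o \<Rightarrow> bool" where
  "iso x y \<longleftrightarrow> (\<exists>f\<in>hom x y. \<exists>g\<in>hom y x. g \<cdot> f = idm x \<and> f \<cdot> g = idm y)"

definition simple :: "'o \<Rightarrow> bool" where
  "simple x \<longleftrightarrow> x \<in> Ob C \<and> idm x \<noteq> 0 \<and> hom x x = range (\<lambda>c. c \<odot> idm x)"

definition conjugate_solution :: "'o \<Rightarrow> 'o \<Rightarrow> 'm \<Rightarrow> 'm \<Rightarrow> bool" where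
  "conjugate_solution x xb r rb \<longleftrightarrow>
     xb \<in> Ob C \<and> r \<in> hom \<one> (xb \<otimes> x) \<and> rb \<in> hom \<one> (x \<otimes> xb) \<and>
     (idm xb \<boxtimes> star rb) \<cdot> (r \<boxtimes> idm xb) = idm xb \<and>
     (idm x \<boxtimes> star r) \<cdot> (rb \<boxtimes> idm x) = idm x"

definition standard_solution :: "'o \<Rightarrow> 'o \<Rightarrow> 'm \<Rightarrow> 'm \<Rightarrow> bool" where
  "standard_solution x xb r rb \<longleftrightarrow>
     conjugate_solution x xb r rb \<and>
     (\<forall>f\<in>hom x x. star r \<cdot> (idm xb \<boxtimes> f) \<cdot> r = star rb \<cdot> (f \<boxtimes> idm xb) \<cdot> rb)"

text \<open>\<open>B\<close> is an orthonormal basis of \<open>hom w z\<close> (with \<open>w\<close> simple) for the inner product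
  determined by \<open>star \<tau> \<cdot> \<sigma> = \<langle>\<sigma>, \<tau>\<rangle> \<odot> idm w\<close>.\<close>

definition onb :: "'o \<Rightarrow> 'o \<Rightarrow> 'm set \<Rightarrow> bool" where
  "onb w z B \<longleftrightarrow>
     finite B \<and> B \<subseteq> hom w z \<and> module.span (scale C) B = hom w z \<and>
     (\<forall>\<sigma>\<in>B. \<forall>\<tau>\<in>B. star \<tau> \<cdot> \<sigma> = (if \<sigma> = \<tau> then 1 else 0) \<odot> idm w)"

definition irr_representatives :: "'o set \<Rightarrow> bool" where
  "irr_representatives I \<longleftrightarrow>
     (\<forall>x\<in>I. simple x) \<and> \<one> \<in> I \<and> (\<forall>x. simple x \<longrightarrow> (\<exists>!y. y \<in> I \<and> iso x y))"

end

locale cstar_tensor_category = tensor_cat_data C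
  for C :: "('o, 'm::real_normed_vector) tensor_cat" (structure) +
  assumes vector_space_scale: "vector_space (scale C)"
    and scale_of_real: "complex_of_real t \<odot> f = t *\<^sub>R f"
    and norm_scale: "norm (c \<odot> f) = cmod c * norm f"
    and hom_subspace: "x \<in> Ob C \<Longrightarrow> y \<in> Ob C \<Longrightarrow> module.subspace (scale C) (hom x y)"
    and hom_complete: "x \<in> Ob C \<Longrightarrow> y \<in> Ob C \<Longrightarrow> complete (hom x y)"
    and ident_in: "x \<in> Ob C \<Longrightarrow> idm x \<in> hom x x"
    and comp_in: "\<lbrakk>x \<in> Ob C; y \<in> Ob C; z \<in> Ob C; f \<in> hom x y; g \<in> hom y z\<rbrakk>
      \<Longrightarrow> g \<cdot> f \<in> hom x z"
    and comp_ident_right: "\<lbrakk>x \<in> Ob C; y \<in> Ob C; f \<in> hom x y\<rbrakk> \<Longrightarrow> f \<cdot> idm x = f"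
    and comp_ident_left: "\<lbrakk>x \<in> Ob C; y \<in> Ob C; f \<in> hom x y\<rbrakk> \<Longrightarrow> idm y \<cdot> f = f"
    and comp_assoc: "\<lbrakk>x \<in> Ob C; y \<in> Ob C; z \<in> Ob C; u \<in> Ob C;
        f \<in> hom x y; g \<in> hom y z; h \<in> hom z u\<rbrakk> \<Longrightarrow> (h \<cdot> g) \<cdot> f = h \<cdot> (g \<cdot> f)"
    and comp_add_right: "\<lbrakk>x \<in> Ob C; y \<in> Ob C; z \<in> Ob C; f \<in> hom x y; f' \<in> hom x y; g \<in> hom y z\<rbrakk>
      \<Longrightarrow> g \<cdot> (f + f') = g \<cdot> f + g \<cdot> f'"
    and comp_add_left: "\<lbrakk>x \<in> Ob C; y \<in> Ob C; z \<in> Ob C; f \<in> hom x y; g \<in> hom y z; g' \<in> hom y z\<rbrakk>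
      \<Longrightarrow> (g + g') \<cdot> f = g \<cdot> f + g' \<cdot> f"
    and comp_scale_right: "\<lbrakk>x \<in> Ob C; y \<in> Ob C; z \<in> Ob C; f \<in> hom x y; g \<in> hom y z\<rbrakk>
      \<Longrightarrow> g \<cdot> (c \<odot> f) = c \<odot> (g \<cdot> f)"
    and comp_scale_left: "\<lbrakk>x \<in> Ob C; y \<in> Ob C; z \<in> Ob C; f \<in> hom x y; g \<in> hom y z\<rbrakk>
      \<Longrightarrow> (c \<odot> g) \<cdot> f = c \<odot> (g \<cdot> f)"
    and norm_comp: "\<lbrakk>x \<in> Ob C; y \<in> Ob C; z \<in> Ob C; f \<in> hom x y; g \<in> hom y z\<rbrakk>
      \<Longrightarrow> norm (g \<cdot> f) \<le> norm g * norm f"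
    and star_in: "\<lbrakk>x \<in> Ob C; y \<in> Ob C; f \<in> hom x y\<rbrakk> \<Longrightarrow> star f \<in> hom y x"
    and star_star: "\<lbrakk>x \<in> Ob C; y \<in> Ob C; f \<in> hom x y\<rbrakk> \<Longrightarrow> star (star f) = f"
    and star_comp: "\<lbrakk>x \<in> Ob C; y \<in> Ob C; z \<in> Ob C; f \<in> hom x y; g \<in> hom y z\<rbrakk>
      \<Longrightarrow> star (g \<cdot> f) = star f \<cdot> star g"
    and star_add: "\<lbrakk>x \<in> Ob C; y \<in> Ob C; f \<in> hom x y; f' \<in> hom x y\<rbrakk>
      \<Longrightarrow> star (f + f') = star f + star f'"
    and star_scale: "\<lbrakk>x \<in> Ob C; y \<in> Ob C; f \<in> hom x y\<rbrakk> \<Longrightarrow> star (c \<odot> f) = cnj c \<odot> star f"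
    and cstar_identity: "\<lbrakk>x \<in> Ob C; y \<in> Ob C; f \<in> hom x y\<rbrakk> \<Longrightarrow> norm (star f \<cdot> f) = (norm f)\<^sup>2"
    and star_comp_positive: "\<lbrakk>x \<in> Ob C; y \<in> Ob C; f \<in> hom x y\<rbrakk>
      \<Longrightarrow> \<exists>h\<in>hom x x. star f \<cdot> f = star h \<cdot> h"
    and unit_in: "\<one> \<in> Ob C"
    and otens_in: "\<lbrakk>x \<in> Ob C; y \<in> Ob C\<rbrakk> \<Longrightarrow> x \<otimes> y \<in> Ob C"
    and otens_assoc: "\<lbrakk>x \<in> Ob C; y \<in> Ob C; z \<in> Ob C\<rbrakk> \<Longrightarrow> (x \<otimes> y) \<otimes> z = x \<otimes> (y \<otimes> z)"
    and otens_unit_left: "x \<in> Ob C \<Longrightarrow> \<one> \<otimes> x = x"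
    and otens_unit_right: "x \<in> Ob C \<Longrightarrow> x \<otimes> \<one> = x"
    and mtens_in: "\<lbrakk>x \<in> Ob C; y \<in> Ob C; x' \<in> Ob C; y' \<in> Ob C; f \<in> hom x y; f' \<in> hom x' y'\<rbrakk>
      \<Longrightarrow> f \<boxtimes> f' \<in> hom (x \<otimes> x') (y \<otimes> y')"
    and mtens_ident: "\<lbrakk>x \<in> Ob C; y \<in> Ob C\<rbrakk> \<Longrightarrow> idm x \<boxtimes> idm y = idm (x \<otimes> y)"
    and mtens_comp: "\<lbrakk>x \<in> Ob C; y \<in> Ob C; z \<in> Ob C; x' \<in> Ob C; y' \<in> Ob C; z' \<in> Ob C;
        f \<in> hom x y; g \<in> hom y z; f' \<in> hom x' y'; g' \<in> hom y' z'\<rbrakk>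
      \<Longrightarrow> (g \<cdot> f) \<boxtimes> (g' \<cdot> f') = (g \<boxtimes> g') \<cdot> (f \<boxtimes> f')"
    and mtens_add_left: "\<lbrakk>x \<in> Ob C; y \<in> Ob C; x' \<in> Ob C; y' \<in> Ob C;
        f \<in> hom x y; g \<in> hom x y; f' \<in> hom x' y'\<rbrakk>
      \<Longrightarrow> (f + g) \<boxtimes> f' = f \<boxtimes> f' + g \<boxtimes> f'"
    and mtens_add_right: "\<lbrakk>x \<in> Ob C; y \<in> Ob C; x' \<in> Ob C; y' \<in> Ob C;
        f \<in> hom x y; f' \<in> hom x' y'; g' \<in> hom x' y'\<rbrakk>
      \<Longrightarrow> f \<boxtimes> (f' + g') = f \<boxtimes> f' + f \<boxtimes> g'"
    and mtens_scale_left: "\<lbrakk>x \<in> Ob C; y \<in> Ob C; x' \<in> Ob C; y' \<in> Ob C; f \<in> hom x y; f' \<in> hom x' y'\<rbrakk>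
      \<Longrightarrow> (c \<odot> f) \<boxtimes> f' = c \<odot> (f \<boxtimes> f')"
    and mtens_scale_right: "\<lbrakk>x \<in> Ob C; y \<in> Ob C; x' \<in> Ob C; y' \<in> Ob C; f \<in> hom x y; f' \<in> hom x' y'\<rbrakk>
      \<Longrightarrow> f \<boxtimes> (c \<odot> f') = c \<odot> (f \<boxtimes> f')"
    and mtens_star: "\<lbrakk>x \<in> Ob C; y \<in> Ob C; x' \<in> Ob C; y' \<in> Ob C; f \<in> hom x y; f' \<in> hom x' y'\<rbrakk>
      \<Longrightarrow> star (f \<boxtimes> f') = star f \<boxtimes> star f'"
    and mtens_assoc: "\<lbrakk>x \<in> Ob C; y \<in> Ob C; x' \<in> Ob C; y' \<in> Ob C; x'' \<in> Ob C; y'' \<in> Ob C;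
        f \<in> hom x y; f' \<in> hom x' y'; f'' \<in> hom x'' y''\<rbrakk>
      \<Longrightarrow> (f \<boxtimes> f') \<boxtimes> f'' = f \<boxtimes> (f' \<boxtimes> f'')"
    and mtens_unit_left: "\<lbrakk>x \<in> Ob C; y \<in> Ob C; f \<in> hom x y\<rbrakk> \<Longrightarrow> idm \<one> \<boxtimes> f = f"
    and mtens_unit_right: "\<lbrakk>x \<in> Ob C; y \<in> Ob C; f \<in> hom x y\<rbrakk> \<Longrightarrow> f \<boxtimes> idm \<one> = f"
  \<comment> \<open>the empty direct sum is the sub-object of the projection \<open>0\<close>\<close>
    and direct_sums: "\<lbrakk>x \<in> Ob C; y \<in> Ob C\<rbrakk> \<Longrightarrow>
      \<exists>s\<in>Ob C. \<exists>u\<in>hom x s. \<exists>v\<in>hom y s.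
        star u \<cdot> u = idm x \<and> star v \<cdot> v = idm y \<and> u \<cdot> star u + v \<cdot> star v = idm s"
    and subobjects: "\<lbrakk>x \<in> Ob C; p \<in> hom x x; p \<cdot> p = p; star p = p\<rbrakk> \<Longrightarrow>
      \<exists>s\<in>Ob C. \<exists>v\<in>hom s x. star v \<cdot> v = idm s \<and> v \<cdot> star v = p"

locale rigid_cstar_tensor_category = cstar_tensor_category C
  for C :: "('o, 'm::real_normed_vector) tensor_cat" (structure) +
  assumes rigid: "x \<in> Ob C \<Longrightarrow> \<exists>xb r rb. conjugate_solution x xb r rb"

text \<open>
  The tube algebra and its cone, for a set \<open>Irr\<close> of representatives of the simple objects and a
  choice of conjugates \<open>cj x\<close> and of solutions \<open>(R x, Rb x)\<close> of the conjugate equations for every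
  object \<open>x\<close>. Elements of the block \<open>A\<^bsub>x,y\<^esub>\<close> are the families of their components
  \<open>a w \<in> hom (w \<otimes> x) (y \<otimes> w)\<close>, \<open>w \<in> Irr\<close>, extended by zero; elements of the fusion algebra are
  the families of their coefficients in the basis \<open>Irr\<close>.
\<close>

locale tube_data = tensor_cat_data C
  for C :: "('o, 'm::real_normed_vector) tensor_cat" (structure) +
  fixes Irr :: "'o set" and cj :: "'o \<Rightarrow> 'o" and R Rb :: "'o \<Rightarrow> 'm"
begin

definition fusion_algebra :: "('o \<Rightarrow> complex) set" where
  "fusion_algebra = {a. finite {x. a x \<noteq> 0} \<and> {x. a x \<noteq> 0} \<subseteq> Irr}"

definition fusion_one :: "'o \<Rightarrow> complex" where
  "fusion_one x = (if x = \<one> then 1 else 0)"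

definition irr_conj :: "'o \<Rightarrow> 'o" where
  "irr_conj x = (THE y. y \<in> Irr \<and> iso (cj x) y)"

definition fusion_star :: "('o \<Rightarrow> complex) \<Rightarrow> 'o \<Rightarrow> complex" where
  "fusion_star a y = (\<Sum>x | a x \<noteq> 0 \<and> irr_conj x = y. cnj (a x))"

definition tube_space :: "'o \<Rightarrow> 'o \<Rightarrow> ('o \<Rightarrow> 'm) set" where
  "tube_space x y =
     {a. (\<forall>w\<in>Irr. a w \<in> hom (w \<otimes> x) (y \<otimes> w)) \<and> (\<forall>w. w \<notin> Irr \<longrightarrow> a w = 0) \<and>
         finite {w. a w \<noteq> 0}}"

text \<open>Independent of the choice of the orthonormal bases.\<close>

definition Psi :: "'o \<Rightarrow> 'o \<Rightarrow> 'o \<Rightarrow> 'm \<Rightarrow> 'o \<Rightarrow> 'm" where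
  "Psi x y z \<gamma> w =
     (if w \<in> Irr
      then \<Sum>\<alpha>\<in>(SOME B. onb w z B). (idm y \<boxtimes> star \<alpha>) \<cdot> \<gamma> \<cdot> (\<alpha> \<boxtimes> idm x)
      else 0)"

text \<open>Product \<open>A\<^bsub>y,t\<^esub> \<times> A\<^bsub>x,y\<^esub> \<rightarrow> A\<^bsub>x,t\<^esub>\<close> and involution \<open>A\<^bsub>x,y\<^esub> \<rightarrow> A\<^bsub>y,x\<^esub>\<close>: the elements given by
  the formulas on representatives \<open>(z, \<gamma>)\<close> of the arguments, on which they do not depend.\<close>

definition tube_mult :: "'o \<Rightarrow> 'o \<Rightarrow> 'o \<Rightarrow> ('o \<Rightarrow> 'm) \<Rightarrow> ('o \<Rightarrow> 'm) \<Rightarrow> 'o \<Rightarrow> 'm" where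
  "tube_mult x y t a b =
     (THE c. \<exists>z1\<in>Ob C. \<exists>\<gamma>1\<in>hom (z1 \<otimes> y) (t \<otimes> z1).
             \<exists>z2\<in>Ob C. \<exists>\<gamma>2\<in>hom (z2 \<otimes> x) (y \<otimes> z2).
               a = Psi y t z1 \<gamma>1 \<and> b = Psi x y z2 \<gamma>2 \<and>
               c = Psi x t (z1 \<otimes> z2) ((\<gamma>1 \<boxtimes> idm z2) \<cdot> (idm z1 \<boxtimes> \<gamma>2)))"

definition tube_star :: "'o \<Rightarrow> 'o \<Rightarrow> ('o \<Rightarrow> 'm) \<Rightarrow> 'o \<Rightarrow> 'm" where
  "tube_star x y a =
     (THE c. \<exists>z\<in>Ob C. \<exists>\<gamma>\<in>hom (z \<otimes> x) (y \<otimes> z).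
               a = Psi x y z \<gamma> \<and>
               c = Psi y x (cj z)
                     ((star (R z) \<boxtimes> idm x \<boxtimes> idm (cj z)) \<cdot>
                      (idm (cj z) \<boxtimes> star \<gamma> \<boxtimes> idm (cj z)) \<cdot>
                      (idm (cj z) \<boxtimes> idm y \<boxtimes> Rb z)))"

text \<open>The isomorphism \<open>w \<mapsto> \<Psi> (1\<^sub>w)\<close> onto \<open>A\<^bsub>\<one>,\<one>\<^esub>\<close>, used as an identification.\<close>

definition fusion_to_tube :: "('o \<Rightarrow> complex) \<Rightarrow> 'o \<Rightarrow> 'm" where
  "fusion_to_tube a v = (\<Sum>w | a w \<noteq> 0. a w \<odot> Psi \<one> \<one> w (idm w) v)"

definition tube_cone :: "('o \<Rightarrow> complex) set" where
  "tube_cone =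
     {c \<in> fusion_algebra.
        \<exists>(n::nat) x a.
          (\<forall>i<n. x i \<in> Irr \<and> a i \<in> tube_space (x i) \<one>) \<and>
          fusion_to_tube c =
            (\<lambda>v. \<Sum>i<n. tube_mult \<one> (x i) \<one> (a i) (tube_star (x i) \<one> (a i)) v)}"

end

end

theory Submission
  imports Defs "HOL-Computational_Algebra.Fundamental_Theorem_Algebra"
begin

text \<open>
  Why the unit is an order unit. Write \<open>[z]\<close> for the class \<open>\<Psi>\<^sup>z(1\<^sub>z)\<close> of an object; in particular
  \<open>[w] [w']\<^sup>* = [w \<otimes> cj w']\<close>. A self-adjoint element is half the sum, over the \<open>w\<close> in its support
  with coefficient \<open>c\<close>, of \<open>c [w] + cnj c [cj w]\<close>, so it is enough to add a multiple of \<open>1\<close> to each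
  of these. From \<open>(1 + c [w]) (1 + c [w])\<^sup>* = 1 + c [w] + cnj c [cj w] + \<bar>c\<bar>\<^sup>2 [w \<otimes> cj w]\<close>
  (\<open>square_unit_plus_class\<close>) it follows that only the products \<open>[w \<otimes> cj w]\<close> have to be bounded
  above by a multiple of \<open>1\<close>.

  This bound is where corners other than \<open>A\<^bsub>\<one>,\<one>\<^esub>\<close> enter. A morphism \<open>\<xi> : x \<rightarrow> cj w \<otimes> w\<close> with \<open>x\<close> simple has
  by Frobenius reciprocity a mate \<open>w \<otimes> x \<rightarrow> w\<close>, hence gives an element \<open>a\<^sub>\<xi>\<close> of \<open>A\<^bsub>x,\<one>\<^esub>\<close>; and
  \<open>a\<^sub>\<xi> a\<^sub>\<xi>\<^sup>*\<close> is the image of \<open>\<xi> \<xi>\<^sup>*\<close> under a linear map, \<open>bend w\<close> followed by \<open>\<Psi>\<close>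
  (\<open>bend_frobenius_mate\<close>). Every projection of \<open>End (cj w \<otimes> w)\<close> is a sum of such \<open>\<xi> \<xi>\<^sup>*\<close>, by
  semisimplicity, so its image lies in the cone (\<open>bend_projection_in_cone\<close>). The identity is sent to
  \<open>\<parallel>Rb w\<parallel>\<^sup>2 1\<close> and \<open>R w (R w)\<^sup>*\<close> to \<open>[w \<otimes> cj w]\<close>. Applied to the projection
  \<open>1 - R w (R w)\<^sup>* / \<parallel>R w\<parallel>\<^sup>2\<close> this says that \<open>\<parallel>R w\<parallel>\<^sup>2 \<parallel>Rb w\<parallel>\<^sup>2 1 - [w \<otimes> cj w]\<close> is in the cone
  (\<open>unit_minus_mult_star_in_cone\<close>).

  Two foundations have to be laid. Semisimplicity is derived from rigidity: orthogonal projections of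
  an object are bounded in number (\<open>card_orthogonal_projections_le\<close>), which makes the relevant morphism
  spaces finite-dimensional, and a finite-dimensional spectral argument shows that objects without
  proper projections are simple (\<open>simpleI\<close>). Well-definedness of product and involution of the tube
  algebra is reduced to a universal property of \<open>\<Psi>\<close> (\<open>Psi_universal\<close>): every additive function of
  pairs \<open>(z, \<gamma>)\<close> with the trace property factors through \<open>\<Psi>\<close>.
\<close>

section \<open>Linear algebra of the morphism spaces\<close>

context cstar_tensor_category
begin

interpretation V: vector_space "scale C"
  by (rule vector_space_scale)

lemma hom_zero: "x \<in> Ob C \<Longrightarrow> y \<in> Ob C \<Longrightarrow> 0 \<in> hom x y"
  using V.subspace_0 hom_subspace by blast

lemma hom_add: "x \<in> Ob C \<Longrightarrow> y \<in> Ob C \<Longrightarrow> f \<in> hom x y \<Longrightarrow> g \<in> hom x y \<Longrightarrow> f + g \<in> hom x y"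
  using V.subspace_add hom_subspace by blast

lemma hom_scale: "x \<in> Ob C \<Longrightarrow> y \<in> Ob C \<Longrightarrow> f \<in> hom x y \<Longrightarrow> c \<odot> f \<in> hom x y"
  using V.subspace_scale hom_subspace by blast

lemma hom_diff: "x \<in> Ob C \<Longrightarrow> y \<in> Ob C \<Longrightarrow> f \<in> hom x y \<Longrightarrow> g \<in> hom x y \<Longrightarrow> f - g \<in> hom x y"
  using V.subspace_diff hom_subspace by blast

lemma hom_sum: "x \<in> Ob C \<Longrightarrow> y \<in> Ob C \<Longrightarrow> (\<And>i. i \<in> A \<Longrightarrow> f i \<in> hom x y) \<Longrightarrow> sum f A \<in> hom x y"
  using V.subspace_sum hom_subspace by blast

lemma comp_zero_left: "\<lbrakk>x \<in> Ob C; y \<in> Ob C; z \<in> Ob C; f \<in> hom x y\<rbrakk> \<Longrightarrow> 0 \<cdot> f = 0"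
  using comp_add_left[of x y z f 0 0] hom_zero by simp

lemma comp_zero_right: "\<lbrakk>x \<in> Ob C; y \<in> Ob C; z \<in> Ob C; g \<in> hom y z\<rbrakk> \<Longrightarrow> g \<cdot> 0 = 0"
  using comp_add_right[of x y z 0 0 g] hom_zero by simp

lemma comp_sum_right:
  assumes "x \<in> Ob C" "y \<in> Ob C" "z \<in> Ob C" "g \<in> hom y z" "\<And>i. i \<in> A \<Longrightarrow> f i \<in> hom x y"
  shows "g \<cdot> sum f A = (\<Sum>i\<in>A. g \<cdot> f i)"
  using assms
  by (induction A rule: infinite_finite_induct)
    (auto simp: comp_zero_right comp_add_right[of x y z] hom_sum)

lemma comp_sum_left:
  assumes "x \<in> Ob C" "y \<in> Ob C" "z \<in> Ob C" "f \<in> hom x y" "\<And>i. i \<in> A \<Longrightarrow> g i \<in> hom y z"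
  shows "sum g A \<cdot> f = (\<Sum>i\<in>A. g i \<cdot> f)"
  using assms
  by (induction A rule: infinite_finite_induct)
    (auto simp: comp_zero_left comp_add_left[of x y z] hom_sum)

lemma comp_diff_right:
  assumes "x \<in> Ob C" "y \<in> Ob C" "z \<in> Ob C" "f \<in> hom x y" "f' \<in> hom x y" "g \<in> hom y z"
  shows "g \<cdot> (f - f') = g \<cdot> f - g \<cdot> f'"
  using comp_add_right[of x y z "f - f'" f' g] assms
  by (simp add: hom_diff algebra_simps)

lemma comp_diff_left:
  assumes "x \<in> Ob C" "y \<in> Ob C" "z \<in> Ob C" "f \<in> hom x y" "g \<in> hom y z" "g' \<in> hom y z"
  shows "(g - g') \<cdot> f = g \<cdot> f - g' \<cdot> f"
  using comp_add_left[of x y z f "g - g'" g'] assms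
  by (simp add: hom_diff algebra_simps)

lemma star_zero: "x \<in> Ob C \<Longrightarrow> y \<in> Ob C \<Longrightarrow> star 0 = 0"
  using star_add[of x y 0 0] hom_zero by simp

lemma star_sum:
  assumes "x \<in> Ob C" "y \<in> Ob C" "\<And>i. i \<in> A \<Longrightarrow> f i \<in> hom x y"
  shows "star (sum f A) = (\<Sum>i\<in>A. star (f i))"
  using assms
  by (induction A rule: infinite_finite_induct)
    (auto simp: star_zero[of x y] star_add[of x y] hom_sum)

lemma star_diff:
  assumes "x \<in> Ob C" "y \<in> Ob C" "f \<in> hom x y" "g \<in> hom x y"
  shows "star (f - g) = star f - star g"
  using star_add[of x y "f - g" g] assms
  by (simp add: hom_diff algebra_simps)

lemma star_ident: "x \<in> Ob C \<Longrightarrow> star (idm x) = idm x"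
  by (metis comp_ident_left comp_ident_right ident_in star_comp star_in star_star)

lemma mtens_zero_left:
  assumes "x \<in> Ob C" "y \<in> Ob C" "x' \<in> Ob C" "y' \<in> Ob C" "f' \<in> hom x' y'"
  shows "0 \<boxtimes> f' = 0"
  using mtens_add_left[of x y x' y' 0 0 f'] assms hom_zero by simp

lemma mtens_zero_right:
  assumes "x \<in> Ob C" "y \<in> Ob C" "x' \<in> Ob C" "y' \<in> Ob C" "f \<in> hom x y"
  shows "f \<boxtimes> 0 = 0"
  using mtens_add_right[of x y x' y' f 0 0] assms hom_zero by simp

lemma mtens_sum_left:
  assumes "x \<in> Ob C" "y \<in> Ob C" "x' \<in> Ob C" "y' \<in> Ob C" "f' \<in> hom x' y'"
    and "\<And>i. i \<in> A \<Longrightarrow> f i \<in> hom x y"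
  shows "sum f A \<boxtimes> f' = (\<Sum>i\<in>A. f i \<boxtimes> f')"
  using assms
  by (induction A rule: infinite_finite_induct)
    (auto simp: mtens_zero_left[of x y x' y'] mtens_add_left[of x y x' y'] hom_sum)

lemma mtens_sum_right:
  assumes "x \<in> Ob C" "y \<in> Ob C" "x' \<in> Ob C" "y' \<in> Ob C" "f \<in> hom x y"
    and "\<And>i. i \<in> A \<Longrightarrow> f' i \<in> hom x' y'"
  shows "f \<boxtimes> sum f' A = (\<Sum>i\<in>A. f \<boxtimes> f' i)"
  using assms
  by (induction A rule: infinite_finite_induct)
    (auto simp: mtens_zero_right[of x y x' y'] mtens_add_right[of x y x' y'] hom_sum)

lemma star_comp_eq_0_iff:
  assumes "x \<in> Ob C" "y \<in> Ob C" "f \<in> hom x y"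
  shows "star f \<cdot> f = 0 \<longleftrightarrow> f = 0"
  using cstar_identity[OF assms] comp_zero_right[OF assms(1,2,1) star_in[OF assms]]
  by auto

lemma norm_star:
  assumes "x \<in> Ob C" "y \<in> Ob C" "f \<in> hom x y"
  shows "norm (star f) = norm f"
proof -
  have *: "norm g \<le> norm (star g)" if "x \<in> Ob C" "y \<in> Ob C" "g \<in> hom x y" for g x y
  proof (cases "g = 0")
    case False
    have "norm g * norm g \<le> norm (star g) * norm g"
      using cstar_identity[OF that] norm_comp[OF that(1,2,1,3) star_in[OF that]]
      by (simp add: power2_eq_square)
    with False show ?thesis by simp
  qed (simp)
  show ?thesis
    using *[OF assms] *[OF assms(2,1) star_in[OF assms]] star_star[OF assms] by simp
qed

lemma norm_ident: "x \<in> Ob C \<Longrightarrow> idm x \<noteq> 0 \<Longrightarrow> norm (idm x) = 1"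
  using cstar_identity[of x x "idm x"]
  by (simp add: ident_in comp_ident_left star_ident power2_eq_square)

lemma ident_zero_imp_hom_zero:
  assumes "x \<in> Ob C" "y \<in> Ob C" "f \<in> hom x y" "idm x = 0 \<or> idm y = 0"
  shows "f = 0"
  using assms(4)
proof
  assume "idm x = 0"
  then show ?thesis
    using comp_ident_right[OF assms(1-3)] comp_zero_right[OF assms(1,1,2,3)] by metis
next
  assume "idm y = 0"
  then show ?thesis
    using comp_ident_left[OF assms(1-3)] comp_zero_left[OF assms(1,2,2,3)] by metis
qed


section \<open>Simple objects\<close>

lemma simple_Ob: "simple w \<Longrightarrow> w \<in> Ob C"
  and simple_ident: "simple w \<Longrightarrow> idm w \<noteq> 0"
  by (auto simp: simple_def)

lemma scale_ident_inject: "simple w \<Longrightarrow> (c \<odot> idm w = d \<odot> idm w) = (c = d)"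
  using simple_ident by simp

definition scalar :: "'o \<Rightarrow> 'm \<Rightarrow> complex" where
  "scalar w f = (SOME c. f = c \<odot> idm w)"

lemma scalar_scale_ident: "simple w \<Longrightarrow> f \<in> hom w w \<Longrightarrow> scalar w f \<odot> idm w = f"
  unfolding scalar_def simple_def by (metis (mono_tags, lifting) rangeE someI_ex)

lemma comp_scalar:
  assumes "simple w" "z \<in> Ob C" "\<alpha> \<in> hom w z" "f \<in> hom w w"
  shows "\<alpha> \<cdot> f = scalar w f \<odot> \<alpha>"
  using assms scalar_scale_ident[OF assms(1,4)] comp_scale_right[of w w z "idm w" \<alpha>]
    comp_ident_right ident_in simple_Ob
  by metis

lemma scalar_comp:
  assumes "simple w" "z \<in> Ob C" "\<alpha> \<in> hom z w" "f \<in> hom w w"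
  shows "f \<cdot> \<alpha> = scalar w f \<odot> \<alpha>"
  using assms scalar_scale_ident[OF assms(1,4)] comp_scale_left[of z w w \<alpha> "idm w"]
    comp_ident_left ident_in simple_Ob
  by metis

text \<open>On morphisms from a simple object the \<open>C\<^sup>*\<close>-norm is the norm of the inner product: \<open>star f \<cdot> f\<close>
  is a scalar, it is \<open>star h \<cdot> h\<close> for a scalar \<open>h\<close>, hence nonnegative, and its modulus is fixed by the
  \<open>C\<^sup>*\<close>-identity.\<close>

lemma star_comp_simple:
  assumes "simple w" "z \<in> Ob C" "f \<in> hom w z"
  shows "star f \<cdot> f = complex_of_real ((norm f)\<^sup>2) \<odot> idm w"
proof -
  note w = simple_Ob[OF assms(1)]
  obtain h where h: "h \<in> hom w w" "star f \<cdot> f = star h \<cdot> h"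
    using star_comp_positive[OF w assms(2,3)] by blast
  define c where "c = scalar w h"
  have hc: "h = c \<odot> idm w"
    unfolding c_def using scalar_scale_ident[OF assms(1) h(1)] by simp
  have eq: "star f \<cdot> f = (cnj c * c) \<odot> idm w"
    unfolding h(2) hc using w
    by (simp add: star_scale[of w w] ident_in star_ident comp_scale_left[of w w w]
        comp_scale_right[of w w w] comp_ident_left[of w w] hom_scale)
  have "(norm f)\<^sup>2 = (cmod c)\<^sup>2"
    using cstar_identity[OF w assms(2,3)] norm_ident[OF w simple_ident[OF assms(1)]]
    by (simp add: eq norm_scale norm_mult power2_eq_square)
  then show ?thesis
    by (simp add: eq complex_norm_square[symmetric] mult.commute del: of_real_power)
qed

end

section \<open>A calculus of string diagrams\<close>

text \<open>Different morphism spaces may overlap, so a bare morphism does not determine its source and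
  target. Arrows record them; then composability is an equation between objects that can be decided
  by rewriting, and the laws of the category become conditional rewrite rules.\<close>

datatype ('o, 'm) arrow = Arrow (src: 'o) (tgt: 'o) (mor: 'm)

context cstar_tensor_category
begin

definition arr :: "('o, 'm) arrow \<Rightarrow> bool" where
  "arr f \<longleftrightarrow> src f \<in> Ob C \<and> tgt f \<in> Ob C \<and> mor f \<in> hom (src f) (tgt f)"

definition cmp :: "('o, 'm) arrow \<Rightarrow> ('o, 'm) arrow \<Rightarrow> ('o, 'm) arrow" (infixr "\<bullet>" 70) where
  "g \<bullet> f = Arrow (src f) (tgt g) (mor g \<cdot> mor f)"

definition tns :: "('o, 'm) arrow \<Rightarrow> ('o, 'm) arrow \<Rightarrow> ('o, 'm) arrow" (infixr "**" 80) where
  "f ** g = Arrow (src f \<otimes> src g) (tgt f \<otimes> tgt g) (mor f \<boxtimes> mor g)"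

definition dag :: "('o, 'm) arrow \<Rightarrow> ('o, 'm) arrow" where
  "dag f = Arrow (tgt f) (src f) (star (mor f))"

definition idt :: "'o \<Rightarrow> ('o, 'm) arrow" where
  "idt x = Arrow x x (idm x)"

lemma arrow_src_tgt [simp]:
  "src (g \<bullet> f) = src f" "tgt (g \<bullet> f) = tgt g"
  "src (f ** g) = src f \<otimes> src g" "tgt (f ** g) = tgt f \<otimes> tgt g"
  "src (dag f) = tgt f" "tgt (dag f) = src f" "src (idt x) = x" "tgt (idt x) = x"
  by (simp_all add: cmp_def tns_def dag_def idt_def)

lemma arrow_mor:
  "mor (g \<bullet> f) = mor g \<cdot> mor f" "mor (f ** g) = mor f \<boxtimes> mor g"
  "mor (dag f) = star (mor f)" "mor (idt x) = idm x"
  by (simp_all add: cmp_def tns_def dag_def idt_def)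

lemma arr_Ob: "arr f \<Longrightarrow> src f \<in> Ob C" "arr f \<Longrightarrow> tgt f \<in> Ob C"
  by (simp_all add: arr_def)

lemma arr_Arrow: "arr (Arrow x y f) \<longleftrightarrow> x \<in> Ob C \<and> y \<in> Ob C \<and> f \<in> hom x y"
  by (simp add: arr_def)

lemma arr_idt [simp]: "x \<in> Ob C \<Longrightarrow> arr (idt x)"
  by (simp add: arr_def idt_def ident_in)

lemma arr_cmp [simp]: "arr f \<Longrightarrow> arr g \<Longrightarrow> tgt f = src g \<Longrightarrow> arr (g \<bullet> f)"
  using comp_in[of "src f" "tgt f" "tgt g" "mor f" "mor g"] by (simp add: arr_def cmp_def)

lemma arr_tns [simp]: "arr f \<Longrightarrow> arr g \<Longrightarrow> arr (f ** g)"
  by (simp add: arr_def tns_def otens_in mtens_in)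

lemma arr_dag [simp]: "arr f \<Longrightarrow> arr (dag f)"
  by (simp add: arr_def dag_def star_in)

lemma Ob_tensor [simp]:
  "\<one> \<in> Ob C" "x \<in> Ob C \<Longrightarrow> y \<in> Ob C \<Longrightarrow> x \<otimes> y \<in> Ob C"
  "x \<in> Ob C \<Longrightarrow> \<one> \<otimes> x = x" "x \<in> Ob C \<Longrightarrow> x \<otimes> \<one> = x"
  "x \<in> Ob C \<Longrightarrow> y \<in> Ob C \<Longrightarrow> z \<in> Ob C \<Longrightarrow> (x \<otimes> y) \<otimes> z = x \<otimes> (y \<otimes> z)"
  by (simp_all add: unit_in otens_in otens_assoc otens_unit_left otens_unit_right)

lemma cmp_assoc [simp]:
  assumes "arr f" "arr g" "arr h" "tgt f = src g" "tgt g = src h"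
  shows "(h \<bullet> g) \<bullet> f = h \<bullet> g \<bullet> f"
  using comp_assoc[of "src f" "tgt f" "tgt g" "tgt h" "mor f" "mor g" "mor h"] assms
  by (simp add: arr_def cmp_def)

lemma cmp_idt [simp]:
  "arr f \<Longrightarrow> src f = x \<Longrightarrow> f \<bullet> idt x = f"
  "arr f \<Longrightarrow> tgt f = x \<Longrightarrow> idt x \<bullet> f = f"
  using comp_ident_right[of "src f" "tgt f" "mor f"] comp_ident_left[of "src f" "tgt f" "mor f"]
  by (cases f; simp add: arr_def cmp_def idt_def)+

lemma tns_assoc [simp]:
  "arr f \<Longrightarrow> arr g \<Longrightarrow> arr h \<Longrightarrow> (f ** g) ** h = f ** g ** h"
  using mtens_assoc[of "src f" "tgt f" "src g" "tgt g" "src h" "tgt h" "mor f" "mor g" "mor h"]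
  by (simp add: arr_def tns_def)

lemma tns_unit [simp]: "arr f \<Longrightarrow> idt \<one> ** f = f" "arr f \<Longrightarrow> f ** idt \<one> = f"
  using mtens_unit_left[of "src f" "tgt f" "mor f"] mtens_unit_right[of "src f" "tgt f" "mor f"]
  by (cases f; simp add: arr_def tns_def idt_def)+

lemma idt_otens [simp]: "x \<in> Ob C \<Longrightarrow> y \<in> Ob C \<Longrightarrow> idt (x \<otimes> y) = idt x ** idt y"
  by (simp add: idt_def tns_def mtens_ident)

lemma dag_simps [simp]:
  "arr f \<Longrightarrow> dag (dag f) = f"
  "x \<in> Ob C \<Longrightarrow> dag (idt x) = idt x"
  "arr f \<Longrightarrow> arr g \<Longrightarrow> dag (f ** g) = dag f ** dag g"
  "arr f \<Longrightarrow> arr g \<Longrightarrow> tgt f = src g \<Longrightarrow> dag (g \<bullet> f) = dag f \<bullet> dag g"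
  using star_star[of "src f" "tgt f" "mor f"] star_ident[of x]
    mtens_star[of "src f" "tgt f" "src g" "tgt g" "mor f" "mor g"]
    star_comp[of "src f" "tgt f" "tgt g" "mor f" "mor g"]
  by (cases f; cases g; simp add: arr_def tns_def dag_def cmp_def idt_def)+

lemma interchange:
  assumes "arr f" "arr g" "arr f'" "arr g'" "tgt f = src g" "tgt f' = src g'"
  shows "(g ** g') \<bullet> (f ** f') = (g \<bullet> f) ** (g' \<bullet> f')"
  using assms mtens_comp[of "src f" "tgt f" "tgt g" "src f'" "tgt f'" "tgt g'"
      "mor f" "mor g" "mor f'" "mor g'"]
  by (simp add: arr_def cmp_def tns_def)

declare arr_Ob [simp]

text \<open>Tensor products are normalised to the right, so a morphism on two strands meets its two
  neighbours as separate factors; the variants with three factors cover this case.\<close>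

lemma interchange_three:
  assumes "arr f" "arr a" "arr b" "arr c" "arr g"
  shows "tgt a \<otimes> tgt b = src f \<Longrightarrow> tgt c = src g \<Longrightarrow>
      (f ** g) \<bullet> (a ** b ** c) = (f \<bullet> (a ** b)) ** (g \<bullet> c)"
    and "src a \<otimes> src b = tgt f \<Longrightarrow> src c = tgt g \<Longrightarrow>
      (a ** b ** c) \<bullet> (f ** g) = ((a ** b) \<bullet> f) ** (c \<bullet> g)"
  using interchange[of "a ** b" f c g] interchange[of f "a ** b" g c] assms by simp_all

lemma conjugate_solution_arrows:
  assumes "conjugate_solution x xb r rb" "x \<in> Ob C"
  shows "xb \<in> Ob C" "arr (Arrow \<one> (xb \<otimes> x) r)" "arr (Arrow \<one> (x \<otimes> xb) rb)"
    and "(idt xb ** dag (Arrow \<one> (x \<otimes> xb) rb)) \<bullet> (Arrow \<one> (xb \<otimes> x) r ** idt xb) = idt xb"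
    and "(idt x ** dag (Arrow \<one> (xb \<otimes> x) r)) \<bullet> (Arrow \<one> (x \<otimes> xb) rb ** idt x) = idt x"
    and "(dag (Arrow \<one> (xb \<otimes> x) r) ** idt xb) \<bullet> (idt xb ** Arrow \<one> (x \<otimes> xb) rb) = idt xb"
    and "(dag (Arrow \<one> (x \<otimes> xb) rb) ** idt x) \<bullet> (idt x ** Arrow \<one> (xb \<otimes> x) r) = idt x"
proof -
  show *: "xb \<in> Ob C" "arr (Arrow \<one> (xb \<otimes> x) r)" "arr (Arrow \<one> (x \<otimes> xb) rb)"
    using assms by (simp_all add: conjugate_solution_def arr_def)
  show 1: "(idt xb ** dag (Arrow \<one> (x \<otimes> xb) rb)) \<bullet> (Arrow \<one> (xb \<otimes> x) r ** idt xb) = idt xb"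
    and 2: "(idt x ** dag (Arrow \<one> (xb \<otimes> x) r)) \<bullet> (Arrow \<one> (x \<otimes> xb) rb ** idt x) = idt x"
    using assms * unfolding conjugate_solution_def
    by (simp_all add: cmp_def tns_def dag_def idt_def)
  show "(dag (Arrow \<one> (xb \<otimes> x) r) ** idt xb) \<bullet> (idt xb ** Arrow \<one> (x \<otimes> xb) rb) = idt xb"
    using arg_cong[OF 1, of dag] assms * by simp
  show "(dag (Arrow \<one> (x \<otimes> xb) rb) ** idt x) \<bullet> (idt x ** Arrow \<one> (xb \<otimes> x) r) = idt x"
    using arg_cong[OF 2, of dag] assms * by simp
qed

text \<open>Frobenius reciprocity: sliding \<open>f\<close> along the strand and straightening it with the conjugate
  equations recovers \<open>f\<close> from a morphism out of the unit. This gives norm estimates below as well as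
  an embedding of \<open>hom x x\<close> into a morphism space with a simple source.\<close>

lemma frobenius_recover:
  assumes "conjugate_solution x xb r rb" "x \<in> Ob C" "f \<in> hom x x"
  shows "f = (star rb \<boxtimes> idm x) \<cdot> (idm x \<boxtimes> ((idm xb \<boxtimes> f) \<cdot> r))"
proof -
  define R where "R = Arrow \<one> (xb \<otimes> x) r"
  define Rb where "Rb = Arrow \<one> (x \<otimes> xb) rb"
  define F where "F = Arrow x x f"
  note cs = conjugate_solution_arrows[OF assms(1,2), folded R_def Rb_def]
  have ty: "arr F" "src F = x" "tgt F = x" "src R = \<one>" "tgt R = xb \<otimes> x"
    "src Rb = \<one>" "tgt Rb = x \<otimes> xb"
    using assms by (simp_all add: F_def R_def Rb_def arr_Arrow)
  have "(dag Rb ** idt x) \<bullet> (idt x ** ((idt xb ** F) \<bullet> R))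
      = (dag Rb ** idt x) \<bullet> (idt x ** idt xb ** F) \<bullet> (idt x ** R)"
    using cs assms ty by (simp add: interchange)
  also have "\<dots> = ((dag Rb ** idt x) \<bullet> (idt x ** idt xb ** F)) \<bullet> (idt x ** R)"
    using cs(1-3) assms ty by simp
  also have "(dag Rb ** idt x) \<bullet> (idt x ** idt xb ** F) = F \<bullet> (dag Rb ** idt x)"
    using cs(1-3) assms ty interchange[of "dag Rb" "idt \<one>" "idt x" F]
    by (simp add: interchange_three flip: idt_otens)
  also have "(F \<bullet> (dag Rb ** idt x)) \<bullet> (idt x ** R) = F"
    using cs assms ty by simp
  finally have "mor ((dag Rb ** idt x) \<bullet> (idt x ** ((idt xb ** F) \<bullet> R))) = mor F" by simp
  then show ?thesis
    by (simp add: arrow_mor R_def Rb_def F_def)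
qed

end

section \<open>Semisimplicity\<close>

context cstar_tensor_category
begin

interpretation V: vector_space "scale C"
  by (rule vector_space_scale)

definition projection :: "'o \<Rightarrow> 'm \<Rightarrow> bool" where
  "projection x p \<longleftrightarrow> p \<in> hom x x \<and> p \<cdot> p = p \<and> star p = p"

lemma norm_projection_le_1: "x \<in> Ob C \<Longrightarrow> projection x p \<Longrightarrow> norm p \<le> 1"
  using cstar_identity[of x x p] by (auto simp: projection_def power2_eq_square)

lemma norm_projection: "x \<in> Ob C \<Longrightarrow> projection x p \<Longrightarrow> p \<noteq> 0 \<Longrightarrow> norm p = 1"
  using cstar_identity[of x x p] by (auto simp: projection_def power2_eq_square)

lemma projection_ident: "x \<in> Ob C \<Longrightarrow> projection x (idm x)"
  using comp_ident_left[of x x "idm x"] by (simp add: projection_def ident_in star_ident)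

lemma projection_sum:
  assumes "x \<in> Ob C" "finite I" "\<And>i. i \<in> I \<Longrightarrow> projection x (p i)"
    and "\<And>i j. i \<in> I \<Longrightarrow> j \<in> I \<Longrightarrow> i \<noteq> j \<Longrightarrow> p i \<cdot> p j = 0"
  shows "projection x (sum p I)"
proof -
  have p: "p i \<in> hom x x" if "i \<in> I" for i
    using assms(3)[OF that] by (simp add: projection_def)
  have "sum p I \<cdot> sum p I = (\<Sum>i\<in>I. p i \<cdot> sum p I)"
    using p assms(1) by (intro comp_sum_left[of x x x]) (auto intro: hom_sum)
  also have "\<dots> = (\<Sum>i\<in>I. \<Sum>j\<in>I. p i \<cdot> p j)"
    using p assms(1) by (intro sum.cong refl comp_sum_right[of x x x]) auto
  also have "\<dots> = (\<Sum>i\<in>I. \<Sum>j\<in>I. if j = i then p i else 0)"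
    using assms by (intro sum.cong refl) (auto simp: projection_def)
  also have "\<dots> = sum p I"
    using assms(2) by simp
  finally show ?thesis
    using p assms star_sum[of x x I p] by (simp add: projection_def hom_sum)
qed

lemma projection_ident_minus:
  assumes "x \<in> Ob C" "projection x p"
  shows "projection x (idm x - p)"
  using assms star_diff[of x x "idm x" p] comp_diff_left[of x x x "idm x - p" "idm x" p]
    comp_diff_right[of x x x "idm x" p p] comp_ident_left[of x x "idm x - p"]
    comp_ident_right[of x x p]
  by (simp add: projection_def hom_diff ident_in star_ident)

lemma pythagoras:
  assumes "simple w" "z \<in> Ob C" "finite I" "\<And>i. i \<in> I \<Longrightarrow> v i \<in> hom w z"
    and "\<And>i j. i \<in> I \<Longrightarrow> j \<in> I \<Longrightarrow> i \<noteq> j \<Longrightarrow> star (v i) \<cdot> v j = 0"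
  shows "(norm (sum v I))\<^sup>2 = (\<Sum>i\<in>I. (norm (v i))\<^sup>2)"
proof -
  note w = simple_Ob[OF assms(1)]
  have S: "sum v I \<in> hom w z"
    using assms w by (auto intro: hom_sum)
  have "star (sum v I) \<cdot> sum v I = (\<Sum>i\<in>I. star (v i)) \<cdot> sum v I"
    using assms w by (simp add: star_sum[of w z])
  also have "\<dots> = (\<Sum>i\<in>I. star (v i) \<cdot> sum v I)"
    using assms w S by (intro comp_sum_left[of w z w]) (auto intro: star_in)
  also have "\<dots> = (\<Sum>i\<in>I. \<Sum>j\<in>I. star (v i) \<cdot> v j)"
    using assms w by (intro sum.cong refl comp_sum_right[of w z w]) (auto intro: star_in)
  also have "\<dots> = (\<Sum>i\<in>I. \<Sum>j\<in>I. if j = i then star (v i) \<cdot> v i else 0)"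
    using assms by (intro sum.cong refl) auto
  also have "\<dots> = (\<Sum>i\<in>I. star (v i) \<cdot> v i)"
    using assms(3) by simp
  also have "\<dots> = (\<Sum>i\<in>I. complex_of_real ((norm (v i))\<^sup>2) \<odot> idm w)"
    using assms by (intro sum.cong refl star_comp_simple) auto
  also have "\<dots> = complex_of_real (\<Sum>i\<in>I. (norm (v i))\<^sup>2) \<odot> idm w"
    by (simp add: V.scale_sum_left)
  finally have "complex_of_real ((norm (sum v I))\<^sup>2) \<odot> idm w
      = complex_of_real (\<Sum>i\<in>I. (norm (v i))\<^sup>2) \<odot> idm w"
    using star_comp_simple[OF assms(1,2) S] by simp
  then show ?thesis
    using scale_ident_inject[OF assms(1)] of_real_eq_iff by blast
qed

end

locale rigid_simple_unit = rigid_cstar_tensor_category C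
  for C :: "('o, 'm::real_normed_vector) tensor_cat" (structure) +
  assumes simple_unit: "simple \<one>"
begin

interpretation V: vector_space "scale C"
  by (rule vector_space_scale)

text \<open>Because \<open>star g \<cdot> g\<close> is a scalar, so is \<open>star (1 \<otimes> g) \<cdot> (1 \<otimes> g)\<close>, and contractivity of
  \<open>1 \<otimes> _\<close> can be read off without spectral theory.\<close>

lemma norm_ident_tensor_le:
  assumes "x \<in> Ob C" "z \<in> Ob C" "g \<in> hom \<one> z"
  shows "norm (idm x \<boxtimes> g) \<le> norm g"
proof -
  have *: "idm x \<boxtimes> g \<in> hom x (x \<otimes> z)"
    using mtens_in[of x x \<one> z "idm x" g] assms by (simp add: ident_in)
  have "star (idm x \<boxtimes> g) \<cdot> (idm x \<boxtimes> g) = (idm x \<cdot> idm x) \<boxtimes> (star g \<cdot> g)"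
    using assms mtens_star[of x x \<one> z "idm x" g] star_in[of \<one> z g]
      mtens_comp[of x x x \<one> z \<one> "idm x" "idm x" g "star g"]
    by (simp add: ident_in star_ident)
  also have "\<dots> = complex_of_real ((norm g)\<^sup>2) \<odot> idm x"
    using assms star_comp_simple[OF simple_unit assms(2,3)]
      mtens_scale_right[of x x \<one> \<one> "idm x" "idm \<one>" "complex_of_real ((norm g)\<^sup>2)"]
      comp_ident_left[of x x "idm x"]
      mtens_unit_right[of x x "idm x"]
    by (simp add: ident_in)
  finally have "(norm (idm x \<boxtimes> g))\<^sup>2 = (norm g)\<^sup>2 * norm (idm x)"
    using cstar_identity[OF _ _ *] assms by (simp add: norm_scale norm_power)
  also have "\<dots> \<le> (norm g)\<^sup>2"
    using norm_ident[OF assms(1)] by (cases "idm x = 0") auto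
  finally show ?thesis by simp
qed

text \<open>The vectors \<open>(1 \<otimes> p\<^sub>i) r\<close> are orthogonal and their sum has norm at most \<open>\<parallel>r\<parallel>\<close>, whereas by
  Frobenius reciprocity none of them is short: \<open>p\<^sub>i\<close> has norm \<open>1\<close> and is recovered from
  \<open>(1 \<otimes> p\<^sub>i) r\<close> by composition with a fixed morphism. So there are only few of them.\<close>

lemma card_orthogonal_projections_le:
  assumes sol: "conjugate_solution x xb r rb" "x \<in> Ob C"
    and I: "finite I" "\<And>i. i \<in> I \<Longrightarrow> projection x (p i)" "\<And>i. i \<in> I \<Longrightarrow> p i \<noteq> 0"
    and orth: "\<And>i j. i \<in> I \<Longrightarrow> j \<in> I \<Longrightarrow> i \<noteq> j \<Longrightarrow> p i \<cdot> p j = 0"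
  shows "real (card I) \<le> (norm (star rb \<boxtimes> idm x))\<^sup>2 * (norm r)\<^sup>2"
proof -
  define K where "K = norm (star rb \<boxtimes> idm x)"
  define h where "h f = (idm xb \<boxtimes> f) \<cdot> r" for f
  have obs: "xb \<in> Ob C" "r \<in> hom \<one> (xb \<otimes> x)" "rb \<in> hom \<one> (x \<otimes> xb)"
    using sol by (auto simp: conjugate_solution_def)
  have rb: "star rb \<boxtimes> idm x \<in> hom (x \<otimes> xb \<otimes> x) x"
    using mtens_in[of "x \<otimes> xb" \<one> x x "star rb" "idm x"] obs sol
    by (simp add: ident_in star_in)
  have h1: "idm xb \<boxtimes> f \<in> hom (xb \<otimes> x) (xb \<otimes> x)" if "f \<in> hom x x" for f
    using that obs sol by (simp add: mtens_in ident_in)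
  have h_in: "h f \<in> hom \<one> (xb \<otimes> x)" if "f \<in> hom x x" for f
    unfolding h_def using comp_in[OF _ _ _ obs(2) h1[OF that]] obs sol by simp
  have p: "p i \<in> hom x x" if "i \<in> I" for i
    using I(2)[OF that] by (simp add: projection_def)
  have h_inner: "star (h f) \<cdot> h g = star r \<cdot> ((idm xb \<boxtimes> (star f \<cdot> g)) \<cdot> r)"
    if fg: "f \<in> hom x x" "g \<in> hom x x" for f g
  proof -
    define R where "R = Arrow \<one> (xb \<otimes> x) r"
    define F where "F = Arrow x x f"
    define G where "G = Arrow x x g"
    have [simp]: "arr R" "arr F" "arr G" "src F = x" "tgt F = x" "src G = x" "tgt G = x"
      "src R = \<one>" "tgt R = xb \<otimes> x"
      using obs sol fg by (simp_all add: R_def F_def G_def arr_Arrow)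
    have "dag ((idt xb ** F) \<bullet> R) \<bullet> ((idt xb ** G) \<bullet> R) =
        dag R \<bullet> (((idt xb ** dag F) \<bullet> (idt xb ** G)) \<bullet> R)"
      using obs sol by simp
    also have "\<dots> = dag R \<bullet> ((idt xb ** (dag F \<bullet> G)) \<bullet> R)"
      using obs sol by (simp add: interchange)
    finally show ?thesis
      unfolding h_def by (drule_tac arg_cong[of _ _ mor])
        (simp only: R_def F_def G_def arrow_mor arrow.sel)
  qed
  have h_0: "star r \<cdot> ((idm xb \<boxtimes> 0) \<cdot> r) = 0"
    using obs sol mtens_zero_right[of xb xb x x "idm xb"]
      comp_zero_left[of \<one> "xb \<otimes> x" "xb \<otimes> x" r]
      comp_zero_right[of \<one> "xb \<otimes> x" \<one> "star r"]
    by (simp add: ident_in star_in)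
  have h_sum: "h (sum p I) = (\<Sum>i\<in>I. h (p i))"
  proof -
    have "idm xb \<boxtimes> sum p I = (\<Sum>i\<in>I. idm xb \<boxtimes> p i)"
      by (rule mtens_sum_right[OF obs(1,1) sol(2,2) ident_in[OF obs(1)] p])
    moreover have "(\<Sum>i\<in>I. idm xb \<boxtimes> p i) \<cdot> r = (\<Sum>i\<in>I. (idm xb \<boxtimes> p i) \<cdot> r)"
      using obs sol by (intro comp_sum_left[OF _ _ _ obs(2) h1[OF p]]) simp_all
    ultimately show ?thesis unfolding h_def by simp
  qed
  have proj: "projection x (sum p I)"
    by (rule projection_sum[OF sol(2) I(1,2) orth])
  have "1 \<le> K\<^sup>2 * (norm (h (p i)))\<^sup>2" if "i \<in> I" for i
  proof -
    have "1 = norm ((star rb \<boxtimes> idm x) \<cdot> (idm x \<boxtimes> h (p i)))"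
      using frobenius_recover[OF sol p[OF that]] norm_projection[OF sol(2) I(2,3)[OF that]]
      by (simp add: h_def)
    also have "\<dots> \<le> K * norm (idm x \<boxtimes> h (p i))"
      unfolding K_def using rb obs sol h_in[OF p[OF that]]
        mtens_in[of x x \<one> "xb \<otimes> x" "idm x" "h (p i)"]
      by (intro norm_comp[of x "x \<otimes> xb \<otimes> x" x]) (auto simp: ident_in)
    also have "\<dots> \<le> K * norm (h (p i))"
      using norm_ident_tensor_le[OF sol(2) _ h_in[OF p[OF that]]] obs sol
      by (intro mult_left_mono) (auto simp: K_def)
    finally have "1\<^sup>2 \<le> (K * norm (h (p i)))\<^sup>2"
      by (intro power_mono) auto
    then show ?thesis by (simp add: power_mult_distrib)
  qed
  then have "real (card I) \<le> (\<Sum>i\<in>I. K\<^sup>2 * (norm (h (p i)))\<^sup>2)"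
    using sum_mono[of I "\<lambda>_. 1 :: real" "\<lambda>i. K\<^sup>2 * (norm (h (p i)))\<^sup>2"] by simp
  also have "\<dots> = K\<^sup>2 * (norm (h (sum p I)))\<^sup>2"
  proof -
    have "star (h (p i)) \<cdot> h (p j) = 0" if "i \<in> I" "j \<in> I" "i \<noteq> j" for i j
      using h_inner[OF p p, OF that(1,2)] I(2)[OF that(1)] orth[OF that] h_0
      by (simp add: projection_def)
    then have "(norm (h (sum p I)))\<^sup>2 = (\<Sum>i\<in>I. (norm (h (p i)))\<^sup>2)"
      unfolding h_sum using I(1) h_in p obs sol
      by (intro pythagoras[OF simple_unit, of "xb \<otimes> x"]) auto
    then show ?thesis by (simp add: sum_distrib_left)
  qed
  also have "\<dots> \<le> K\<^sup>2 * (norm r)\<^sup>2"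
  proof -
    have "projection (xb \<otimes> x) (idm xb \<boxtimes> sum p I)"
      using proj obs sol h1 mtens_comp[of xb xb xb x x x "idm xb" "idm xb" "sum p I" "sum p I"]
        mtens_star[of xb xb x x "idm xb" "sum p I"] comp_ident_left[of xb xb "idm xb"]
      by (auto simp: projection_def star_ident ident_in)
    then have "norm (idm xb \<boxtimes> sum p I) * norm r \<le> 1 * norm r"
      using norm_projection_le_1[of "xb \<otimes> x"] obs sol by (intro mult_right_mono) auto
    moreover have "norm (h (sum p I)) \<le> norm (idm xb \<boxtimes> sum p I) * norm r"
      unfolding h_def using proj h1 obs sol
      by (intro norm_comp[of \<one> "xb \<otimes> x" "xb \<otimes> x"]) (auto simp: projection_def)
    ultimately show ?thesis
      by (intro mult_left_mono power_mono) auto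
  qed
  finally show ?thesis unfolding K_def .
qed

lemma card_orthogonal_projections_bounded:
  assumes "x \<in> Ob C"
  obtains N :: nat where "\<And>(I :: 'm set) p. \<lbrakk>finite I; \<And>i. i \<in> I \<Longrightarrow> projection x (p i);
      \<And>i. i \<in> I \<Longrightarrow> p i \<noteq> 0; \<And>i j. i \<in> I \<Longrightarrow> j \<in> I \<Longrightarrow> i \<noteq> j \<Longrightarrow> p i \<cdot> p j = 0\<rbrakk> \<Longrightarrow> card I \<le> N"
proof -
  obtain xb r rb where sol: "conjugate_solution x xb r rb"
    using rigid[OF assms] by blast
  define K where "K = (norm (star rb \<boxtimes> idm x))\<^sup>2 * (norm r)\<^sup>2"
  have "card I \<le> nat \<lceil>K\<rceil>" if "real (card I) \<le> K" for I :: "'m set"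
    using that by linarith
  then show ?thesis
    using card_orthogonal_projections_le[OF sol assms] unfolding K_def by (intro that) blast
qed

section \<open>Orthonormal bases\<close>

definition orthonormal :: "'o \<Rightarrow> 'o \<Rightarrow> 'm set \<Rightarrow> bool" where
  "orthonormal w z B \<longleftrightarrow> finite B \<and> B \<subseteq> hom w z \<and>
     (\<forall>\<sigma>\<in>B. \<forall>\<tau>\<in>B. star \<tau> \<cdot> \<sigma> = (if \<sigma> = \<tau> then 1 else 0) \<odot> idm w)"

lemma isometry_range_projection:
  assumes "w \<in> Ob C" "z \<in> Ob C" "\<alpha> \<in> hom w z" "star \<alpha> \<cdot> \<alpha> = idm w"
  shows "projection z (\<alpha> \<cdot> star \<alpha>)"
  unfolding projection_def
proof (intro conjI)
  have s: "star \<alpha> \<in> hom z w"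
    using assms star_in by blast
  show "\<alpha> \<cdot> star \<alpha> \<in> hom z z"
    using comp_in[OF assms(2,1,2) s assms(3)] .
  show "(\<alpha> \<cdot> star \<alpha>) \<cdot> (\<alpha> \<cdot> star \<alpha>) = \<alpha> \<cdot> star \<alpha>"
    using comp_assoc[OF assms(2,1,2,2) s assms(3), of "\<alpha> \<cdot> star \<alpha>"]
      comp_assoc[OF assms(1,2,1,2) assms(3) s assms(3)] comp_in[OF assms(2,1,2) s assms(3)]
      assms(4) comp_ident_right[OF assms(1-3)] by simp
  show "star (\<alpha> \<cdot> star \<alpha>) = \<alpha> \<cdot> star \<alpha>"
    using star_comp[OF assms(2,1,2) s assms(3)] star_star[OF assms(1-3)] by simp
qed

lemma orthogonal_ranges:
  assumes "w \<in> Ob C" "w' \<in> Ob C" "z \<in> Ob C" "\<alpha> \<in> hom w z" "\<beta> \<in> hom w' z" "star \<alpha> \<cdot> \<beta> = 0"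
  shows "(\<alpha> \<cdot> star \<alpha>) \<cdot> (\<beta> \<cdot> star \<beta>) = 0"
proof -
  have "(\<alpha> \<cdot> star \<alpha>) \<cdot> (\<beta> \<cdot> star \<beta>) = \<alpha> \<cdot> ((star \<alpha> \<cdot> \<beta>) \<cdot> star \<beta>)"
    using assms star_in comp_in
      comp_assoc[of z z w z "\<beta> \<cdot> star \<beta>" "star \<alpha>" \<alpha>] comp_assoc[of z w' z w "star \<beta>" \<beta> "star \<alpha>"]
    by simp
  then show ?thesis
    using assms comp_zero_left[of z w' w "star \<beta>"] comp_zero_right[of z w z \<alpha>] star_in by simp
qed

lemma isometry_range_nonzero:
  assumes "w \<in> Ob C" "z \<in> Ob C" "\<alpha> \<in> hom w z" "star \<alpha> \<cdot> \<alpha> = idm w" "idm w \<noteq> 0"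
  shows "\<alpha> \<cdot> star \<alpha> \<noteq> 0"
  using star_comp_eq_0_iff[of z w "star \<alpha>"] star_comp_eq_0_iff[OF assms(1-3)]
    star_zero[of z w] star_star[OF assms(1-3)] star_in[OF assms(1-3)] assms by auto

lemma orthonormal_card_bounded:
  assumes "simple w" "z \<in> Ob C"
  obtains N where "\<And>B. orthonormal w z B \<Longrightarrow> card B \<le> N"
proof -
  note w = simple_Ob[OF assms(1)]
  obtain N where N: "\<And>(I :: 'm set) p. \<lbrakk>finite I; \<And>i. i \<in> I \<Longrightarrow> projection z (p i);
      \<And>i. i \<in> I \<Longrightarrow> p i \<noteq> 0; \<And>i j. i \<in> I \<Longrightarrow> j \<in> I \<Longrightarrow> i \<noteq> j \<Longrightarrow> p i \<cdot> p j = 0\<rbrakk> \<Longrightarrow> card I \<le> N"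
    using card_orthogonal_projections_bounded[OF assms(2)] by blast
  have "card B \<le> N" if "orthonormal w z B" for B
    using that w assms simple_ident
    by (intro N[of B "\<lambda>\<alpha>. \<alpha> \<cdot> star \<alpha>"] isometry_range_projection[OF w]
        isometry_range_nonzero[OF w assms(2)] orthogonal_ranges[OF w w assms(2)])
      (auto simp: orthonormal_def)
  then show ?thesis using that by blast
qed

lemma orthonormal_residual:
  assumes "simple w" "z \<in> Ob C" "orthonormal w z B" "\<sigma> \<in> hom w z" "\<beta> \<in> B"
  shows "star \<beta> \<cdot> (\<Sum>\<alpha>\<in>B. \<alpha> \<cdot> (star \<alpha> \<cdot> \<sigma>)) = star \<beta> \<cdot> \<sigma>"
proof -
  note w = simple_Ob[OF assms(1)]
  have B: "\<alpha> \<in> hom w z" "star \<alpha> \<in> hom z w" "star \<alpha> \<cdot> \<sigma> \<in> hom w w" if "\<alpha> \<in> B" for \<alpha>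
    using that assms w comp_in[of w z w \<sigma> "star \<alpha>"] star_in[of w z \<alpha>]
    by (auto simp: orthonormal_def)
  have "star \<beta> \<cdot> (\<Sum>\<alpha>\<in>B. \<alpha> \<cdot> (star \<alpha> \<cdot> \<sigma>)) = (\<Sum>\<alpha>\<in>B. star \<beta> \<cdot> (\<alpha> \<cdot> (star \<alpha> \<cdot> \<sigma>)))"
    using B(2)[OF assms(5)] comp_in[OF w w assms(2) B(3,1)]
    by (intro comp_sum_right[OF w assms(2) w])
  also have "\<dots> = (\<Sum>\<alpha>\<in>B. (star \<beta> \<cdot> \<alpha>) \<cdot> (star \<alpha> \<cdot> \<sigma>))"
    using B assms w by (intro sum.cong refl comp_assoc[of w w z w, symmetric]) auto
  also have "\<dots> = (\<Sum>\<alpha>\<in>B. if \<alpha> = \<beta> then star \<beta> \<cdot> \<sigma> else 0)"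
  proof (intro sum.cong refl)
    fix \<alpha> assume \<alpha>: "\<alpha> \<in> B"
    then have "star \<beta> \<cdot> \<alpha> = (if \<alpha> = \<beta> then 1 else 0) \<odot> idm w"
      using assms by (auto simp: orthonormal_def)
    then show "(star \<beta> \<cdot> \<alpha>) \<cdot> (star \<alpha> \<cdot> \<sigma>) = (if \<alpha> = \<beta> then star \<beta> \<cdot> \<sigma> else 0)"
      using B(3)[OF \<alpha>] w comp_ident_left[of w w] comp_zero_left[of w w w] by auto
  qed
  also have "\<dots> = star \<beta> \<cdot> \<sigma>"
    using assms by (simp add: orthonormal_def)
  finally show ?thesis .
qed

lemma onb_expansion:
  assumes "simple w" "z \<in> Ob C" "onb w z B" "\<sigma> \<in> hom w z"
  shows "(\<Sum>\<alpha>\<in>B. \<alpha> \<cdot> (star \<alpha> \<cdot> \<sigma>)) = \<sigma>"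
proof -
  note w = simple_Ob[OF assms(1)]
  have B: "finite B" "B \<subseteq> hom w z"
    "\<And>\<sigma> \<tau>. \<sigma> \<in> B \<Longrightarrow> \<tau> \<in> B \<Longrightarrow> star \<tau> \<cdot> \<sigma> = (if \<sigma> = \<tau> then 1 else 0) \<odot> idm w"
    using assms(3) by (auto simp: onb_def)
  have "\<sigma> \<in> V.span B"
    using assms by (simp add: onb_def)
  then obtain u where u: "\<sigma> = (\<Sum>\<alpha>\<in>B. u \<alpha> \<odot> \<alpha>)"
    using V.span_finite[OF B(1)] by auto
  have "\<beta> \<cdot> (star \<beta> \<cdot> \<sigma>) = u \<beta> \<odot> \<beta>" if b: "\<beta> \<in> B" for \<beta>
  proof -
    have "star \<beta> \<cdot> \<sigma> = (\<Sum>\<alpha>\<in>B. star \<beta> \<cdot> (u \<alpha> \<odot> \<alpha>))"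
      unfolding u using B w assms b by (intro comp_sum_right[of w z w]) (auto intro: star_in hom_scale)
    also have "\<dots> = (\<Sum>\<alpha>\<in>B. if \<alpha> = \<beta> then u \<beta> \<odot> idm w else 0)"
    proof (intro sum.cong refl)
      fix \<alpha> assume a: "\<alpha> \<in> B"
      show "star \<beta> \<cdot> (u \<alpha> \<odot> \<alpha>) = (if \<alpha> = \<beta> then u \<beta> \<odot> idm w else 0)"
        using comp_scale_right[OF w assms(2) w _ star_in[OF w assms(2)], of \<alpha> \<beta> "u \<alpha>"]
          B(2) B(3)[OF a b] a b
        by (auto simp: subset_iff)
    qed
    also have "\<dots> = u \<beta> \<odot> idm w"
      using b B by simp
    finally show ?thesis
      using comp_scale_right[of w w z "idm w" \<beta> "u \<beta>"] comp_ident_right[of w z \<beta>] B b w assms(2)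
      by (auto simp: ident_in)
  qed
  then show ?thesis by (simp add: u[symmetric])
qed

text \<open>The range projections of an orthonormal family are orthogonal, so there is a largest such
  family. It spans, since otherwise the residual of some \<open>\<sigma>\<close> could be normalised and added.\<close>

lemma onb_exists:
  assumes "simple w" "z \<in> Ob C"
  shows "\<exists>B. onb w z B"
proof -
  note w = simple_Ob[OF assms(1)]
  obtain N where N: "\<And>B. orthonormal w z B \<Longrightarrow> card B \<le> N"
    using orthonormal_card_bounded[OF assms] by blast
  have "orthonormal w z {}" by (simp add: orthonormal_def)
  with N obtain B where B: "orthonormal w z B" "\<And>B'. orthonormal w z B' \<Longrightarrow> card B' \<le> card B"
    using ex_has_greatest_nat[of "orthonormal w z" "{}" card "Suc N"] le_imp_less_Suc by blast
  have B': "finite B" "B \<subseteq> hom w z"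
    using B(1) by (auto simp: orthonormal_def)
  have expand: "(\<Sum>\<alpha>\<in>B. \<alpha> \<cdot> (star \<alpha> \<cdot> \<sigma>)) = \<sigma>" if s: "\<sigma> \<in> hom w z" for \<sigma>
  proof (rule ccontr)
    assume neq: "\<not> ?thesis"
    define \<rho> where "\<rho> = \<sigma> - (\<Sum>\<alpha>\<in>B. \<alpha> \<cdot> (star \<alpha> \<cdot> \<sigma>))"
    have S: "(\<Sum>\<alpha>\<in>B. \<alpha> \<cdot> (star \<alpha> \<cdot> \<sigma>)) \<in> hom w z"
      using w assms(2) B' s star_in[of w z] comp_in[of w z w \<sigma>] comp_in[of w w z]
      by (intro hom_sum) auto
    then have r: "\<rho> \<in> hom w z" "\<rho> \<noteq> 0"
      using s w assms(2) neq by (auto simp: \<rho>_def hom_diff)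
    have orth: "star \<beta> \<cdot> \<rho> = 0" if "\<beta> \<in> B" for \<beta>
      unfolding \<rho>_def
      using comp_diff_right[OF w assms(2) w s S, of "star \<beta>"] orthonormal_residual[OF assms B(1) s that]
        star_in[of w z \<beta>] B' that w assms(2) by auto
    define \<beta> where "\<beta> = complex_of_real (1 / norm \<rho>) \<odot> \<rho>"
    have b: "\<beta> \<in> hom w z"
      unfolding \<beta>_def using r w assms(2) by (intro hom_scale)
    have "norm \<beta> = 1"
      using r(2) by (simp add: \<beta>_def norm_scale norm_divide)
    then have b1: "star \<beta> \<cdot> \<beta> = idm w"
      using star_comp_simple[OF assms b] by simp
    have b0: "star \<alpha> \<cdot> \<beta> = 0" "star \<beta> \<cdot> \<alpha> = 0" if a: "\<alpha> \<in> B" for \<alpha>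
    proof -
      have a': "\<alpha> \<in> hom w z" "star \<alpha> \<in> hom z w" using a B' w assms(2) star_in by auto
      show *: "star \<alpha> \<cdot> \<beta> = 0"
        unfolding \<beta>_def using comp_scale_right[OF w assms(2) w r(1) a'(2)] orth[OF a] by simp
      show "star \<beta> \<cdot> \<alpha> = 0"
        using star_comp[OF w assms(2) w b a'(2)] star_star[OF w assms(2) a'(1)] star_zero[OF w w] *
        by simp
    qed
    have "\<beta> \<notin> B"
      using b0 b1 simple_ident[OF assms(1)] by force
    moreover have "orthonormal w z (insert \<beta> B)"
      using B(1) b b1 b0 \<open>\<beta> \<notin> B\<close> unfolding orthonormal_def by auto
    ultimately show False
      using B(2)[of "insert \<beta> B"] B' by simp
  qed
  have "V.span B = hom w z"
  proof
    show "V.span B \<subseteq> hom w z"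
      using V.span_minimal[OF B'(2)] hom_subspace w assms(2) by blast
    show "hom w z \<subseteq> V.span B"
    proof
      fix \<sigma> assume s: "\<sigma> \<in> hom w z"
      have "\<alpha> \<cdot> (star \<alpha> \<cdot> \<sigma>) \<in> V.span B" if "\<alpha> \<in> B" for \<alpha>
        using comp_scalar[OF assms, of \<alpha> "star \<alpha> \<cdot> \<sigma>"] comp_in[of w z w \<sigma> "star \<alpha>"] star_in[of w z \<alpha>]
          B' that s w assms(2) V.span_base V.span_scale by auto
      then have "(\<Sum>\<alpha>\<in>B. \<alpha> \<cdot> (star \<alpha> \<cdot> \<sigma>)) \<in> V.span B" by (rule V.span_sum)
      then show "\<sigma> \<in> V.span B" using expand[OF s] by simp
    qed
  qed
  then show ?thesis using B(1) by (auto simp: onb_def orthonormal_def)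
qed

end

section \<open>Objects without proper projections are simple\<close>

context rigid_simple_unit
begin

interpretation V: vector_space "scale C"
  by (rule vector_space_scale)

definition peval :: "'o \<Rightarrow> 'm \<Rightarrow> complex poly \<Rightarrow> 'm" where
  "peval x h p = fold_coeffs (\<lambda>a f. a \<odot> idm x + h \<cdot> f) p 0"

context
  fixes x h
  assumes x: "x \<in> Ob C" and h: "h \<in> hom x x"
begin

lemma peval_0: "peval x h 0 = 0"
  by (simp add: peval_def)

lemma peval_pCons: "peval x h (pCons a p) = a \<odot> idm x + h \<cdot> peval x h p"
proof (cases "a = 0 \<and> p = 0")
  case True
  then show ?thesis using comp_zero_right[OF x x x h] by (simp add: peval_0)
qed (auto simp: peval_def)

lemma peval_in: "peval x h p \<in> hom x x"
proof (induction p)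
  case 0
  show ?case using hom_zero[OF x x] by (simp add: peval_0)
next
  case (pCons a p)
  show ?case unfolding peval_pCons
    by (rule hom_add[OF x x hom_scale[OF x x ident_in[OF x]] comp_in[OF x x x pCons.IH h]])
qed

lemma peval_add: "peval x h (p + q) = peval x h p + peval x h q"
proof (induction p arbitrary: q)
  case 0
  show ?case by (simp add: peval_0)
next
  case (pCons a p)
  show ?case
  proof (cases q)
    case (pCons b r)
    show ?thesis
      unfolding pCons add_pCons peval_pCons pCons.IH comp_add_right[OF x x x peval_in peval_in h]
      by (simp add: V.scale_left_distrib)
  qed
qed

lemma peval_smult: "peval x h (smult c p) = c \<odot> peval x h p"
proof (induction p)
  case 0
  show ?case by (simp add: peval_0)
next
  case (pCons a p)
  show ?case
    unfolding smult_pCons peval_pCons pCons.IH comp_scale_right[OF x x x peval_in h]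
    by (simp add: V.scale_right_distrib)
qed

lemma peval_mult: "peval x h (p * q) = peval x h p \<cdot> peval x h q"
proof (induction p)
  case 0
  show ?case using comp_zero_left[OF x x x peval_in] by (simp add: peval_0)
next
  case (pCons a p)
  have 1: "a \<odot> idm x \<in> hom x x" "h \<cdot> peval x h p \<in> hom x x"
    using hom_scale[OF x x ident_in[OF x]] comp_in[OF x x x peval_in h] by auto
  show ?case
    unfolding mult_pCons_left peval_add peval_smult peval_pCons pCons.IH
      comp_add_left[OF x x x peval_in 1] comp_scale_left[OF x x x peval_in ident_in[OF x]]
      comp_ident_left[OF x x peval_in] comp_assoc[OF x x x x peval_in peval_in h]
    by simp
qed

lemma peval_const: "peval x h [:c:] = c \<odot> idm x"
  using comp_zero_right[OF x x x h] by (simp add: peval_pCons peval_0)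

lemma peval_X: "peval x h [:0, 1:] = h"
  using comp_ident_right[OF x x h] by (simp add: peval_pCons[of 0] peval_const)

lemma peval_sum: "peval x h (sum p A) = (\<Sum>i\<in>A. peval x h (p i))"
  by (induction A rule: infinite_finite_induct) (simp_all add: peval_0 peval_add)

lemma peval_eigenvector:
  assumes "f \<in> hom x x" "h \<cdot> f = c \<odot> f"
  shows "peval x h p \<cdot> f = poly p c \<odot> f"
proof (induction p)
  case 0
  show ?case using comp_zero_left[OF x x x assms(1)] by (simp add: peval_0)
next
  case (pCons a p)
  have 1: "a \<odot> idm x \<in> hom x x" "h \<cdot> peval x h p \<in> hom x x"
    using hom_scale[OF x x ident_in[OF x]] comp_in[OF x x x peval_in h] by auto
  show ?case
    unfolding peval_pCons comp_add_left[OF x x x assms(1) 1]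
      comp_scale_left[OF x x x assms(1) ident_in[OF x]] comp_ident_left[OF x x assms(1)]
      comp_assoc[OF x x x x assms(1) peval_in h] pCons.IH
      comp_scale_right[OF x x x assms(1) h] assms(2)
    by (simp add: V.scale_left_distrib mult.commute)
qed

text \<open>By Frobenius reciprocity the endomorphisms of \<open>x\<close> embed into the finite-dimensional space of
  morphisms from the unit to \<open>xb \<otimes> x\<close>, so the powers of \<open>h\<close> are linearly dependent.\<close>

lemma annihilating_polynomial: "\<exists>p. p \<noteq> 0 \<and> peval x h p = 0"
proof -
  obtain xb r rb where sol: "conjugate_solution x xb r rb"
    using rigid[OF x] by blast
  then have obs: "xb \<in> Ob C" "r \<in> hom \<one> (xb \<otimes> x)"
    by (auto simp: conjugate_solution_def)
  have oo: "\<one> \<in> Ob C" "xb \<otimes> x \<in> Ob C" using obs x by simp_all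
  define \<phi> where "\<phi> f = (idm xb \<boxtimes> f) \<cdot> r" for f
  have t: "idm xb \<boxtimes> f \<in> hom (xb \<otimes> x) (xb \<otimes> x)" if "f \<in> hom x x" for f
    using mtens_in[OF obs(1,1) x x ident_in[OF obs(1)] that] .
  have \<phi>_in: "\<phi> f \<in> hom \<one> (xb \<otimes> x)" if "f \<in> hom x x" for f
    unfolding \<phi>_def using comp_in[OF oo(1,2,2) obs(2) t[OF that]] .
  have \<phi>_scale: "\<phi> (c \<odot> f) = c \<odot> \<phi> f" if "f \<in> hom x x" for c f
    unfolding \<phi>_def mtens_scale_right[OF obs(1,1) x x ident_in[OF obs(1)] that]
    by (rule comp_scale_left[OF oo(1,2,2) obs(2) t[OF that]])
  have \<phi>_add: "\<phi> (f + g) = \<phi> f + \<phi> g" if "f \<in> hom x x" "g \<in> hom x x" for f g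
    unfolding \<phi>_def mtens_add_right[OF obs(1,1) x x ident_in[OF obs(1)] that]
    by (rule comp_add_left[OF oo(1,2,2) obs(2) t[OF that(1)] t[OF that(2)]])
  have \<phi>_sum: "\<phi> (sum f A) = (\<Sum>i\<in>A. \<phi> (f i))" if "\<And>i. f i \<in> hom x x" for f :: "nat \<Rightarrow> 'm" and A
    unfolding \<phi>_def mtens_sum_right[OF obs(1,1) x x ident_in[OF obs(1)] that]
    by (rule comp_sum_left[OF oo(1,2,2) obs(2) t[OF that]])
  have \<phi>_inj: "f = 0" if "f \<in> hom x x" "\<phi> f = 0" for f
  proof -
    have rb: "star rb \<boxtimes> idm x \<in> hom (x \<otimes> xb \<otimes> x) x"
      using mtens_in[of "x \<otimes> xb" \<one> x x "star rb" "idm x"] sol x star_in[of \<one> "x \<otimes> xb" rb]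
      by (simp add: ident_in conjugate_solution_def)
    show ?thesis
      using frobenius_recover[OF sol x that(1)] that(2)
        mtens_zero_right[OF x x oo(1,2) ident_in[OF x]] comp_zero_right[OF x _ x rb] x obs
      by (simp add: \<phi>_def)
  qed
  obtain B where B: "onb \<one> (xb \<otimes> x) B"
    using onb_exists[OF simple_unit oo(2)] by blast
  then have fin: "finite B" and span: "V.span B = hom \<one> (xb \<otimes> x)"
    by (auto simp: onb_def)
  define n where "n = card B"
  define v where "v i = \<phi> (peval x h (monom 1 i))" for i
  show ?thesis
  proof (cases "inj_on v {..n}")
    case False
    then obtain i j where ij: "i \<noteq> j" "v i = v j" by (auto simp: inj_on_def)
    define p :: "complex poly" where "p = monom 1 i + smult (-1) (monom 1 j)"
    have "\<phi> (peval x h p) = 0"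
      unfolding p_def peval_add peval_smult \<phi>_add[OF peval_in hom_scale[OF x x peval_in]]
        \<phi>_scale[OF peval_in]
      using ij(2) by (simp add: v_def)
    moreover have "coeff p i \<noteq> 0"
      using ij(1) by (simp add: p_def)
    ultimately show ?thesis
      using \<phi>_inj[OF peval_in] by (metis coeff_0)
  next
    case True
    have "V.dependent (v ` {..n})"
    proof (rule ccontr)
      assume "\<not> V.dependent (v ` {..n})"
      then have "card (v ` {..n}) \<le> card B"
        using V.independent_span_bound[OF fin] span \<phi>_in[OF peval_in] by (auto simp: v_def)
      then show False
        using card_image[OF True] by (simp add: n_def)
    qed
    then obtain u where u: "\<exists>y\<in>v ` {..n}. u y \<noteq> 0" "(\<Sum>y\<in>v ` {..n}. u y \<odot> y) = 0"
      using V.dependent_finite[of "v ` {..n}"] by auto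
    define p where "p = (\<Sum>i\<le>n. smult (u (v i)) (monom 1 i))"
    have "\<phi> (peval x h p) = (\<Sum>i\<le>n. u (v i) \<odot> v i)"
      unfolding p_def peval_sum peval_smult v_def
      using \<phi>_sum[of "\<lambda>i. u (\<phi> (peval x h (monom 1 i))) \<odot> peval x h (monom 1 i)" "{..n}"]
        \<phi>_scale[OF peval_in] hom_scale[OF x x peval_in] by simp
    also have "\<dots> = 0"
      using u(2) sum.reindex[OF True, of "\<lambda>y. u y \<odot> y"] by simp
    finally have "peval x h p = 0"
      using \<phi>_inj[OF peval_in] by blast
    moreover obtain i where "i \<le> n" "u (v i) \<noteq> 0"
      using u(1) by auto
    then have "coeff p i \<noteq> 0"
      by (simp add: p_def coeff_sum if_distrib[of "(*) _"] cong: if_cong)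
    ultimately show ?thesis by (metis coeff_0)
  qed
qed

text \<open>A root of the minimal polynomial of a self-adjoint \<open>h\<close> yields \<open>k \<noteq> 0\<close>, a polynomial in
  \<open>h\<close>, with \<open>h k = \<lambda> k\<close>. Then \<open>k k\<^sup>*\<close> is a multiple of the spectral projection of \<open>h\<close> at \<open>\<lambda>\<close>.\<close>

lemma eigenprojection:
  assumes sa: "star h = h" and nz: "idm x \<noteq> 0"
  obtains c e where "projection x e" "e \<noteq> 0" "h \<cdot> e = c \<odot> e"
proof -
  obtain p where p: "p \<noteq> 0" "peval x h p = 0"
    and min: "\<And>q. q \<noteq> 0 \<Longrightarrow> peval x h q = 0 \<Longrightarrow> degree p \<le> degree q"
    using annihilating_polynomial
      ex_has_least_nat[of "\<lambda>p. p \<noteq> 0 \<and> peval x h p = 0" _ degree] by blast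
  have "degree p \<noteq> 0"
  proof
    assume "degree p = 0"
    then obtain c where "p = [:c:]" by (metis degree_eq_zeroE)
    then show False using p nz by (simp add: peval_const)
  qed
  then obtain c where "poly p c = 0"
    using fundamental_theorem_of_algebra[of p] by (auto simp: constant_degree)
  then obtain q where q: "p = [:- c, 1:] * q"
    by (metis dvdE poly_eq_0_iff_dvd)
  define k where "k = peval x h q"
  have k: "k \<in> hom x x" by (simp add: k_def peval_in)
  have q0: "q \<noteq> 0" using p(1) q by auto
  have "degree p = Suc (degree q)"
    using degree_mult_eq[OF _ q0, of "[:- c, 1:]"] unfolding q by (simp del: mult_pCons_left)
  then have k0: "k \<noteq> 0"
    using min[OF q0] by (auto simp: k_def)
  have lin: "[:- c, 1:] = [:0, 1:] + [:- c:]" by simp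
  have "peval x h [:- c, 1:] \<cdot> k = 0"
    using p(2) unfolding q k_def peval_mult .
  then have hk: "h \<cdot> k = c \<odot> k"
    unfolding lin peval_add peval_X peval_const
      comp_add_left[OF x x x k h hom_scale[OF x x ident_in[OF x]]]
      comp_scale_left[OF x x x k ident_in[OF x]] comp_ident_left[OF x x k]
    by (simp add: add_eq_0_iff2)
  have kh: "k \<cdot> h = c \<odot> k"
    using hk peval_mult[of q "[:0, 1:]"] peval_mult[of "[:0, 1:]" q]
    by (simp only: k_def peval_X mult.commute)
  have sk: "star k \<in> hom x x" using star_in[OF x x k] .
  have hsk: "h \<cdot> star k = cnj c \<odot> star k"
    using star_comp[OF x x x h k] star_scale[OF x x k, of c] by (simp add: kh sa)
  define d where "d = poly q (cnj c)"
  have kk: "k \<cdot> star k = d \<odot> star k"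
    unfolding d_def k_def by (rule peval_eigenvector) (use sk hsk in \<open>simp_all add: k_def\<close>)
  have "k \<cdot> star k \<noteq> 0"
    using star_comp_eq_0_iff[OF x x sk] star_star[OF x x k] star_zero[OF x x] k0 by metis
  then have d0: "d \<noteq> 0" using kk by auto
  have dk: "d \<odot> star k = cnj d \<odot> k"
    using star_comp[OF x x x sk k] star_star[OF x x k] star_scale[OF x x sk, of d]
    by (simp add: kk)
  have k_eq: "k = (d / cnj d) \<odot> star k"
    using arg_cong[OF dk, of "scale C (1 / cnj d)"] d0 by simp
  \<comment> \<open>From \<open>k k\<^sup>* = d k\<^sup>*\<close> the element \<open>k\<^sup>* / cnj d\<close> is \<open>k k\<^sup>* / \<bar>d\<bar>\<^sup>2\<close>, hence self-adjoint.\<close>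
  define e where "e = (1 / cnj d) \<odot> star k"
  have e_eq: "e = (1 / d) \<odot> k"
    unfolding e_def using d0 by (subst k_eq) simp
  have e: "e \<in> hom x x" unfolding e_def using hom_scale[OF x x sk] .
  have "star e = e"
    using star_scale[OF x x k, of "1 / d"] unfolding e_eq[symmetric] by (simp add: e_def)
  moreover have "e \<cdot> e = e"
  proof -
    have "e \<cdot> e = (1 / d) \<odot> (k \<cdot> ((1 / cnj d) \<odot> star k))"
      using comp_scale_left[OF x x x e k, of "1 / d"] by (simp add: e_eq[symmetric] e_def[symmetric])
    also have "\<dots> = (1 / d) \<odot> ((1 / cnj d) \<odot> (d \<odot> star k))"
      using comp_scale_right[OF x x x sk k] by (simp add: kk)
    also have "\<dots> = e" using d0 by (simp add: e_def)
    finally show ?thesis .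
  qed
  moreover have "h \<cdot> e = c \<odot> e"
    unfolding e_eq comp_scale_right[OF x x x k h] hk by (simp add: mult.commute)
  moreover have "e \<noteq> 0"
    unfolding e_eq using k0 d0 by simp
  ultimately show thesis
    using that e by (simp add: projection_def)
qed

end

text \<open>The eigenprojection of a self-adjoint endomorphism can only be the identity, so self-adjoint
  endomorphisms are scalars; every endomorphism is a combination of two self-adjoint ones.\<close>

lemma simpleI:
  assumes x: "x \<in> Ob C" and nz: "idm x \<noteq> 0"
    and triv: "\<And>p. projection x p \<Longrightarrow> p = 0 \<or> p = idm x"
  shows "simple x"
proof -
  have sa: "\<exists>c. h = c \<odot> idm x" if h: "h \<in> hom x x" "star h = h" for h
    using eigenprojection[OF x h nz] triv comp_ident_right[OF x x h(1)] by metis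
  have "\<exists>c. f = c \<odot> idm x" if f: "f \<in> hom x x" for f
  proof -
    have sf: "star f \<in> hom x x" using star_in[OF x x f] .
    obtain a where a: "f + star f = a \<odot> idm x"
      using sa[OF hom_add[OF x x f sf]] star_add[OF x x f sf] star_star[OF x x f]
      by (auto simp: add.commute)
    have g: "\<i> \<odot> (star f - f) \<in> hom x x"
      using hom_scale[OF x x hom_diff[OF x x sf f]] .
    have "star (\<i> \<odot> (star f - f)) = \<i> \<odot> (star f - f)"
      using star_scale[OF x x hom_diff[OF x x sf f]] star_diff[OF x x sf f] star_star[OF x x f]
      by (simp add: V.scale_right_diff_distrib)
    then obtain b where b: "\<i> \<odot> (star f - f) = b \<odot> idm x"
      using sa[OF g] by blast
    have "star f - f = (- \<i>) \<odot> (\<i> \<odot> (star f - f))" by simp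
    also have "\<dots> = (- \<i> * b) \<odot> idm x" unfolding b by simp
    finally have c: "star f - f = (- \<i> * b) \<odot> idm x" .
    have "2 \<odot> f = (f + star f) - (star f - f)"
      using V.scale_left_distrib[of 1 1 f] by simp
    also have "\<dots> = (a + \<i> * b) \<odot> idm x"
      unfolding a c V.scale_left_diff_distrib[symmetric] by simp
    finally have "(1/2) \<odot> (2 \<odot> f) = (1/2) \<odot> ((a + \<i> * b) \<odot> idm x)" by simp
    then have "f = ((a + \<i> * b) / 2) \<odot> idm x" by simp
    then show ?thesis by blast
  qed
  then have "hom x x = range (\<lambda>c. c \<odot> idm x)"
    using hom_scale[OF x x ident_in[OF x]] by auto
  then show ?thesis using x nz by (simp add: simple_def)
qed


section \<open>Decomposition into simple objects\<close>

definition orthogonal_projections :: "'o \<Rightarrow> 'm set \<Rightarrow> bool" where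
  "orthogonal_projections z P \<longleftrightarrow> finite P \<and> (\<forall>p\<in>P. projection z p \<and> p \<noteq> 0) \<and>
     (\<forall>p\<in>P. \<forall>q\<in>P. p \<noteq> q \<longrightarrow> p \<cdot> q = 0)"

text \<open>In a largest family of orthogonal projections every member is minimal: a proper projection \<open>f\<close>
  of the range of \<open>p\<close> would allow \<open>p\<close> to be replaced by the two projections coming from \<open>f\<close> and \<open>1 - f\<close>.
  Hence the ranges are simple.\<close>

lemma simple_subobject_exists:
  assumes z: "z \<in> Ob C" and nz: "idm z \<noteq> 0"
  obtains w v where "simple w" "v \<in> hom w z" "star v \<cdot> v = idm w"
proof -
  obtain N where N: "\<And>P. orthogonal_projections z P \<Longrightarrow> card P < N"
  proof -
    obtain N :: nat where "\<And>(I :: 'm set) p. \<lbrakk>finite I; \<And>i. i \<in> I \<Longrightarrow> projection z (p i);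
      \<And>i. i \<in> I \<Longrightarrow> p i \<noteq> 0; \<And>i j. i \<in> I \<Longrightarrow> j \<in> I \<Longrightarrow> i \<noteq> j \<Longrightarrow> p i \<cdot> p j = 0\<rbrakk> \<Longrightarrow> card I \<le> N"
      using card_orthogonal_projections_bounded[OF z] by blast
    from this[of _ "\<lambda>p. p"] show ?thesis
      by (intro that[of "Suc N"]) (auto simp: orthogonal_projections_def less_Suc_eq_le)
  qed
  have one: "orthogonal_projections z {idm z}"
    using projection_ident[OF z] nz by (simp add: orthogonal_projections_def)
  obtain P where P: "orthogonal_projections z P"
    and max: "\<And>Q. orthogonal_projections z Q \<Longrightarrow> card Q \<le> card P"
    using ex_has_greatest_nat[of "orthogonal_projections z" "{idm z}" card N] one N by blast
  have fin: "finite P" using P by (simp add: orthogonal_projections_def)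
  from max[OF one] obtain p where p: "p \<in> P" by fastforce
  then have pp: "p \<in> hom z z" "p \<cdot> p = p" "star p = p" "p \<noteq> 0" "projection z p"
    using P by (auto simp: orthogonal_projections_def projection_def)
  obtain s v where s: "s \<in> Ob C" and v: "v \<in> hom s z" "star v \<cdot> v = idm s" "v \<cdot> star v = p"
    using subobjects[OF z pp(1-3)] by blast
  have sv: "star v \<in> hom z s" using star_in[OF s z v(1)] .
  have s0: "idm s \<noteq> 0"
    using ident_zero_imp_hom_zero[OF s z v(1)] v(3) comp_zero_left[OF z s z sv] pp(4) by auto
  have "simple s"
  proof (rule simpleI[OF s s0], rule ccontr)
    fix f assume f: "projection s f" and nt: "\<not> (f = 0 \<or> f = idm s)"
    define E where "E g = v \<cdot> (g \<cdot> star v)" for g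
    have Ein: "E g \<in> hom z z" if "g \<in> hom s s" for g
      unfolding E_def using comp_in[OF z s z comp_in[OF z s s sv that] v(1)] .
    have vE: "star v \<cdot> E g = g \<cdot> star v" if "g \<in> hom s s" for g
      unfolding E_def
      using comp_assoc[OF z s z s comp_in[OF z s s sv that] v(1) sv] v(2)
        comp_ident_left[OF z s comp_in[OF z s s sv that]] by simp
    have EE: "E f \<cdot> E g = E (f \<cdot> g)" if "f \<in> hom s s" "g \<in> hom s s" for f g
    proof -
      have "E f \<cdot> E g = v \<cdot> ((f \<cdot> star v) \<cdot> E g)"
        using comp_assoc[OF z z s z Ein[OF that(2)] comp_in[OF z s s sv that(1)] v(1)]
        by (simp add: E_def)
      also have "(f \<cdot> star v) \<cdot> E g = f \<cdot> (g \<cdot> star v)"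
        using comp_assoc[OF z z s s Ein[OF that(2)] sv that(1)] vE[OF that(2)] by simp
      also have "f \<cdot> (g \<cdot> star v) = (f \<cdot> g) \<cdot> star v"
        using comp_assoc[OF z s s s sv that(2,1)] by simp
      finally show ?thesis by (simp add: E_def)
    qed
    have Estar: "star (E g) = E (star g)" if "g \<in> hom s s" for g
      using star_comp[OF z s z comp_in[OF z s s sv that] v(1)] star_comp[OF z s s sv that]
        star_star[OF s z v(1)] comp_assoc[OF z s s z sv star_in[OF s s that] v(1)]
      by (simp add: E_def)
    have E0: "E 0 = 0"
      unfolding E_def using comp_zero_left[OF z s s sv] comp_zero_right[OF z s z v(1)] by simp
    have E_inj: "g = 0" if "g \<in> hom s s" "E g = 0" for g
      using vE[OF that(1)] that(2) comp_zero_right[OF z z s sv] comp_assoc[OF s z s s v(1) sv that(1)]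
        v(2) comp_ident_right[OF s s that(1)] comp_zero_left[OF s z s v(1)] by simp
    have Eproj: "projection z (E g)" if "projection s g" for g
      using that Ein EE Estar by (simp add: projection_def)
    define f' where "f' = idm s - f"
    have f': "projection s f'" "f' \<noteq> 0"
      using projection_ident_minus[OF s f] nt by (auto simp: f'_def)
    have fh: "f \<in> hom s s" "f' \<in> hom s s" using f f' by (auto simp: projection_def)
    have ff': "f \<cdot> f' = 0" "f' \<cdot> f = 0"
      using comp_diff_left[OF s s s fh(1) ident_in[OF s] fh(1)] f
        comp_diff_right[OF s s s ident_in[OF s] fh(1,1)] comp_ident_left[OF s s fh(1)]
        comp_ident_right[OF s s fh(1)]
      by (simp_all add: f'_def projection_def)
    have pE: "p \<cdot> E g = E g \<and> E g \<cdot> p = E g" if "g \<in> hom s s" for g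
    proof -
      have "E (idm s) = p" using comp_ident_left[OF z s sv] v(3) by (simp add: E_def)
      then show ?thesis
        using EE[OF ident_in[OF s] that] EE[OF that ident_in[OF s]]
          comp_ident_left[OF s s that] comp_ident_right[OF s s that] by simp
    qed
    have other: "q \<cdot> E g = 0 \<and> E g \<cdot> q = 0" if q: "q \<in> P - {p}" and g: "g \<in> hom s s" for q g
    proof -
      have qh: "q \<in> hom z z" "q \<cdot> p = 0" "p \<cdot> q = 0"
        using q p P by (auto simp: orthogonal_projections_def projection_def)
      have "q \<cdot> E g = (q \<cdot> p) \<cdot> E g"
        using comp_assoc[OF z z z z Ein[OF g] pp(1) qh(1)] pE[OF g] by simp
      moreover have "E g \<cdot> q = E g \<cdot> (p \<cdot> q)"
        using comp_assoc[OF z z z z qh(1) pp(1) Ein[OF g]] pE[OF g] by simp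
      ultimately show ?thesis
        using qh comp_zero_left[OF z z z Ein[OF g]] comp_zero_right[OF z z z Ein[OF g]] by simp
    qed
    have ne: "E f \<noteq> 0" "E f' \<noteq> 0" using E_inj fh nt f'(2) by blast+
    have E2: "E f \<cdot> E f' = 0" "E f' \<cdot> E f = 0"
      using EE fh ff' E0 by simp_all
    have self: "E f \<cdot> E f = E f" "E f' \<cdot> E f' = E f'"
      using Eproj[OF f] Eproj[OF f'(1)] by (auto simp: projection_def)
    have d1: "E f \<noteq> E f'" using E2 self ne by auto
    have d2: "E f \<notin> P - {p}" "E f' \<notin> P - {p}" using other fh self ne by metis+
    have "orthogonal_projections z (insert (E f) (insert (E f') (P - {p})))"
      using P Eproj[OF f] Eproj[OF f'(1)] ne E2 other[OF _ fh(1)] other[OF _ fh(2)]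
      unfolding orthogonal_projections_def by auto
    then have "card (insert (E f) (insert (E f') (P - {p}))) \<le> card P" by (rule max)
    moreover have "card (insert (E f) (insert (E f') (P - {p}))) = Suc (card P)"
      using d1 d2 fin p by (simp add: card_Diff_singleton card_gt_0_iff) (metis card_gt_0_iff Suc_pred emptyE)
    ultimately show False by simp
  qed
  then show thesis using that v by blast
qed

end

section \<open>Isotypic decomposition of objects\<close>

locale tube_category = rigid_simple_unit C + tube_data C Irr cj R Rb
  for C :: "('o, 'm::real_normed_vector) tensor_cat" (structure)
    and Irr :: "'o set" and cj :: "'o \<Rightarrow> 'o" and R Rb :: "'o \<Rightarrow> 'm" +
  assumes irr: "irr_representatives Irr"
    and solution: "x \<in> Ob C \<Longrightarrow> conjugate_solution x (cj x) (R x) (Rb x)"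
begin

interpretation V: vector_space "scale C"
  by (rule vector_space_scale)

lemma Irr_simple: "w \<in> Irr \<Longrightarrow> simple w"
  using irr by (simp add: irr_representatives_def)

lemma Irr_Ob: "w \<in> Irr \<Longrightarrow> w \<in> Ob C"
  using Irr_simple simple_Ob by blast

lemma unit_Irr: "\<one> \<in> Irr"
  using irr by (simp add: irr_representatives_def)

text \<open>Both \<open>star f \<cdot> f\<close> and \<open>f \<cdot> star f\<close> are scalars, so a nonzero \<open>f\<close> is invertible up to
  rescaling, while distinct members of \<open>Irr\<close> are not isomorphic.\<close>

lemma schur:
  assumes w: "w \<in> Irr" "w' \<in> Irr" "w \<noteq> w'" and f: "f \<in> hom w w'"
  shows "f = 0"
proof (rule ccontr)
  assume nz: "f \<noteq> 0"
  have o: "w \<in> Ob C" "w' \<in> Ob C" using w Irr_Ob by auto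
  have sf: "star f \<in> hom w' w" using star_in[OF o f] .
  define g where "g = complex_of_real (1 / (norm f)\<^sup>2) \<odot> star f"
  have g: "g \<in> hom w' w" unfolding g_def using hom_scale[OF o(2,1) sf] .
  have "g \<cdot> f = idm w"
    unfolding g_def comp_scale_left[OF o o(1) f sf]
    using star_comp_simple[OF Irr_simple[OF w(1)] o(2) f] nz by simp
  moreover have "f \<cdot> g = idm w'"
    unfolding g_def comp_scale_right[OF o(2,1,2) sf f]
    using star_comp_simple[OF Irr_simple[OF w(2)] o(1) sf] nz star_star[OF o f] norm_star[OF o f]
    by simp
  ultimately have "iso w w'"
    unfolding iso_def using f g by blast
  moreover have "iso w w"
    unfolding iso_def using ident_in[OF o(1)] comp_ident_left[OF o(1,1)] by blast
  ultimately show False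
    using irr w Irr_simple[OF w(1)] unfolding irr_representatives_def by metis
qed

definition basis :: "'o \<Rightarrow> 'o \<Rightarrow> 'm set" where
  "basis w z = (SOME B. onb w z B)"

lemma onb_basis: "w \<in> Irr \<Longrightarrow> z \<in> Ob C \<Longrightarrow> onb w z (basis w z)"
  unfolding basis_def using onb_exists[OF Irr_simple] by (rule someI_ex)

lemma basis:
  assumes "w \<in> Irr" "z \<in> Ob C"
  shows "finite (basis w z)" "\<alpha> \<in> basis w z \<Longrightarrow> \<alpha> \<in> hom w z"
    and "\<alpha> \<in> basis w z \<Longrightarrow> star \<alpha> \<in> hom z w"
    and "\<alpha> \<in> basis w z \<Longrightarrow> star \<alpha> \<cdot> \<alpha> = idm w"
    and "\<alpha> \<in> basis w z \<Longrightarrow> \<beta> \<in> basis w z \<Longrightarrow> \<alpha> \<noteq> \<beta> \<Longrightarrow> star \<alpha> \<cdot> \<beta> = 0"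
  using onb_basis[OF assms] star_in[OF Irr_Ob[OF assms(1)] assms(2), of \<alpha>]
  by (auto simp: onb_def)

definition constituents :: "'o \<Rightarrow> 'o set" where
  "constituents z = {w \<in> Irr. hom w z \<noteq> {0}}"

lemma basis_empty:
  assumes "w \<in> Irr" "z \<in> Ob C" "w \<notin> constituents z"
  shows "basis w z = {}"
proof -
  have "\<alpha> \<notin> basis w z" for \<alpha>
  proof
    assume a: "\<alpha> \<in> basis w z"
    then have "\<alpha> = 0"
      using basis(2)[OF assms(1,2) a] assms by (auto simp: constituents_def)
    then show False
      using basis(3,4)[OF assms(1,2) a] comp_zero_right[OF Irr_Ob[OF assms(1)] assms(2) Irr_Ob[OF assms(1)]]
        simple_ident[OF Irr_simple[OF assms(1)]] by auto
  qed
  then show ?thesis by blast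
qed

text \<open>Isometries into \<open>z\<close> from different members of \<open>Irr\<close> have orthogonal ranges, by Schur's lemma,
  so there are at most as many as there are orthogonal projections of \<open>z\<close>.\<close>

lemma finite_constituents:
  assumes z: "z \<in> Ob C"
  shows "finite (constituents z)"
proof -
  obtain N where N: "\<And>(I :: 'm set) p. \<lbrakk>finite I; \<And>i. i \<in> I \<Longrightarrow> projection z (p i);
      \<And>i. i \<in> I \<Longrightarrow> p i \<noteq> 0; \<And>i j. i \<in> I \<Longrightarrow> j \<in> I \<Longrightarrow> i \<noteq> j \<Longrightarrow> p i \<cdot> p j = 0\<rbrakk> \<Longrightarrow> card I \<le> N"
    using card_orthogonal_projections_bounded[OF z] by blast
  have "\<exists>\<alpha>. \<alpha> \<in> hom w z \<and> star \<alpha> \<cdot> \<alpha> = idm w" if w: "w \<in> constituents z" for w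
  proof -
    have wI: "w \<in> Irr" using w by (simp add: constituents_def)
    have "V.span (basis w z) \<noteq> {0}"
      using onb_basis[OF wI z] w by (simp add: onb_def constituents_def)
    then have "basis w z \<noteq> {}" using V.span_empty by metis
    then show ?thesis using basis[OF wI z] by blast
  qed
  then obtain a where a: "\<And>w. w \<in> constituents z \<Longrightarrow> a w \<in> hom w z \<and> star (a w) \<cdot> a w = idm w"
    by metis
  have c: "w \<in> Irr" "w \<in> Ob C" "idm w \<noteq> 0" if "w \<in> constituents z" for w
    using that Irr_Ob simple_ident[OF Irr_simple] by (auto simp: constituents_def)
  have orth: "star (a w) \<cdot> a w' = 0" if "w \<in> constituents z" "w' \<in> constituents z" "w \<noteq> w'" for w w'
    using schur[of w' w "star (a w) \<cdot> a w'"] c[OF that(1)] c[OF that(2)] a[OF that(1)] a[OF that(2)] that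
      comp_in[of w' z w "a w'" "star (a w)"] star_in[of w z "a w"] z by auto
  have "card J \<le> N" if J: "J \<subseteq> constituents z" "finite J" for J
  proof -
    have inj: "inj_on a J"
    proof (rule inj_onI, rule ccontr)
      fix w w' assume "w \<in> J" "w' \<in> J" "a w = a w'" "w \<noteq> w'"
      then show False using orth[of w w'] a[of w] c[of w] J by auto
    qed
    have "card (a ` J) \<le> N"
    proof (rule N[of _ "\<lambda>\<alpha>. \<alpha> \<cdot> star \<alpha>"])
      show "finite (a ` J)" using J by simp
    next
      fix i assume "i \<in> a ` J"
      then obtain w where w: "w \<in> constituents z" "i = a w" using J by auto
      show "projection z (i \<cdot> star i)" "i \<cdot> star i \<noteq> 0"
        using isometry_range_projection[OF c(2)[OF w(1)] z] a[OF w(1)]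
          isometry_range_nonzero[OF c(2)[OF w(1)] z _ _ c(3)[OF w(1)]] w(2) by auto
    next
      fix i j assume "i \<in> a ` J" "j \<in> a ` J" "i \<noteq> j"
      then obtain w w' where w: "w \<in> constituents z" "w' \<in> constituents z" "w \<noteq> w'" "i = a w" "j = a w'"
        using J by auto
      then show "(i \<cdot> star i) \<cdot> (j \<cdot> star j) = 0"
        using orthogonal_ranges[OF c(2)[OF w(1)] c(2)[OF w(2)] z] a[OF w(1)] a[OF w(2)] orth by simp
    qed
    then show ?thesis using card_image[OF inj] by simp
  qed
  then show ?thesis using finite_if_finite_subsets_card_bdd by blast
qed

text \<open>The sum is a projection. If its complement were nonzero, the range of the complement would
  contain a simple object, giving a nonzero \<open>\<beta>\<close> from some \<open>w \<in> Irr\<close> to \<open>z\<close>; but expanding \<open>\<beta>\<close> in the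
  basis of \<open>hom w z\<close> shows that the sum fixes \<open>\<beta>\<close>.\<close>

lemma ident_decomposition:
  assumes z: "z \<in> Ob C" and J: "finite J" "constituents z \<subseteq> J" "J \<subseteq> Irr"
  shows "(\<Sum>w\<in>J. \<Sum>\<alpha>\<in>basis w z. \<alpha> \<cdot> star \<alpha>) = idm z"
proof -
  define S where "S = (SIGMA w:J. basis w z)"
  define p where "p = (\<lambda>(w :: 'o, \<alpha>). \<alpha> \<cdot> star \<alpha>)"
  define e where "e = idm z - sum p S"
  have fin: "finite S" unfolding S_def using J basis(1)[OF _ z] by auto
  have S: "w \<in> Irr" "w \<in> Ob C" "\<alpha> \<in> hom w z" "star \<alpha> \<in> hom z w" "star \<alpha> \<cdot> \<alpha> = idm w"
    if "(w, \<alpha>) \<in> S" for w \<alpha>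
    using that J basis[OF _ z] Irr_Ob by (auto simp: S_def)
  have sum_eq: "(\<Sum>w\<in>J. \<Sum>\<alpha>\<in>basis w z. \<alpha> \<cdot> star \<alpha>) = sum p S"
    unfolding S_def p_def using J basis(1)[OF _ z] by (intro sum.Sigma) auto
  have orth: "star \<alpha> \<cdot> \<beta> = 0" if "(w, \<alpha>) \<in> S" "(w', \<beta>) \<in> S" "(w, \<alpha>) \<noteq> (w', \<beta>)" for w \<alpha> w' \<beta>
  proof (cases "w = w'")
    case True
    then show ?thesis using basis(5)[OF S(1)[OF that(1)] z, of \<alpha> \<beta>] that by (simp add: S_def)
  next
    case False
    then show ?thesis
      using schur[OF S(1)[OF that(2)] S(1)[OF that(1)]]
        comp_in[OF S(2)[OF that(2)] z S(2)[OF that(1)] S(3)[OF that(2)] S(4)[OF that(1)]] by auto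
  qed
  have pin: "p i \<in> hom z z" if "i \<in> S" for i
    using comp_in[OF z S(2) z S(4,3)] that by (cases i) (auto simp: p_def)
  have proj: "projection z (sum p S)"
  proof (rule projection_sum[OF z fin])
    fix i assume "i \<in> S"
    then show "projection z (p i)"
      using isometry_range_projection[OF S(2) z S(3,5)] by (cases i) (auto simp: p_def)
  next
    fix i j assume "i \<in> S" "j \<in> S" "i \<noteq> j"
    then show "p i \<cdot> p j = 0"
      using orthogonal_ranges[OF S(2) S(2) z S(3) S(3) orth] by (cases i; cases j) (auto simp: p_def)
  qed
  have e: "projection z e"
    unfolding e_def using projection_ident_minus[OF z proj] .
  have "e = 0"
  proof (rule ccontr)
    assume "e \<noteq> 0"
    obtain s v where s: "s \<in> Ob C" and v: "v \<in> hom s z" "star v \<cdot> v = idm s" "v \<cdot> star v = e"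
      using subobjects[OF z, of e] e by (auto simp: projection_def)
    have sv: "star v \<in> hom z s" using star_in[OF s z v(1)] .
    have "idm s \<noteq> 0"
      using ident_zero_imp_hom_zero[OF s z v(1)] v(3) comp_zero_left[OF z s z sv] \<open>e \<noteq> 0\<close> by auto
    then obtain w0 u where u: "simple w0" "u \<in> hom w0 s" "star u \<cdot> u = idm w0"
      using simple_subobject_exists[OF s] by blast
    have w0: "w0 \<in> Ob C" using simple_Ob[OF u(1)] .
    obtain w where w: "w \<in> Irr" "iso w0 w"
      using irr u(1) unfolding irr_representatives_def by blast
    have wO: "w \<in> Ob C" using Irr_Ob[OF w(1)] .
    obtain f g where fg: "f \<in> hom w0 w" "g \<in> hom w w0" "f \<cdot> g = idm w"
      using w(2) unfolding iso_def by blast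
    have su: "star u \<in> hom s w0" using star_in[OF w0 s u(2)] .
    have ug: "u \<cdot> g \<in> hom w s" using comp_in[OF wO w0 s fg(2) u(2)] .
    define \<beta> where "\<beta> = v \<cdot> (u \<cdot> g)"
    have b: "\<beta> \<in> hom w z" unfolding \<beta>_def using comp_in[OF wO s z ug v(1)] .
    have "star v \<cdot> \<beta> = u \<cdot> g"
      unfolding \<beta>_def using comp_assoc[OF wO s z s ug v(1) sv] v(2) comp_ident_left[OF wO s ug] by simp
    moreover have "star u \<cdot> (u \<cdot> g) = g"
      using comp_assoc[OF wO w0 s w0 fg(2) u(2) su] u(3) comp_ident_left[OF wO w0 fg(2)] by simp
    ultimately have "f \<cdot> (star u \<cdot> (star v \<cdot> \<beta>)) = idm w" using fg(3) by simp
    then have b0: "\<beta> \<noteq> 0"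
      using comp_zero_right[OF wO z s sv] comp_zero_right[OF wO s w0 su] comp_zero_right[OF wO w0 wO fg(1)]
        simple_ident[OF Irr_simple[OF w(1)]] by auto
    have wJ: "w \<in> J"
      using b b0 w(1) J(2) hom_zero[OF wO z] by (auto simp: constituents_def)
    have "e \<cdot> \<beta> = \<beta>"
    proof -
      have "e \<cdot> v = v"
        using comp_assoc[OF s z s z v(1) sv v(1)] v comp_ident_right[OF s z v(1)] by simp
      then show ?thesis
        unfolding \<beta>_def using comp_assoc[OF wO s z z ug v(1), of e] e by (simp add: projection_def)
    qed
    moreover have "sum p S \<cdot> \<beta> = \<beta>"
    proof -
      have "sum p S \<cdot> \<beta> = (\<Sum>i\<in>S. p i \<cdot> \<beta>)"
        using comp_sum_left[OF wO z z b pin] .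
      also have "\<dots> = (\<Sum>(w', \<alpha>)\<in>S. \<alpha> \<cdot> (star \<alpha> \<cdot> \<beta>))"
        using comp_assoc[OF wO z S(2) z b S(4) S(3)] by (intro sum.cong) (auto simp: p_def)
      also have "\<dots> = (\<Sum>w'\<in>J. \<Sum>\<alpha>\<in>basis w' z. \<alpha> \<cdot> (star \<alpha> \<cdot> \<beta>))"
        unfolding S_def using J basis(1)[OF _ z] by (intro sum.Sigma[symmetric]) auto
      also have "\<dots> = (\<Sum>w'\<in>J. if w' = w then \<beta> else 0)"
      proof (intro sum.cong refl)
        fix w' assume w': "w' \<in> J"
        then have I: "w' \<in> Irr" using J by auto
        show "(\<Sum>\<alpha>\<in>basis w' z. \<alpha> \<cdot> (star \<alpha> \<cdot> \<beta>)) = (if w' = w then \<beta> else 0)"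
        proof (cases "w' = w")
          case True
          then show ?thesis
            using onb_expansion[OF Irr_simple[OF w(1)] z onb_basis[OF w(1) z] b] by simp
        next
          case False
          have "\<alpha> \<cdot> (star \<alpha> \<cdot> \<beta>) = 0" if "\<alpha> \<in> basis w' z" for \<alpha>
            using schur[OF w(1) I _ comp_in[OF wO z Irr_Ob[OF I] b basis(3)[OF I z that]]] False
              comp_zero_right[OF wO Irr_Ob[OF I] z basis(2)[OF I z that]] by simp
          with False show ?thesis by simp
        qed
      qed
      also have "\<dots> = \<beta>" using wJ J(1) by simp
      finally show ?thesis .
    qed
    ultimately show False
      using comp_diff_left[OF wO z z b ident_in[OF z], of "sum p S"] proj b0 comp_ident_left[OF wO z b]
      by (simp add: e_def projection_def)
  qed
  then show ?thesis by (simp add: e_def sum_eq)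
qed

section \<open>The universal property of Psi\<close>

text \<open>The bimodule structure that \<open>\<Psi>\<close> makes cyclic: morphisms of the category act on \<open>\<gamma>\<close> from
  both sides through the strand \<open>z\<close>, which runs from bottom left to top right, and leave the
  strands \<open>x\<close> and \<open>y\<close> alone.\<close>

definition sandwich :: "'o \<Rightarrow> 'o \<Rightarrow> 'm \<Rightarrow> 'm \<Rightarrow> 'm \<Rightarrow> 'm" where
  "sandwich x y \<tau> \<gamma> \<sigma> = (idm y \<boxtimes> \<tau>) \<cdot> \<gamma> \<cdot> (\<sigma> \<boxtimes> idm x)"

lemma Psi_basis: "w \<in> Irr \<Longrightarrow>
    Psi x y z \<gamma> w = (\<Sum>\<alpha>\<in>basis w z. sandwich x y (star \<alpha>) \<gamma> \<alpha>)"
  by (simp add: Psi_def basis_def sandwich_def)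

context
  fixes x y
  assumes x: "x \<in> Ob C" and y: "y \<in> Ob C"
begin

lemma sandwich_factors:
  assumes "z \<in> Ob C" "z' \<in> Ob C" "w \<in> Ob C" "w' \<in> Ob C"
    and "\<gamma> \<in> hom (z \<otimes> x) (y \<otimes> z')" "\<tau> \<in> hom z' w'" "\<sigma> \<in> hom w z"
  shows "idm y \<boxtimes> \<tau> \<in> hom (y \<otimes> z') (y \<otimes> w')" "\<sigma> \<boxtimes> idm x \<in> hom (w \<otimes> x) (z \<otimes> x)"
    and "(idm y \<boxtimes> \<tau>) \<cdot> \<gamma> \<in> hom (z \<otimes> x) (y \<otimes> w')" "sandwich x y \<tau> \<gamma> \<sigma> \<in> hom (w \<otimes> x) (y \<otimes> w')"
proof -
  show 1: "idm y \<boxtimes> \<tau> \<in> hom (y \<otimes> z') (y \<otimes> w')"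
    using mtens_in[OF y y assms(2,4) ident_in[OF y] assms(6)] .
  show 2: "\<sigma> \<boxtimes> idm x \<in> hom (w \<otimes> x) (z \<otimes> x)"
    using mtens_in[OF assms(3,1) x x assms(7) ident_in[OF x]] .
  show 3: "(idm y \<boxtimes> \<tau>) \<cdot> \<gamma> \<in> hom (z \<otimes> x) (y \<otimes> w')"
    using comp_in[OF _ _ _ assms(5) 1] assms x y by simp
  show "sandwich x y \<tau> \<gamma> \<sigma> \<in> hom (w \<otimes> x) (y \<otimes> w')"
    unfolding sandwich_def using comp_in[OF _ _ _ 2 3] assms x y by simp
qed

lemma sandwich_sum_left:
  assumes "z \<in> Ob C" "z' \<in> Ob C" "w \<in> Ob C" "w' \<in> Ob C"
    and "\<gamma> \<in> hom (z \<otimes> x) (y \<otimes> z')" "\<And>i. i \<in> A \<Longrightarrow> \<tau> i \<in> hom z' w'" "\<sigma> \<in> hom w z"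
  shows "sandwich x y (sum \<tau> A) \<gamma> \<sigma> = (\<Sum>i\<in>A. sandwich x y (\<tau> i) \<gamma> \<sigma>)"
proof -
  have o: "z \<otimes> x \<in> Ob C" "y \<otimes> z' \<in> Ob C" "w \<otimes> x \<in> Ob C" "y \<otimes> w' \<in> Ob C"
    using assms x y by simp_all
  note f = sandwich_factors[OF assms(1-5) _ assms(7)]
  have "idm y \<boxtimes> sum \<tau> A = (\<Sum>i\<in>A. idm y \<boxtimes> \<tau> i)"
    using mtens_sum_right[OF y y assms(2,4) ident_in[OF y] assms(6)] .
  also have "\<dots> \<cdot> \<gamma> = (\<Sum>i\<in>A. (idm y \<boxtimes> \<tau> i) \<cdot> \<gamma>)"
    using comp_sum_left[OF o(1,2,4) assms(5) f(1)[OF assms(6)]] .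
  also have "\<dots> \<cdot> (\<sigma> \<boxtimes> idm x) = (\<Sum>i\<in>A. sandwich x y (\<tau> i) \<gamma> \<sigma>)"
    unfolding sandwich_def
    using comp_sum_left[OF o(3,1,4) mtens_in[OF assms(3,1) x x assms(7) ident_in[OF x]] f(3)[OF assms(6)]] .
  finally show ?thesis by (simp add: sandwich_def)
qed

lemma sandwich_sum_right:
  assumes "z \<in> Ob C" "z' \<in> Ob C" "w \<in> Ob C" "w' \<in> Ob C"
    and "\<gamma> \<in> hom (z \<otimes> x) (y \<otimes> z')" "\<tau> \<in> hom z' w'" "\<And>i. i \<in> A \<Longrightarrow> \<sigma> i \<in> hom w z"
  shows "sandwich x y \<tau> \<gamma> (sum \<sigma> A) = (\<Sum>i\<in>A. sandwich x y \<tau> \<gamma> (\<sigma> i))"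
proof -
  have o: "z \<otimes> x \<in> Ob C" "y \<otimes> z' \<in> Ob C" "w \<otimes> x \<in> Ob C" "y \<otimes> w' \<in> Ob C"
    using assms x y by simp_all
  have f: "(idm y \<boxtimes> \<tau>) \<cdot> \<gamma> \<in> hom (z \<otimes> x) (y \<otimes> w')"
    using comp_in[OF o(1,2,4) assms(5) mtens_in[OF y y assms(2,4) ident_in[OF y] assms(6)]] .
  have "sum \<sigma> A \<boxtimes> idm x = (\<Sum>i\<in>A. \<sigma> i \<boxtimes> idm x)"
    using mtens_sum_left[OF assms(3,1) x x ident_in[OF x] assms(7)] .
  then show ?thesis
    unfolding sandwich_def
    using comp_sum_right[OF o(3,1,4) f mtens_in[OF assms(3,1) x x assms(7) ident_in[OF x]]] by simp
qed

lemma sandwich_add: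
  assumes "z \<in> Ob C" "z' \<in> Ob C" "w \<in> Ob C" "w' \<in> Ob C"
    and "\<gamma> \<in> hom (z \<otimes> x) (y \<otimes> z')" "\<gamma>' \<in> hom (z \<otimes> x) (y \<otimes> z')" "\<tau> \<in> hom z' w'" "\<sigma> \<in> hom w z"
  shows "sandwich x y \<tau> (\<gamma> + \<gamma>') \<sigma> = sandwich x y \<tau> \<gamma> \<sigma> + sandwich x y \<tau> \<gamma>' \<sigma>"
proof -
  have o: "z \<otimes> x \<in> Ob C" "y \<otimes> z' \<in> Ob C" "w \<otimes> x \<in> Ob C" "y \<otimes> w' \<in> Ob C"
    using assms x y by simp_all
  note f = sandwich_factors[OF assms(1-5,7,8)]
  note f' = sandwich_factors[OF assms(1-4,6,7,8)]
  show ?thesis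
    unfolding sandwich_def comp_add_right[OF o(1,2,4) assms(5,6) f(1)]
    using comp_add_left[OF o(3,1,4) f(2,3) f'(3)] .
qed

lemma sandwich_scale:
  assumes "z \<in> Ob C" "z' \<in> Ob C" "w \<in> Ob C" "w' \<in> Ob C"
    and "\<gamma> \<in> hom (z \<otimes> x) (y \<otimes> z')" "\<tau> \<in> hom z' w'" "\<sigma> \<in> hom w z"
  shows "sandwich x y (c \<odot> \<tau>) \<gamma> \<sigma> = c \<odot> sandwich x y \<tau> \<gamma> \<sigma>"
    and "sandwich x y \<tau> \<gamma> (c \<odot> \<sigma>) = c \<odot> sandwich x y \<tau> \<gamma> \<sigma>"
    and "sandwich x y \<tau> (c \<odot> \<gamma>) \<sigma> = c \<odot> sandwich x y \<tau> \<gamma> \<sigma>"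
proof -
  have o: "z \<otimes> x \<in> Ob C" "y \<otimes> z' \<in> Ob C" "w \<otimes> x \<in> Ob C" "y \<otimes> w' \<in> Ob C"
    using assms x y by simp_all
  note f = sandwich_factors[OF assms]
  show "sandwich x y (c \<odot> \<tau>) \<gamma> \<sigma> = c \<odot> sandwich x y \<tau> \<gamma> \<sigma>"
    unfolding sandwich_def mtens_scale_right[OF y y assms(2,4) ident_in[OF y] assms(6)]
      comp_scale_left[OF o(1,2,4) assms(5) f(1)] comp_scale_left[OF o(3,1,4) f(2,3)] ..
  show "sandwich x y \<tau> \<gamma> (c \<odot> \<sigma>) = c \<odot> sandwich x y \<tau> \<gamma> \<sigma>"
    unfolding sandwich_def mtens_scale_left[OF assms(3,1) x x assms(7) ident_in[OF x]]
      comp_scale_right[OF o(3,1,4) f(2,3)] ..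
  show "sandwich x y \<tau> (c \<odot> \<gamma>) \<sigma> = c \<odot> sandwich x y \<tau> \<gamma> \<sigma>"
    unfolding sandwich_def comp_scale_right[OF o(1,2,4) assms(5) f(1)]
      comp_scale_left[OF o(3,1,4) f(2,3)] ..
qed

lemma sandwich_sandwich:
  assumes "z \<in> Ob C" "z' \<in> Ob C" "w \<in> Ob C" "w' \<in> Ob C" "v \<in> Ob C" "v' \<in> Ob C"
    and "\<gamma> \<in> hom (z \<otimes> x) (y \<otimes> z')" "\<tau> \<in> hom z' w'" "\<sigma> \<in> hom w z"
    and "\<tau>' \<in> hom w' v'" "\<sigma>' \<in> hom v w"
  shows "sandwich x y \<tau>' (sandwich x y \<tau> \<gamma> \<sigma>) \<sigma>' = sandwich x y (\<tau>' \<cdot> \<tau>) \<gamma> (\<sigma> \<cdot> \<sigma>')"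
proof -
  define G where "G = Arrow (z \<otimes> x) (y \<otimes> z') \<gamma>"
  define T where "T = Arrow z' w' \<tau>"
  define T' where "T' = Arrow w' v' \<tau>'"
  define S where "S = Arrow w z \<sigma>"
  define S' where "S' = Arrow v w \<sigma>'"
  note defs = G_def T_def T'_def S_def S'_def
  have [simp]: "arr G" "arr T" "arr T'" "arr S" "arr S'" "src G = z \<otimes> x" "tgt G = y \<otimes> z'"
    "src T = z'" "tgt T = w'" "src T' = w'" "tgt T' = v'" "src S = w" "tgt S = z" "src S' = v" "tgt S' = w"
    using assms x y by (simp_all add: defs arr_Arrow)
  have "((idt y ** T') \<bullet> (((idt y ** T) \<bullet> G) \<bullet> (S ** idt x))) \<bullet> (S' ** idt x)
     = (((idt y ** T') \<bullet> (idt y ** T)) \<bullet> G) \<bullet> ((S ** idt x) \<bullet> (S' ** idt x))"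
    using assms x y by simp
  also have "\<dots> = ((idt y ** (T' \<bullet> T)) \<bullet> G) \<bullet> ((S \<bullet> S') ** idt x)"
    using assms x y by (simp add: interchange)
  finally show ?thesis
    unfolding sandwich_def by (drule_tac arg_cong[of _ _ mor]) (simp only: defs arrow_mor arrow.sel)
qed

lemma sandwich_ident:
  assumes "z \<in> Ob C" "z' \<in> Ob C" "\<gamma> \<in> hom (z \<otimes> x) (y \<otimes> z')"
  shows "sandwich x y (idm z') \<gamma> (idm z) = \<gamma>"
proof -
  have o: "z \<otimes> x \<in> Ob C" "y \<otimes> z' \<in> Ob C" using assms x y by simp_all
  show ?thesis
    unfolding sandwich_def mtens_ident[OF y assms(2)] mtens_ident[OF assms(1) x]
      comp_ident_left[OF o assms(3)] comp_ident_right[OF o assms(3)] ..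
qed

lemma Psi_add:
  assumes "z \<in> Ob C" "\<gamma> \<in> hom (z \<otimes> x) (y \<otimes> z)" "\<gamma>' \<in> hom (z \<otimes> x) (y \<otimes> z)"
  shows "Psi x y z (\<gamma> + \<gamma>') v = Psi x y z \<gamma> v + Psi x y z \<gamma>' v"
proof (cases "v \<in> Irr")
  case True
  then show ?thesis
    using sandwich_add[OF assms(1,1) Irr_Ob Irr_Ob assms(2,3) basis(3,2)[OF _ assms(1)], OF True True True _ True]
    by (simp add: Psi_basis sum.distrib)
qed (simp add: Psi_def)

lemma Psi_scale:
  assumes "z \<in> Ob C" "\<gamma> \<in> hom (z \<otimes> x) (y \<otimes> z)"
  shows "Psi x y z (c \<odot> \<gamma>) v = c \<odot> Psi x y z \<gamma> v"
proof (cases "v \<in> Irr")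
  case True
  then show ?thesis
    using sandwich_scale(3)[OF assms(1,1) Irr_Ob Irr_Ob assms(2) basis(3,2)[OF _ assms(1)], OF True True True _ True]
    by (simp add: Psi_basis V.scale_sum_right)
qed (simp add: Psi_def)

lemma Psi_in:
  assumes "z \<in> Ob C" "\<gamma> \<in> hom (z \<otimes> x) (y \<otimes> z)" "w \<in> Irr"
  shows "Psi x y z \<gamma> w \<in> hom (w \<otimes> x) (y \<otimes> w)"
  unfolding Psi_basis[OF assms(3)]
  using sandwich_factors(4)[OF assms(1,1) Irr_Ob[OF assms(3)] Irr_Ob[OF assms(3)] assms(2)
      basis(3,2)[OF assms(3,1)]] Irr_Ob[OF assms(3)] x y
  by (intro hom_sum) simp_all

text \<open>Expand \<open>star \<alpha> \<cdot> u\<close> on one side and \<open>u \<cdot> \<beta>\<close> on the other in the orthonormal bases; both expansions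
  have the same matrix of coefficients \<open>c \<alpha> \<beta>\<close>.\<close>

lemma Psi_trace:
  assumes z: "z \<in> Ob C" "z' \<in> Ob C" and u: "u \<in> hom z' z" and g: "\<gamma> \<in> hom (z \<otimes> x) (y \<otimes> z')"
  shows "Psi x y z (sandwich x y u \<gamma> (idm z)) = Psi x y z' (sandwich x y (idm z') \<gamma> u)"
proof
  fix w
  show "Psi x y z (sandwich x y u \<gamma> (idm z)) w = Psi x y z' (sandwich x y (idm z') \<gamma> u) w"
  proof (cases "w \<in> Irr")
    case True
    note w = Irr_Ob[OF True] and ws = Irr_simple[OF True]
    define c where "c \<alpha> \<beta> = scalar w (star \<alpha> \<cdot> (u \<cdot> \<beta>))" for \<alpha> \<beta>
    define T where "T \<alpha> \<beta> = c \<alpha> \<beta> \<odot> sandwich x y (star \<beta>) \<gamma> \<alpha>" for \<alpha> \<beta>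
    note a = basis(2,3)[OF True z(1)] and b = basis(2,3)[OF True z(2)]
    have ub: "u \<cdot> \<beta> \<in> hom w z" if "\<beta> \<in> basis w z'" for \<beta>
      using comp_in[OF w z(2,1) b(1)[OF that] u] .
    have aub: "star \<alpha> \<cdot> (u \<cdot> \<beta>) \<in> hom w w" if "\<alpha> \<in> basis w z" "\<beta> \<in> basis w z'" for \<alpha> \<beta>
      using comp_in[OF w z(1) w ub[OF that(2)] a(2)[OF that(1)]] .
    have au: "star \<alpha> \<cdot> u \<in> hom z' w" if "\<alpha> \<in> basis w z" for \<alpha>
      using comp_in[OF z(2,1) w u a(2)[OF that]] .
    have left: "sandwich x y (star \<alpha>) (sandwich x y u \<gamma> (idm z)) \<alpha> = (\<Sum>\<beta>\<in>basis w z'. T \<alpha> \<beta>)"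
      if al: "\<alpha> \<in> basis w z" for \<alpha>
    proof -
      have s: "star (star \<alpha> \<cdot> u) \<in> hom w z'" using star_in[OF z(2) w au[OF al]] .
      have scaled: "star (\<beta> \<cdot> (star \<beta> \<cdot> star (star \<alpha> \<cdot> u))) = c \<alpha> \<beta> \<odot> star \<beta>"
        if be: "\<beta> \<in> basis w z'" for \<beta>
      proof -
        have "star (\<beta> \<cdot> (star \<beta> \<cdot> star (star \<alpha> \<cdot> u))) = ((star \<alpha> \<cdot> u) \<cdot> \<beta>) \<cdot> star \<beta>"
          using star_comp[OF w w z(2) comp_in[OF w z(2) w s b(2)[OF be]] b(1)[OF be]]
            star_comp[OF w z(2) w s b(2)[OF be]] star_star[OF z(2) w au[OF al]]
            star_star[OF w z(2) b(1)[OF be]] by simp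
        also have "(star \<alpha> \<cdot> u) \<cdot> \<beta> = star \<alpha> \<cdot> (u \<cdot> \<beta>)"
          using comp_assoc[OF w z(2,1) w b(1)[OF be] u a(2)[OF al]] .
        also have "\<dots> \<cdot> star \<beta> = c \<alpha> \<beta> \<odot> star \<beta>"
          unfolding c_def using scalar_comp[OF ws z(2) b(2)[OF be] aub[OF al be]] .
        finally show ?thesis .
      qed
      have "star \<alpha> \<cdot> u = star (\<Sum>\<beta>\<in>basis w z'. \<beta> \<cdot> (star \<beta> \<cdot> star (star \<alpha> \<cdot> u)))"
        using onb_expansion[OF ws z(2) onb_basis[OF True z(2)] s] star_star[OF z(2) w au[OF al]] by simp
      also have "\<dots> = (\<Sum>\<beta>\<in>basis w z'. star (\<beta> \<cdot> (star \<beta> \<cdot> star (star \<alpha> \<cdot> u))))"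
        by (rule star_sum[OF w z(2) comp_in[OF w w z(2) comp_in[OF w z(2) w s b(2)] b(1)]])
      also have "\<dots> = (\<Sum>\<beta>\<in>basis w z'. c \<alpha> \<beta> \<odot> star \<beta>)"
        by (intro sum.cong refl scaled)
      finally have exp: "star \<alpha> \<cdot> u = (\<Sum>\<beta>\<in>basis w z'. c \<alpha> \<beta> \<odot> star \<beta>)" .
      have "sandwich x y (star \<alpha>) (sandwich x y u \<gamma> (idm z)) \<alpha> = sandwich x y (star \<alpha> \<cdot> u) \<gamma> \<alpha>"
        using sandwich_sandwich[OF z z(1,1) w w g u ident_in[OF z(1)] a(2,1)[OF al]]
          comp_ident_left[OF w z(1) a(1)[OF al]] by simp
      also have "\<dots> = (\<Sum>\<beta>\<in>basis w z'. sandwich x y (c \<alpha> \<beta> \<odot> star \<beta>) \<gamma> \<alpha>)"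
        unfolding exp
        by (rule sandwich_sum_left[OF z w w g hom_scale[OF z(2) w b(2)] a(1)[OF al]])
      also have "\<dots> = (\<Sum>\<beta>\<in>basis w z'. T \<alpha> \<beta>)"
        unfolding T_def by (intro sum.cong refl sandwich_scale(1)[OF z w w g b(2) a(1)[OF al]])
      finally show ?thesis .
    qed
    have right: "sandwich x y (star \<beta>) (sandwich x y (idm z') \<gamma> u) \<beta> = (\<Sum>\<alpha>\<in>basis w z. T \<alpha> \<beta>)"
      if be: "\<beta> \<in> basis w z'" for \<beta>
    proof -
      have "u \<cdot> \<beta> = (\<Sum>\<alpha>\<in>basis w z. \<alpha> \<cdot> (star \<alpha> \<cdot> (u \<cdot> \<beta>)))"
        using onb_expansion[OF ws z(1) onb_basis[OF True z(1)] ub[OF be]] by simp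
      also have "\<dots> = (\<Sum>\<alpha>\<in>basis w z. c \<alpha> \<beta> \<odot> \<alpha>)"
        unfolding c_def by (intro sum.cong refl comp_scalar[OF ws z(1) a(1) aub[OF _ be]])
      finally have exp: "u \<cdot> \<beta> = (\<Sum>\<alpha>\<in>basis w z. c \<alpha> \<beta> \<odot> \<alpha>)" .
      have "sandwich x y (star \<beta>) (sandwich x y (idm z') \<gamma> u) \<beta> = sandwich x y (star \<beta>) \<gamma> (u \<cdot> \<beta>)"
        using sandwich_sandwich[OF z z(2,2) w w g ident_in[OF z(2)] u b(2,1)[OF be]]
          comp_ident_right[OF z(2) w b(2)[OF be]] by simp
      also have "\<dots> = (\<Sum>\<alpha>\<in>basis w z. sandwich x y (star \<beta>) \<gamma> (c \<alpha> \<beta> \<odot> \<alpha>))"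
        unfolding exp
        by (rule sandwich_sum_right[OF z w w g b(2)[OF be] hom_scale[OF w z(1) a(1)]])
      also have "\<dots> = (\<Sum>\<alpha>\<in>basis w z. T \<alpha> \<beta>)"
        unfolding T_def by (intro sum.cong refl sandwich_scale(2)[OF z w w g b(2)[OF be] a(1)])
      finally show ?thesis .
    qed
    show ?thesis
      unfolding Psi_basis[OF True]
      using left right sum.swap[of T "basis w z'" "basis w z"] by simp
  qed (simp add: Psi_def)
qed

text \<open>Insert \<open>1\<^sub>z = \<Sum> \<alpha> \<cdot> star \<alpha>\<close> next to \<open>\<gamma>\<close> and move each \<open>\<alpha>\<close> to the other side with the trace property:
  what remains on the strand \<open>w\<close> is a summand of the \<open>w\<close>-component of \<open>\<Psi>\<close>. Additivity alone is
  assumed of \<open>F\<close>, so the statement covers conjugate-linear functions such as the involution. The index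
  set \<open>J\<close> may be enlarged, which is what makes different objects comparable.\<close>

theorem Psi_universal:
  fixes F :: "'o \<Rightarrow> 'm \<Rightarrow> 'b::ab_group_add"
  assumes add: "\<And>z \<gamma> \<gamma>'. \<lbrakk>z \<in> Ob C; \<gamma> \<in> hom (z \<otimes> x) (y \<otimes> z); \<gamma>' \<in> hom (z \<otimes> x) (y \<otimes> z)\<rbrakk>
      \<Longrightarrow> F z (\<gamma> + \<gamma>') = F z \<gamma> + F z \<gamma>'"
    and trace: "\<And>z z' u \<gamma>. \<lbrakk>z \<in> Ob C; z' \<in> Ob C; u \<in> hom z' z; \<gamma> \<in> hom (z \<otimes> x) (y \<otimes> z')\<rbrakk>
      \<Longrightarrow> F z (sandwich x y u \<gamma> (idm z)) = F z' (sandwich x y (idm z') \<gamma> u)"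
    and z: "z \<in> Ob C" and g: "\<gamma> \<in> hom (z \<otimes> x) (y \<otimes> z)"
    and J: "finite J" "constituents z \<subseteq> J" "J \<subseteq> Irr"
  shows "F z \<gamma> = (\<Sum>w\<in>J. F w (Psi x y z \<gamma> w))"
proof -
  have F0: "F z 0 = 0" if "z \<in> Ob C" for z
    using add[OF that, of 0 0] hom_zero[of "z \<otimes> x" "y \<otimes> z"] that x y by simp
  have Fsum: "F z (sum f A) = (\<Sum>i\<in>A. F z (f i))"
    if "z \<in> Ob C" "\<And>i. i \<in> A \<Longrightarrow> f i \<in> hom (z \<otimes> x) (y \<otimes> z)" for z A and f :: "'k \<Rightarrow> 'm"
    using that
  proof (induction A rule: infinite_finite_induct)
    case (insert i A)
    have "sum f A \<in> hom (z \<otimes> x) (y \<otimes> z)"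
      using insert.prems x y by (intro hom_sum) auto
    then show ?case using insert add[of z "f i" "sum f A"] by simp
  qed (simp_all add: F0)
  define S where "S = (SIGMA w:J. basis w z)"
  have S: "w \<in> Irr" "w \<in> Ob C" "\<alpha> \<in> hom w z" "star \<alpha> \<in> hom z w" "\<alpha> \<cdot> star \<alpha> \<in> hom z z"
    if "(w, \<alpha>) \<in> S" for w \<alpha>
    using that J basis(2,3)[OF _ z, of w \<alpha>] Irr_Ob[of w] comp_in[OF z _ z, of w "star \<alpha>" \<alpha>]
    by (auto simp: S_def)
  have sigma: "(\<Sum>w\<in>J. \<Sum>\<alpha>\<in>basis w z. f w \<alpha>) = (\<Sum>(w, \<alpha>)\<in>S. f w \<alpha>)"
    for f :: "'o \<Rightarrow> 'm \<Rightarrow> 'c::comm_monoid_add"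
    unfolding S_def using J basis(1)[OF _ z] by (intro sum.Sigma) auto
  have "\<gamma> = sandwich x y (\<Sum>i\<in>S. snd i \<cdot> star (snd i)) \<gamma> (idm z)"
    using ident_decomposition[OF z J] sandwich_ident[OF z z g]
    unfolding sigma by (simp add: case_prod_beta)
  also have "\<dots> = (\<Sum>i\<in>S. sandwich x y (snd i \<cdot> star (snd i)) \<gamma> (idm z))"
    using S(5) by (intro sandwich_sum_left[OF z z z z g _ ident_in[OF z]]) auto
  finally have "F z \<gamma> = F z (\<Sum>i\<in>S. sandwich x y (snd i \<cdot> star (snd i)) \<gamma> (idm z))" by simp
  also have "\<dots> = (\<Sum>i\<in>S. F z (sandwich x y (snd i \<cdot> star (snd i)) \<gamma> (idm z)))"
    using S(5) sandwich_factors(4)[OF z z z z g _ ident_in[OF z]] by (intro Fsum[OF z]) auto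
  also have "\<dots> = (\<Sum>(w, \<alpha>)\<in>S. F w (sandwich x y (star \<alpha>) \<gamma> \<alpha>))"
  proof (intro sum.cong refl)
    fix i assume "i \<in> S"
    moreover obtain w \<alpha> where i: "i = (w, \<alpha>)" by (cases i)
    ultimately have wa: "(w, \<alpha>) \<in> S" by simp
    note s = S[OF wa]
    have "sandwich x y (\<alpha> \<cdot> star \<alpha>) \<gamma> (idm z) = sandwich x y \<alpha> (sandwich x y (star \<alpha>) \<gamma> (idm z)) (idm z)"
      using sandwich_sandwich[OF z z z s(2) z z g s(4) ident_in[OF z] s(3) ident_in[OF z]]
        comp_ident_left[OF z z ident_in[OF z]] by simp
    also have "F z \<dots> = F w (sandwich x y (idm w) (sandwich x y (star \<alpha>) \<gamma> (idm z)) \<alpha>)"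
      using trace[OF z s(2,3) sandwich_factors(4)[OF z z z s(2) g s(4) ident_in[OF z]]] .
    also have "sandwich x y (idm w) (sandwich x y (star \<alpha>) \<gamma> (idm z)) \<alpha> = sandwich x y (star \<alpha>) \<gamma> \<alpha>"
      using sandwich_sandwich[OF z z z s(2,2,2) g s(4) ident_in[OF z] ident_in[OF s(2)] s(3)]
        comp_ident_left[OF z s(2) s(4)] comp_ident_left[OF s(2) z s(3)] by simp
    finally show "F z (sandwich x y (snd i \<cdot> star (snd i)) \<gamma> (idm z)) =
        (case i of (w, \<alpha>) \<Rightarrow> F w (sandwich x y (star \<alpha>) \<gamma> \<alpha>))"
      by (simp add: i)
  qed
  also have "\<dots> = (\<Sum>w\<in>J. \<Sum>\<alpha>\<in>basis w z. F w (sandwich x y (star \<alpha>) \<gamma> \<alpha>))"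
    unfolding sigma ..
  also have "\<dots> = (\<Sum>w\<in>J. F w (Psi x y z \<gamma> w))"
  proof (intro sum.cong refl)
    fix w assume "w \<in> J"
    then have w: "w \<in> Irr" "w \<in> Ob C" using J Irr_Ob by auto
    show "(\<Sum>\<alpha>\<in>basis w z. F w (sandwich x y (star \<alpha>) \<gamma> \<alpha>)) = F w (Psi x y z \<gamma> w)"
      unfolding Psi_basis[OF w(1)]
      using sandwich_factors(4)[OF z z w(2,2) g basis(3,2)[OF w(1) z]]
      by (intro Fsum[OF w(2), symmetric]) simp
  qed
  finally show ?thesis .
qed

corollary Psi_determines:
  fixes F :: "'o \<Rightarrow> 'm \<Rightarrow> 'b::ab_group_add"
  assumes add: "\<And>z \<gamma> \<gamma>'. \<lbrakk>z \<in> Ob C; \<gamma> \<in> hom (z \<otimes> x) (y \<otimes> z); \<gamma>' \<in> hom (z \<otimes> x) (y \<otimes> z)\<rbrakk>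
      \<Longrightarrow> F z (\<gamma> + \<gamma>') = F z \<gamma> + F z \<gamma>'"
    and trace: "\<And>z z' u \<gamma>. \<lbrakk>z \<in> Ob C; z' \<in> Ob C; u \<in> hom z' z; \<gamma> \<in> hom (z \<otimes> x) (y \<otimes> z')\<rbrakk>
      \<Longrightarrow> F z (sandwich x y u \<gamma> (idm z)) = F z' (sandwich x y (idm z') \<gamma> u)"
    and z: "z \<in> Ob C" "\<gamma> \<in> hom (z \<otimes> x) (y \<otimes> z)"
    and z': "z' \<in> Ob C" "\<gamma>' \<in> hom (z' \<otimes> x) (y \<otimes> z')"
    and eq: "Psi x y z \<gamma> = Psi x y z' \<gamma>'"
  shows "F z \<gamma> = F z' \<gamma>'"
proof -
  define J where "J = constituents z \<union> constituents z'"
  have J: "finite J" "constituents z \<subseteq> J" "constituents z' \<subseteq> J" "J \<subseteq> Irr"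
    using finite_constituents z(1) z'(1) by (auto simp: J_def constituents_def)
  show ?thesis
    using Psi_universal[of F, OF add trace z J(1,2,4)] Psi_universal[of F, OF add trace z' J(1,3,4)] eq
    by simp
qed

end

end

section \<open>Product and involution of the tube algebra\<close>

context cstar_tensor_category
begin

lemma cmp_idt_tensor [simp]:
  "arr f \<Longrightarrow> a \<in> Ob C \<Longrightarrow> b \<in> Ob C \<Longrightarrow> src f = a \<otimes> b \<Longrightarrow> f \<bullet> (idt a ** idt b) = f"
  "arr f \<Longrightarrow> a \<in> Ob C \<Longrightarrow> b \<in> Ob C \<Longrightarrow> tgt f = a \<otimes> b \<Longrightarrow> (idt a ** idt b) \<bullet> f = f"
  using cmp_idt[of f "a \<otimes> b"] by simp_all

lemma slide:
  assumes "arr f" "arr g"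
  shows "(f ** idt (tgt g)) \<bullet> (idt (src f) ** g) = f ** g"
    and "(idt (tgt f) ** g) \<bullet> (f ** idt (src g)) = f ** g"
  using assms by (simp_all add: interchange)

end

context tube_category
begin

definition Ra :: "'o \<Rightarrow> ('o, 'm) arrow" where "Ra x = Arrow \<one> (cj x \<otimes> x) (R x)"

definition Rba :: "'o \<Rightarrow> ('o, 'm) arrow" where "Rba x = Arrow \<one> (x \<otimes> cj x) (Rb x)"

lemma Ra_simps [simp]:
  "src (Ra x) = \<one>" "tgt (Ra x) = cj x \<otimes> x" "src (Rba x) = \<one>" "tgt (Rba x) = x \<otimes> cj x"
  "mor (Ra x) = R x" "mor (Rba x) = Rb x"
  by (simp_all add: Ra_def Rba_def)

lemma conjugate_arrows [simp]:
  assumes "x \<in> Ob C"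
  shows "cj x \<in> Ob C" "arr (Ra x)" "arr (Rba x)"
    and "(idt (cj x) ** dag (Rba x)) \<bullet> (Ra x ** idt (cj x)) = idt (cj x)"
    and "(idt x ** dag (Ra x)) \<bullet> (Rba x ** idt x) = idt x"
    and "(dag (Ra x) ** idt (cj x)) \<bullet> (idt (cj x) ** Rba x) = idt (cj x)"
    and "(dag (Rba x) ** idt x) \<bullet> (idt x ** Ra x) = idt x"
  using conjugate_solution_arrows[OF solution[OF assms] assms] by (simp_all add: Ra_def Rba_def)

lemma R_in: "x \<in> Ob C \<Longrightarrow> R x \<in> hom \<one> (cj x \<otimes> x)" "x \<in> Ob C \<Longrightarrow> Rb x \<in> hom \<one> (x \<otimes> cj x)"
  using solution[of x] by (auto simp: conjugate_solution_def)

lemma R_nonzero: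
  assumes x: "x \<in> Ob C" and nz: "idm x \<noteq> 0"
  shows "R x \<noteq> 0"
proof
  assume z: "R x = 0"
  have o: "cj x \<in> Ob C" "cj x \<otimes> x \<in> Ob C" using x by simp_all
  have "star (Rb x) \<boxtimes> idm x \<in> hom (x \<otimes> cj x \<otimes> x) x"
    using mtens_in[OF _ unit_in x x star_in[OF unit_in _ R_in(2)[OF x]] ident_in[OF x]] x by simp
  then have "idm x = 0"
    using frobenius_recover[OF solution[OF x] x ident_in[OF x]] z x
      comp_zero_right[OF unit_in o(2,2) mtens_in[OF o(1,1) x x ident_in[OF o(1)] ident_in[OF x]]]
      mtens_zero_right[OF x x unit_in o(2) ident_in[OF x]]
      comp_zero_right[OF x _ x, of "x \<otimes> cj x \<otimes> x" "star (Rb x) \<boxtimes> idm x"]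
    by simp
  with nz show False by simp
qed

definition tube_prod :: "'o \<Rightarrow> 'm \<Rightarrow> 'o \<Rightarrow> 'm \<Rightarrow> 'm" where
  "tube_prod z1 \<gamma>1 z2 \<gamma>2 = (\<gamma>1 \<boxtimes> idm z2) \<cdot> (idm z1 \<boxtimes> \<gamma>2)"

context
  fixes x y
  assumes x: "x \<in> Ob C" and y: "y \<in> Ob C"
begin

lemma tube_prod_factors:
  assumes "t \<in> Ob C" "z1 \<in> Ob C" "z1' \<in> Ob C" "z2 \<in> Ob C" "z2' \<in> Ob C"
    and "\<gamma>1 \<in> hom (z1 \<otimes> y) (t \<otimes> z1')" "\<gamma>2 \<in> hom (z2 \<otimes> x) (y \<otimes> z2')"
  shows "\<gamma>1 \<boxtimes> idm z2' \<in> hom (z1 \<otimes> y \<otimes> z2') (t \<otimes> z1' \<otimes> z2')"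
    and "idm z1 \<boxtimes> \<gamma>2 \<in> hom (z1 \<otimes> z2 \<otimes> x) (z1 \<otimes> y \<otimes> z2')"
    and "tube_prod z1 \<gamma>1 z2' \<gamma>2 \<in> hom (z1 \<otimes> z2 \<otimes> x) (t \<otimes> z1' \<otimes> z2')"
proof -
  show 1: "\<gamma>1 \<boxtimes> idm z2' \<in> hom (z1 \<otimes> y \<otimes> z2') (t \<otimes> z1' \<otimes> z2')"
    using mtens_in[OF _ _ assms(5,5,6) ident_in[OF assms(5)]] assms x y by simp
  show 2: "idm z1 \<boxtimes> \<gamma>2 \<in> hom (z1 \<otimes> z2 \<otimes> x) (z1 \<otimes> y \<otimes> z2')"
    using mtens_in[OF assms(2,2) _ _ ident_in[OF assms(2)] assms(7)] assms x y by simp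
  show "tube_prod z1 \<gamma>1 z2' \<gamma>2 \<in> hom (z1 \<otimes> z2 \<otimes> x) (t \<otimes> z1' \<otimes> z2')"
    unfolding tube_prod_def using comp_in[OF _ _ _ 2 1] assms x y by simp
qed

lemma tube_prod_add:
  assumes "t \<in> Ob C" "z1 \<in> Ob C" "z2 \<in> Ob C"
    and "\<gamma>1 \<in> hom (z1 \<otimes> y) (t \<otimes> z1)" "\<gamma>2 \<in> hom (z2 \<otimes> x) (y \<otimes> z2)"
  shows "\<gamma>1' \<in> hom (z1 \<otimes> y) (t \<otimes> z1) \<Longrightarrow>
      tube_prod z1 (\<gamma>1 + \<gamma>1') z2 \<gamma>2 = tube_prod z1 \<gamma>1 z2 \<gamma>2 + tube_prod z1 \<gamma>1' z2 \<gamma>2"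
    and "\<gamma>2' \<in> hom (z2 \<otimes> x) (y \<otimes> z2) \<Longrightarrow>
      tube_prod z1 \<gamma>1 z2 (\<gamma>2 + \<gamma>2') = tube_prod z1 \<gamma>1 z2 \<gamma>2 + tube_prod z1 \<gamma>1 z2 \<gamma>2'"
proof -
  note o = x y assms(1-3)
  have ob: "z1 \<otimes> z2 \<otimes> x \<in> Ob C" "z1 \<otimes> y \<otimes> z2 \<in> Ob C" "t \<otimes> z1 \<otimes> z2 \<in> Ob C"
    "z1 \<otimes> y \<in> Ob C" "t \<otimes> z1 \<in> Ob C" "z2 \<otimes> x \<in> Ob C" "y \<otimes> z2 \<in> Ob C"
    using o by simp_all
  note f = tube_prod_factors[OF assms(1,2,2,3,3,4,5)]
  show "tube_prod z1 (\<gamma>1 + \<gamma>1') z2 \<gamma>2 = tube_prod z1 \<gamma>1 z2 \<gamma>2 + tube_prod z1 \<gamma>1' z2 \<gamma>2"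
    if "\<gamma>1' \<in> hom (z1 \<otimes> y) (t \<otimes> z1)"
    unfolding tube_prod_def mtens_add_left[OF ob(4,5) o(5,5) assms(4) that ident_in[OF o(5)]]
    using comp_add_left[OF ob(1-3) f(2,1) tube_prod_factors(1)[OF assms(1,2,2,3,3) that assms(5)]] .
  show "tube_prod z1 \<gamma>1 z2 (\<gamma>2 + \<gamma>2') = tube_prod z1 \<gamma>1 z2 \<gamma>2 + tube_prod z1 \<gamma>1 z2 \<gamma>2'"
    if "\<gamma>2' \<in> hom (z2 \<otimes> x) (y \<otimes> z2)"
    unfolding tube_prod_def mtens_add_right[OF o(4,4) ob(6,7) ident_in[OF o(4)] assms(5) that]
    using comp_add_right[OF ob(1-3) f(2) tube_prod_factors(2)[OF assms(1,2,2,3,3,4) that] f(1)] .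
qed

lemma tube_prod_scale:
  assumes "t \<in> Ob C" "z1 \<in> Ob C" "z2 \<in> Ob C"
    and "\<gamma>1 \<in> hom (z1 \<otimes> y) (t \<otimes> z1)" "\<gamma>2 \<in> hom (z2 \<otimes> x) (y \<otimes> z2)"
  shows "tube_prod z1 (c \<odot> \<gamma>1) z2 \<gamma>2 = c \<odot> tube_prod z1 \<gamma>1 z2 \<gamma>2"
    and "tube_prod z1 \<gamma>1 z2 (c \<odot> \<gamma>2) = c \<odot> tube_prod z1 \<gamma>1 z2 \<gamma>2"
proof -
  note o = x y assms(1-3)
  have ob: "z1 \<otimes> z2 \<otimes> x \<in> Ob C" "z1 \<otimes> y \<otimes> z2 \<in> Ob C" "t \<otimes> z1 \<otimes> z2 \<in> Ob C"
    "z1 \<otimes> y \<in> Ob C" "t \<otimes> z1 \<in> Ob C" "z2 \<otimes> x \<in> Ob C" "y \<otimes> z2 \<in> Ob C"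
    using o by simp_all
  note f = tube_prod_factors[OF assms(1,2,2,3,3,4,5)]
  show "tube_prod z1 (c \<odot> \<gamma>1) z2 \<gamma>2 = c \<odot> tube_prod z1 \<gamma>1 z2 \<gamma>2"
    unfolding tube_prod_def mtens_scale_left[OF ob(4,5) o(5,5) assms(4) ident_in[OF o(5)]]
    using comp_scale_left[OF ob(1-3) f(2,1)] .
  show "tube_prod z1 \<gamma>1 z2 (c \<odot> \<gamma>2) = c \<odot> tube_prod z1 \<gamma>1 z2 \<gamma>2"
    unfolding tube_prod_def mtens_scale_right[OF o(4,4) ob(6,7) ident_in[OF o(4)] assms(5)]
    using comp_scale_right[OF ob(1-3) f(2,1)] .
qed

text \<open>Sliding \<open>\<gamma>2\<close> past \<open>u\<close> exhibits the products as the two sandwiches of one morphism with \<open>u \<otimes> 1\<close>.\<close>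

lemma tube_prod_trace_left:
  assumes t: "t \<in> Ob C" and z: "z1 \<in> Ob C" "z1' \<in> Ob C" "z2 \<in> Ob C" and u: "u \<in> hom z1' z1"
    and g: "\<gamma>1 \<in> hom (z1 \<otimes> y) (t \<otimes> z1')" "\<gamma>2 \<in> hom (z2 \<otimes> x) (y \<otimes> z2)"
  shows "Psi x t (z1 \<otimes> z2) (tube_prod z1 (sandwich y t u \<gamma>1 (idm z1)) z2 \<gamma>2)
    = Psi x t (z1' \<otimes> z2) (tube_prod z1' (sandwich y t (idm z1') \<gamma>1 u) z2 \<gamma>2)"
proof -
  let ?z1' = "idt z1'" and ?z1 = "idt z1" and ?z2 = "idt z2" and ?x = "idt x" and ?y = "idt y"
    and ?t = "idt t"
  define X where "X = tube_prod z1 \<gamma>1 z2 \<gamma>2"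
  have X: "X \<in> hom ((z1 \<otimes> z2) \<otimes> x) (t \<otimes> (z1' \<otimes> z2))"
    unfolding X_def using tube_prod_factors(3)[OF t z(1,2,3,3) g] x z by simp
  have u2: "u \<boxtimes> idm z2 \<in> hom (z1' \<otimes> z2) (z1 \<otimes> z2)"
    using mtens_in[OF z(2,1,3,3) u ident_in[OF z(3)]] .
  define U where "U = Arrow z1' z1 u"
  define G where "G = Arrow (z1 \<otimes> y) (t \<otimes> z1') \<gamma>1"
  define H where "H = Arrow (z2 \<otimes> x) (y \<otimes> z2) \<gamma>2"
  note defs = U_def G_def H_def
  have [simp]: "arr U" "arr G" "arr H" "src U = z1'" "tgt U = z1" "src G = z1 \<otimes> y" "tgt G = t \<otimes> z1'"
    "src H = z2 \<otimes> x" "tgt H = y \<otimes> z2"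
    using x y t z u g by (simp_all add: defs arr_Arrow)
  note [simp] = x y t z
  have "((((?t ** U) \<bullet> G) \<bullet> (?z1 ** ?y)) ** ?z2) \<bullet> (?z1 ** H)
      = ((?t ** (U ** ?z2)) \<bullet> (G ** ?z2) \<bullet> (?z1 ** H)) \<bullet> (idt (z1 \<otimes> z2) ** ?x)"
  proof -
    have "((((?t ** U) \<bullet> G) \<bullet> (?z1 ** ?y)) ** ?z2) = (?t ** U ** ?z2) \<bullet> (G ** ?z2)"
      by (simp add: interchange_three)
    then show ?thesis
      using cmp_idt(1)[of "(?t ** (U ** ?z2)) \<bullet> (G ** ?z2) \<bullet> (?z1 ** H)" "z1 \<otimes> z2 \<otimes> x"]
      by simp
  qed
  from arg_cong[OF this, of mor]
  have 1: "tube_prod z1 (sandwich y t u \<gamma>1 (idm z1)) z2 \<gamma>2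
      = sandwich x t (u \<boxtimes> idm z2) X (idm (z1 \<otimes> z2))"
    by (simp only: tube_prod_def sandwich_def X_def defs arrow_mor arrow.sel)
  have "((?t ** idt (z1' \<otimes> z2)) \<bullet> (G ** ?z2) \<bullet> (?z1 ** H)) \<bullet> ((U ** ?z2) ** ?x)
      = ((((?t ** ?z1') \<bullet> G) \<bullet> (U ** ?y)) ** ?z2) \<bullet> (?z1' ** H)"
  proof -
    have "((?t ** idt (z1' \<otimes> z2)) \<bullet> (G ** ?z2) \<bullet> (?z1 ** H)) \<bullet> ((U ** ?z2) ** ?x)
        = (G ** ?z2) \<bullet> (?z1 ** H) \<bullet> (U ** ?z2 ** ?x)"
      using cmp_idt(2)[of "G ** ?z2" "t \<otimes> z1' \<otimes> z2"] by (simp flip: cmp_assoc)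
    also have "(?z1 ** H) \<bullet> (U ** ?z2 ** ?x) = (U ** ?y ** ?z2) \<bullet> (?z1' ** H)"
      by (simp add: interchange)
    also have "(G ** ?z2) \<bullet> (U ** ?y ** ?z2) \<bullet> (?z1' ** H)
        = ((G ** ?z2) \<bullet> (U ** ?y ** ?z2)) \<bullet> (?z1' ** H)"
      by simp
    also have "(G ** ?z2) \<bullet> (U ** ?y ** ?z2) = (G \<bullet> (U ** ?y)) ** ?z2"
      by (simp add: interchange_three)
    finally show ?thesis by simp
  qed
  from arg_cong[OF this, of mor]
  have 2: "sandwich x t (idm (z1' \<otimes> z2)) X (u \<boxtimes> idm z2)
      = tube_prod z1' (sandwich y t (idm z1') \<gamma>1 u) z2 \<gamma>2"
    by (simp only: tube_prod_def sandwich_def X_def defs arrow_mor arrow.sel)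
  show ?thesis
    unfolding 1 2[symmetric] using Psi_trace[OF x t _ _ u2 X] by simp
qed

lemma tube_prod_trace_right:
  assumes t: "t \<in> Ob C" and z: "z1 \<in> Ob C" "z2 \<in> Ob C" "z2' \<in> Ob C" and u: "u \<in> hom z2' z2"
    and g: "\<gamma>1 \<in> hom (z1 \<otimes> y) (t \<otimes> z1)" "\<gamma>2 \<in> hom (z2 \<otimes> x) (y \<otimes> z2')"
  shows "Psi x t (z1 \<otimes> z2) (tube_prod z1 \<gamma>1 z2 (sandwich x y u \<gamma>2 (idm z2)))
    = Psi x t (z1 \<otimes> z2') (tube_prod z1 \<gamma>1 z2' (sandwich x y (idm z2') \<gamma>2 u))"
proof -
  let ?z2' = "idt z2'" and ?z1 = "idt z1" and ?z2 = "idt z2" and ?x = "idt x" and ?y = "idt y"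
    and ?t = "idt t"
  define X where "X = tube_prod z1 \<gamma>1 z2' \<gamma>2"
  have X: "X \<in> hom ((z1 \<otimes> z2) \<otimes> x) (t \<otimes> (z1 \<otimes> z2'))"
    unfolding X_def using tube_prod_factors(3)[OF t z(1,1,2,3) g] x z by simp
  have u2: "idm z1 \<boxtimes> u \<in> hom (z1 \<otimes> z2') (z1 \<otimes> z2)"
    using mtens_in[OF z(1,1,3,2) ident_in[OF z(1)] u] .
  define U where "U = Arrow z2' z2 u"
  define G where "G = Arrow (z1 \<otimes> y) (t \<otimes> z1) \<gamma>1"
  define H where "H = Arrow (z2 \<otimes> x) (y \<otimes> z2') \<gamma>2"
  note defs = U_def G_def H_def
  have [simp]: "arr U" "arr G" "arr H" "src U = z2'" "tgt U = z2" "src G = z1 \<otimes> y" "tgt G = t \<otimes> z1"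
    "src H = z2 \<otimes> x" "tgt H = y \<otimes> z2'"
    using x y t z u g by (simp_all add: defs arr_Arrow)
  note [simp] = x y t z
  have "(G ** ?z2) \<bullet> (?z1 ** (((?y ** U) \<bullet> H) \<bullet> (?z2 ** ?x)))
      = ((?t ** (?z1 ** U)) \<bullet> (G ** ?z2') \<bullet> (?z1 ** H)) \<bullet> (idt (z1 \<otimes> z2) ** ?x)"
  proof -
    have "?z1 ** (((?y ** U) \<bullet> H) \<bullet> (?z2 ** ?x)) = (?z1 ** ?y ** U) \<bullet> (?z1 ** H)"
      by (simp add: interchange)
    moreover have "(G ** ?z2) \<bullet> (?z1 ** ?y ** U) = (?t ** ?z1 ** U) \<bullet> (G ** ?z2')"
      using slide[of G U] by simp
    moreover have "(G ** ?z2) \<bullet> ((?z1 ** ?y ** U) \<bullet> (?z1 ** H))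
        = ((G ** ?z2) \<bullet> (?z1 ** ?y ** U)) \<bullet> (?z1 ** H)"
      by simp
    ultimately show ?thesis
      using cmp_idt(1)[of "(?t ** (?z1 ** U)) \<bullet> (G ** ?z2') \<bullet> (?z1 ** H)" "z1 \<otimes> z2 \<otimes> x"]
      by simp
  qed
  from arg_cong[OF this, of mor]
  have 1: "tube_prod z1 \<gamma>1 z2 (sandwich x y u \<gamma>2 (idm z2))
      = sandwich x t (idm z1 \<boxtimes> u) X (idm (z1 \<otimes> z2))"
    by (simp only: tube_prod_def sandwich_def X_def defs arrow_mor arrow.sel)
  have "((?t ** idt (z1 \<otimes> z2')) \<bullet> (G ** ?z2') \<bullet> (?z1 ** H)) \<bullet> ((?z1 ** U) ** ?x)
      = (G ** ?z2') \<bullet> (?z1 ** (((?y ** ?z2') \<bullet> H) \<bullet> (U ** ?x)))"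
  proof -
    have "((?t ** idt (z1 \<otimes> z2')) \<bullet> (G ** ?z2') \<bullet> (?z1 ** H)) \<bullet> ((?z1 ** U) ** ?x)
        = (G ** ?z2') \<bullet> (?z1 ** H) \<bullet> (?z1 ** U ** ?x)"
      using cmp_idt(2)[of "G ** ?z2'" "t \<otimes> z1 \<otimes> z2'"] by (simp flip: cmp_assoc)
    also have "(?z1 ** H) \<bullet> (?z1 ** U ** ?x) = ?z1 ** (H \<bullet> (U ** ?x))"
      by (simp add: interchange)
    finally show ?thesis by simp
  qed
  from arg_cong[OF this, of mor]
  have 2: "sandwich x t (idm (z1 \<otimes> z2')) X (idm z1 \<boxtimes> u)
      = tube_prod z1 \<gamma>1 z2' (sandwich x y (idm z2') \<gamma>2 u)"
    by (simp only: tube_prod_def sandwich_def X_def defs arrow_mor arrow.sel)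
  show ?thesis
    unfolding 1 2[symmetric] using Psi_trace[OF x t _ _ u2 X] z by simp
qed

text \<open>In each factor separately, the right-hand side is additive and has the trace property, hence
  depends only on the value of \<open>\<Psi>\<close>.\<close>

theorem tube_mult_Psi:
  assumes t: "t \<in> Ob C" and z: "z1 \<in> Ob C" "z2 \<in> Ob C"
    and g: "\<gamma>1 \<in> hom (z1 \<otimes> y) (t \<otimes> z1)" "\<gamma>2 \<in> hom (z2 \<otimes> x) (y \<otimes> z2)"
  shows "tube_mult x y t (Psi y t z1 \<gamma>1) (Psi x y z2 \<gamma>2)
    = Psi x t (z1 \<otimes> z2) (tube_prod z1 \<gamma>1 z2 \<gamma>2)"
proof -
  have left: "Psi x t (z \<otimes> z2) (tube_prod z \<gamma> z2 \<delta>) = Psi x t (z' \<otimes> z2) (tube_prod z' \<gamma>' z2 \<delta>)"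
    if o: "z \<in> Ob C" "z' \<in> Ob C" "z2 \<in> Ob C"
      and h: "\<gamma> \<in> hom (z \<otimes> y) (t \<otimes> z)" "\<gamma>' \<in> hom (z' \<otimes> y) (t \<otimes> z')" "\<delta> \<in> hom (z2 \<otimes> x) (y \<otimes> z2)"
      and eq: "Psi y t z \<gamma> = Psi y t z' \<gamma>'" for z z' z2 \<gamma> \<gamma>' \<delta>
  proof
    fix v
    define F where "F z \<gamma> = Psi x t (z \<otimes> z2) (tube_prod z \<gamma> z2 \<delta>) v" for z \<gamma>
    have "F z \<gamma> = F z' \<gamma>'"
    proof (rule Psi_determines[OF y t _ _ o(1) h(1) o(2) h(2) eq])
      fix z \<gamma> \<gamma>' assume a: "z \<in> Ob C" "\<gamma> \<in> hom (z \<otimes> y) (t \<otimes> z)" "\<gamma>' \<in> hom (z \<otimes> y) (t \<otimes> z)"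
      show "F z (\<gamma> + \<gamma>') = F z \<gamma> + F z \<gamma>'"
        unfolding F_def tube_prod_add(1)[OF t a(1) o(3) a(2) h(3) a(3)]
        using tube_prod_factors(3)[OF t a(1,1) o(3,3) a(2) h(3)]
          tube_prod_factors(3)[OF t a(1,1) o(3,3) a(3) h(3)] a(1) o(3) x
        by (intro Psi_add[OF x t]) simp_all
    next
      fix z z' u \<gamma> assume "z \<in> Ob C" "z' \<in> Ob C" "u \<in> hom z' z" "\<gamma> \<in> hom (z \<otimes> y) (t \<otimes> z')"
      then show "F z (sandwich y t u \<gamma> (idm z)) = F z' (sandwich y t (idm z') \<gamma> u)"
        unfolding F_def using tube_prod_trace_left[OF t _ _ o(3) _ _ h(3)] by simp
    qed
    then show "Psi x t (z \<otimes> z2) (tube_prod z \<gamma> z2 \<delta>) v = Psi x t (z' \<otimes> z2) (tube_prod z' \<gamma>' z2 \<delta>) v"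
      by (simp add: F_def)
  qed
  have right: "Psi x t (z1 \<otimes> z) (tube_prod z1 \<delta> z \<gamma>) = Psi x t (z1 \<otimes> z') (tube_prod z1 \<delta> z' \<gamma>')"
    if o: "z \<in> Ob C" "z' \<in> Ob C" "z1 \<in> Ob C"
      and h: "\<gamma> \<in> hom (z \<otimes> x) (y \<otimes> z)" "\<gamma>' \<in> hom (z' \<otimes> x) (y \<otimes> z')" "\<delta> \<in> hom (z1 \<otimes> y) (t \<otimes> z1)"
      and eq: "Psi x y z \<gamma> = Psi x y z' \<gamma>'" for z z' z1 \<gamma> \<gamma>' \<delta>
  proof
    fix v
    define F where "F z \<gamma> = Psi x t (z1 \<otimes> z) (tube_prod z1 \<delta> z \<gamma>) v" for z \<gamma>
    have "F z \<gamma> = F z' \<gamma>'"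
    proof (rule Psi_determines[OF x y _ _ o(1) h(1) o(2) h(2) eq])
      fix z \<gamma> \<gamma>' assume a: "z \<in> Ob C" "\<gamma> \<in> hom (z \<otimes> x) (y \<otimes> z)" "\<gamma>' \<in> hom (z \<otimes> x) (y \<otimes> z)"
      show "F z (\<gamma> + \<gamma>') = F z \<gamma> + F z \<gamma>'"
        unfolding F_def tube_prod_add(2)[OF t o(3) a(1) h(3) a(2,3)]
        using tube_prod_factors(3)[OF t o(3,3) a(1,1) h(3) a(2)]
          tube_prod_factors(3)[OF t o(3,3) a(1,1) h(3) a(3)] a(1) o(3) x
        by (intro Psi_add[OF x t]) simp_all
    next
      fix z z' u \<gamma> assume "z \<in> Ob C" "z' \<in> Ob C" "u \<in> hom z' z" "\<gamma> \<in> hom (z \<otimes> x) (y \<otimes> z')"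
      then show "F z (sandwich x y u \<gamma> (idm z)) = F z' (sandwich x y (idm z') \<gamma> u)"
        unfolding F_def using tube_prod_trace_right[OF t o(3) _ _ _ h(3)] by simp
    qed
    then show "Psi x t (z1 \<otimes> z) (tube_prod z1 \<delta> z \<gamma>) v = Psi x t (z1 \<otimes> z') (tube_prod z1 \<delta> z' \<gamma>') v"
      by (simp add: F_def)
  qed
  show ?thesis
    unfolding tube_mult_def
  proof (rule the_equality)
    show "\<exists>w1\<in>Ob C. \<exists>\<delta>1\<in>hom (w1 \<otimes> y) (t \<otimes> w1). \<exists>w2\<in>Ob C. \<exists>\<delta>2\<in>hom (w2 \<otimes> x) (y \<otimes> w2).
        Psi y t z1 \<gamma>1 = Psi y t w1 \<delta>1 \<and> Psi x y z2 \<gamma>2 = Psi x y w2 \<delta>2 \<and>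
        Psi x t (z1 \<otimes> z2) (tube_prod z1 \<gamma>1 z2 \<gamma>2)
          = Psi x t (w1 \<otimes> w2) ((\<delta>1 \<boxtimes> idm w2) \<cdot> (idm w1 \<boxtimes> \<delta>2))"
      using z g by (auto simp: tube_prod_def)
  next
    fix c
    assume "\<exists>w1\<in>Ob C. \<exists>\<delta>1\<in>hom (w1 \<otimes> y) (t \<otimes> w1). \<exists>w2\<in>Ob C. \<exists>\<delta>2\<in>hom (w2 \<otimes> x) (y \<otimes> w2).
        Psi y t z1 \<gamma>1 = Psi y t w1 \<delta>1 \<and> Psi x y z2 \<gamma>2 = Psi x y w2 \<delta>2 \<and>
        c = Psi x t (w1 \<otimes> w2) ((\<delta>1 \<boxtimes> idm w2) \<cdot> (idm w1 \<boxtimes> \<delta>2))"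
    then obtain w1 \<delta>1 w2 \<delta>2 where w: "w1 \<in> Ob C" "\<delta>1 \<in> hom (w1 \<otimes> y) (t \<otimes> w1)" "w2 \<in> Ob C"
      "\<delta>2 \<in> hom (w2 \<otimes> x) (y \<otimes> w2)" "Psi y t z1 \<gamma>1 = Psi y t w1 \<delta>1" "Psi x y z2 \<gamma>2 = Psi x y w2 \<delta>2"
      "c = Psi x t (w1 \<otimes> w2) (tube_prod w1 \<delta>1 w2 \<delta>2)"
      by (auto simp: tube_prod_def)
    show "c = Psi x t (z1 \<otimes> z2) (tube_prod z1 \<gamma>1 z2 \<gamma>2)"
      using left[OF z(1) w(1) z(2) g(1) w(2) g(2) w(5)] right[OF z(2) w(3,1) g(2) w(4,2,6)] w(7)
      by simp
  qed
qed

end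

end

context tube_category
begin

text \<open>The dual of \<open>star u\<close>, that is \<open>star u\<close> with both of its strands bent around.\<close>

definition transposed :: "'o \<Rightarrow> 'o \<Rightarrow> 'm \<Rightarrow> 'm" where
  "transposed z z' u = (star (R z') \<boxtimes> idm (cj z)) \<cdot> (idm (cj z') \<boxtimes> star u \<boxtimes> idm (cj z)) \<cdot>
     (idm (cj z') \<boxtimes> Rb z)"

text \<open>For \<open>z' = z\<close> this represents the adjoint of \<open>\<Psi>\<^sup>z(\<gamma>)\<close>. Two different objects are allowed because the
  trace property concerns morphisms \<open>\<gamma> : z \<otimes> x \<rightarrow> y \<otimes> z'\<close>, whose two \<open>z\<close>-strands do not match.\<close>

definition sharp :: "'o \<Rightarrow> 'o \<Rightarrow> 'o \<Rightarrow> 'o \<Rightarrow> 'm \<Rightarrow> 'm" where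
  "sharp x y z z' \<gamma> =
     (star (R z) \<boxtimes> idm x \<boxtimes> idm (cj z')) \<cdot>
     (idm (cj z) \<boxtimes> star \<gamma> \<boxtimes> idm (cj z')) \<cdot>
     (idm (cj z) \<boxtimes> idm y \<boxtimes> Rb z')"

text \<open>The transpose of \<open>star u\<close> can be slid through the solutions of the conjugate equations on
  either side.\<close>

lemma transposed_arrows:
  assumes z: "z \<in> Ob C" "z' \<in> Ob C" and u: "u \<in> hom z' z"
  defines "U \<equiv> Arrow z' z u" and "T \<equiv> Arrow (cj z') (cj z) (transposed z z' u)"
  shows "arr T" "(idt z' ** T) \<bullet> Rba z' = (dag U ** idt (cj z)) \<bullet> Rba z"
    and "dag (Ra z) \<bullet> (T ** idt z) = dag (Ra z') \<bullet> (idt (cj z') ** dag U)"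
proof -
  let ?cz' = "idt (cj z')" and ?z' = "idt z'" and ?Sz' = "Rba z'" and ?Rz' = "Ra z'"
    and ?cz = "idt (cj z)" and ?z = "idt z" and ?Sz = "Rba z" and ?Rz = "Ra z"
  note [simp] = z
  have [simp]: "arr U" "src U = z'" "tgt U = z" using z u by (simp_all add: U_def arr_Arrow)
  define B where "B = ?cz' ** dag U ** ?cz"
  have "T = ((dag ?Rz' ** ?cz) \<bullet> B) \<bullet> (?cz' ** ?Sz)"
    by (simp add: T_def transposed_def cmp_def tns_def dag_def idt_def Ra_def Rba_def U_def B_def)
  then have T: "T = (dag ?Rz' ** ?cz) \<bullet> B \<bullet> (?cz' ** ?Sz)"
    by (simp add: B_def)
  show "arr T"
    unfolding T B_def by simp
  have "(?z' ** T) \<bullet> ?Sz'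
      = (?z' ** dag ?Rz' ** ?cz) \<bullet> (?z' ** B) \<bullet> (?z' ** ?cz' ** ?Sz) \<bullet> ?Sz'"
  proof -
    have "?z' ** T = (?z' ** dag ?Rz' ** ?cz) \<bullet> (?z' ** B) \<bullet> (?z' ** ?cz' ** ?Sz)"
      unfolding T B_def by (simp add: interchange)
    then show ?thesis by (simp add: B_def)
  qed
  also have "(?z' ** ?cz' ** ?Sz) \<bullet> ?Sz' = (?Sz' ** ?z ** ?cz) \<bullet> ?Sz"
    using slide[of "?Sz'" "?Sz"] by simp
  also have "(?z' ** B) \<bullet> (?Sz' ** ?z ** ?cz) \<bullet> ?Sz
      = ((?z' ** B) \<bullet> (?Sz' ** ?z ** ?cz)) \<bullet> ?Sz"
    by (simp add: B_def)
  also have "(?z' ** B) \<bullet> (?Sz' ** ?z ** ?cz)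
      = (?Sz' ** ?z' ** ?cz) \<bullet> (dag U ** ?cz)"
    using slide[of "?Sz'" "dag U ** ?cz"] by (simp add: B_def)
  also have "(?z' ** dag ?Rz' ** ?cz) \<bullet>
      ((?Sz' ** ?z' ** ?cz) \<bullet> (dag U ** ?cz)) \<bullet> ?Sz
      = ((?z' ** dag ?Rz' ** ?cz) \<bullet> (?Sz' ** ?z' ** ?cz)) \<bullet>
        (dag U ** ?cz) \<bullet> ?Sz"
    by simp
  also have "(?z' ** dag ?Rz' ** ?cz) \<bullet> (?Sz' ** ?z' ** ?cz)
      = ((?z' ** dag ?Rz') \<bullet> (?Sz' ** ?z')) ** ?cz"
    using interchange[of "?Sz' ** ?z'" "?z' ** dag ?Rz'" "?cz" "?cz"] by simp
  finally show "(?z' ** T) \<bullet> ?Sz' = (dag U ** ?cz) \<bullet> ?Sz" by simp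
  have "dag ?Rz \<bullet> (T ** ?z)
      = dag ?Rz \<bullet> (dag ?Rz' ** ?cz ** ?z) \<bullet> (B ** ?z) \<bullet> (?cz' ** ?Sz ** ?z)"
  proof -
    have "T ** ?z = (dag ?Rz' ** ?cz ** ?z) \<bullet> (B ** ?z) \<bullet> (?cz' ** ?Sz ** ?z)"
      using interchange[of "B \<bullet> (?cz' ** ?Sz)" "dag ?Rz' ** ?cz" "?z" "?z"]
        interchange[of "?cz' ** ?Sz" B "?z" "?z"]
      unfolding T by (simp add: B_def)
    then show ?thesis by simp
  qed
  also have "\<dots> = (dag ?Rz \<bullet> (dag ?Rz' ** ?cz ** ?z)) \<bullet> (B ** ?z) \<bullet> (?cz' ** ?Sz ** ?z)"
    by (simp add: B_def)
  also have "dag ?Rz \<bullet> (dag ?Rz' ** ?cz ** ?z) = dag ?Rz' \<bullet> (?cz' ** ?z' ** dag ?Rz)"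
    using slide[of "dag ?Rz'" "dag ?Rz"] by simp
  also have "(dag ?Rz' \<bullet> (?cz' ** ?z' ** dag ?Rz)) \<bullet> (B ** ?z) \<bullet> (?cz' ** ?Sz ** ?z)
      = dag ?Rz' \<bullet> ((?cz' ** ?z' ** dag ?Rz) \<bullet> (B ** ?z)) \<bullet> (?cz' ** ?Sz ** ?z)"
    by (simp add: B_def)
  also have "(?cz' ** ?z' ** dag ?Rz) \<bullet> (B ** ?z)
      = (?cz' ** dag U) \<bullet> (?cz' ** ?z ** dag ?Rz)"
  proof -
    have "(?z' ** dag ?Rz) \<bullet> (dag U ** ?cz ** ?z) = dag U \<bullet> (?z ** dag ?Rz)"
      using slide[of "dag U" "dag ?Rz"] by simp
    then show ?thesis by (simp add: B_def interchange)
  qed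
  also have "dag ?Rz' \<bullet> ((?cz' ** dag U) \<bullet> (?cz' ** ?z ** dag ?Rz)) \<bullet> (?cz' ** ?Sz ** ?z)
      = dag ?Rz' \<bullet> (?cz' ** dag U) \<bullet> (?cz' ** ((?z ** dag ?Rz) \<bullet> (?Sz ** ?z)))"
  proof -
    have "(?cz' ** ?z ** dag ?Rz) \<bullet> (?cz' ** ?Sz ** ?z)
       = ?cz' ** ((?z ** dag ?Rz) \<bullet> (?Sz ** ?z))"
      using interchange[of "?cz'" "?cz'" "?Sz ** ?z" "?z ** dag ?Rz"] by simp
    then show ?thesis by simp
  qed
  finally show "dag ?Rz \<bullet> (T ** ?z) = dag ?Rz' \<bullet> (?cz' ** dag U)" by simp
qed

context
  fixes x y
  assumes x: "x \<in> Ob C" and y: "y \<in> Ob C"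
begin

lemma sharp_factors:
  assumes z: "z \<in> Ob C" "z' \<in> Ob C" and g: "\<gamma> \<in> hom (z \<otimes> x) (y \<otimes> z')"
  shows "idm (cj z) \<boxtimes> idm y \<boxtimes> Rb z' \<in> hom (cj z \<otimes> y) (cj z \<otimes> y \<otimes> z' \<otimes> cj z')"
    and "idm (cj z) \<boxtimes> star \<gamma> \<boxtimes> idm (cj z') \<in> hom (cj z \<otimes> y \<otimes> z' \<otimes> cj z') (cj z \<otimes> z \<otimes> x \<otimes> cj z')"
    and "star (R z) \<boxtimes> idm x \<boxtimes> idm (cj z') \<in> hom (cj z \<otimes> z \<otimes> x \<otimes> cj z') (x \<otimes> cj z')"
    and "(star (R z) \<boxtimes> idm x \<boxtimes> idm (cj z')) \<cdot> (idm (cj z) \<boxtimes> star \<gamma> \<boxtimes> idm (cj z'))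
      \<in> hom (cj z \<otimes> y \<otimes> z' \<otimes> cj z') (x \<otimes> cj z')"
    and "sharp x y z z' \<gamma> \<in> hom (cj z \<otimes> y) (x \<otimes> cj z')"
proof -
  let ?cz' = "idt (cj z')" and ?Sz' = "Rba z'" and ?cz = "idt (cj z)" and ?Rz = "Ra z"
    and ?x = "idt x" and ?y = "idt y"
  note [simp] = x y z
  define G where "G = Arrow (z \<otimes> x) (y \<otimes> z') \<gamma>"
  have [simp]: "arr G" "src G = z \<otimes> x" "tgt G = y \<otimes> z'" "mor G = \<gamma>" using g by (simp_all add: G_def arr_Arrow)
  have 1: "arr (?cz ** ?y ** ?Sz')" "arr (?cz ** dag G ** ?cz')"
    "arr (dag ?Rz ** ?x ** ?cz')"
    "arr ((dag ?Rz ** ?x ** ?cz') \<bullet> (?cz ** dag G ** ?cz'))"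
    "arr (((dag ?Rz ** ?x ** ?cz') \<bullet> (?cz ** dag G ** ?cz')) \<bullet> (?cz ** ?y ** ?Sz'))"
    by simp_all
  from 1[unfolded arr_def arrow_mor] show
    "idm (cj z) \<boxtimes> idm y \<boxtimes> Rb z' \<in> hom (cj z \<otimes> y) (cj z \<otimes> y \<otimes> z' \<otimes> cj z')"
    "idm (cj z) \<boxtimes> star \<gamma> \<boxtimes> idm (cj z') \<in> hom (cj z \<otimes> y \<otimes> z' \<otimes> cj z') (cj z \<otimes> z \<otimes> x \<otimes> cj z')"
    "star (R z) \<boxtimes> idm x \<boxtimes> idm (cj z') \<in> hom (cj z \<otimes> z \<otimes> x \<otimes> cj z') (x \<otimes> cj z')"
    "(star (R z) \<boxtimes> idm x \<boxtimes> idm (cj z')) \<cdot> (idm (cj z) \<boxtimes> star \<gamma> \<boxtimes> idm (cj z'))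
      \<in> hom (cj z \<otimes> y \<otimes> z' \<otimes> cj z') (x \<otimes> cj z')"
    "sharp x y z z' \<gamma> \<in> hom (cj z \<otimes> y) (x \<otimes> cj z')"
    by (simp_all add: sharp_def)
qed

lemma sharp_add:
  assumes z: "z \<in> Ob C" "z' \<in> Ob C"
    and g: "\<gamma> \<in> hom (z \<otimes> x) (y \<otimes> z')" "\<gamma>' \<in> hom (z \<otimes> x) (y \<otimes> z')"
  shows "sharp x y z z' (\<gamma> + \<gamma>') = sharp x y z z' \<gamma> + sharp x y z z' \<gamma>'"
proof -
  have o: "cj z \<otimes> y \<in> Ob C" "cj z \<otimes> y \<otimes> z' \<otimes> cj z' \<in> Ob C" "cj z \<otimes> z \<otimes> x \<otimes> cj z' \<in> Ob C"
    "x \<otimes> cj z' \<in> Ob C" "cj z \<in> Ob C" "cj z' \<in> Ob C" "z \<otimes> x \<in> Ob C" "y \<otimes> z' \<in> Ob C"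
    "(z \<otimes> x) \<otimes> cj z' \<in> Ob C" "(y \<otimes> z') \<otimes> cj z' \<in> Ob C"
    using x y z by simp_all
  have s: "star \<gamma> \<in> hom (y \<otimes> z') (z \<otimes> x)" "star \<gamma>' \<in> hom (y \<otimes> z') (z \<otimes> x)"
    using star_in[OF o(7,8)] g by auto
  note i = ident_in[OF o(6)]
  note f = sharp_factors[OF z g(1)] and f' = sharp_factors[OF z g(2)]
  have "idm (cj z) \<boxtimes> star (\<gamma> + \<gamma>') \<boxtimes> idm (cj z')
      = idm (cj z) \<boxtimes> star \<gamma> \<boxtimes> idm (cj z') + idm (cj z) \<boxtimes> star \<gamma>' \<boxtimes> idm (cj z')"
    unfolding star_add[OF o(7,8) g] mtens_add_left[OF o(8,7,6,6) s i]
    by (rule mtens_add_right[OF o(5,5,10,9) ident_in[OF o(5)] mtens_in[OF o(8,7,6,6) s(1) i]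
          mtens_in[OF o(8,7,6,6) s(2) i]])
  then show ?thesis
    unfolding sharp_def
    using comp_add_right[OF o(2,3,4) f(2) f'(2) f(3)] comp_add_left[OF o(1,2,4) f(1,4) f'(4)] by simp
qed

lemma sharp_scale:
  assumes z: "z \<in> Ob C" "z' \<in> Ob C" and g: "\<gamma> \<in> hom (z \<otimes> x) (y \<otimes> z')"
  shows "sharp x y z z' (c \<odot> \<gamma>) = cnj c \<odot> sharp x y z z' \<gamma>"
proof -
  have o: "cj z \<otimes> y \<in> Ob C" "cj z \<otimes> y \<otimes> z' \<otimes> cj z' \<in> Ob C" "cj z \<otimes> z \<otimes> x \<otimes> cj z' \<in> Ob C"
    "x \<otimes> cj z' \<in> Ob C" "cj z \<in> Ob C" "cj z' \<in> Ob C" "z \<otimes> x \<in> Ob C" "y \<otimes> z' \<in> Ob C"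
    "(z \<otimes> x) \<otimes> cj z' \<in> Ob C" "(y \<otimes> z') \<otimes> cj z' \<in> Ob C"
    using x y z by simp_all
  have s: "star \<gamma> \<in> hom (y \<otimes> z') (z \<otimes> x)"
    using star_in[OF o(7,8)] g by auto
  note i = ident_in[OF o(6)]
  note f = sharp_factors[OF z g]
  have "idm (cj z) \<boxtimes> star (c \<odot> \<gamma>) \<boxtimes> idm (cj z') = cnj c \<odot> (idm (cj z) \<boxtimes> star \<gamma> \<boxtimes> idm (cj z'))"
    unfolding star_scale[OF o(7,8) g] mtens_scale_left[OF o(8,7,6,6) s i]
    by (rule mtens_scale_right[OF o(5,5,10,9) ident_in[OF o(5)] mtens_in[OF o(8,7,6,6) s i]])
  then show ?thesis
    unfolding sharp_def
    using comp_scale_right[OF o(2,3,4) f(2,3)] comp_scale_left[OF o(1,2,4) f(1,4)] by simp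
qed

text \<open>A morphism \<open>u\<close> on the strand \<open>z\<close> turns under \<open>sharp\<close> into its transpose on the strand \<open>cj z\<close>,
  on the opposite side. So both arguments of \<open>\<Psi>\<close> come from the same morphism, \<open>Y\<close> in the proof, and
  the trace property for \<open>u\<close> follows from the one for its transpose.\<close>

lemma sharp_trace:
  assumes z: "z \<in> Ob C" "z' \<in> Ob C" and u: "u \<in> hom z' z" and g: "\<gamma> \<in> hom (z \<otimes> x) (y \<otimes> z')"
  shows "Psi y x (cj z) (sharp x y z z (sandwich x y u \<gamma> (idm z)))
    = Psi y x (cj z') (sharp x y z' z' (sandwich x y (idm z') \<gamma> u))"
proof -
  let ?cz' = "idt (cj z')" and ?z' = "idt z'" and ?Sz' = "Rba z'" and ?Rz' = "Ra z'"
    and ?cz = "idt (cj z)" and ?z = "idt z" and ?Sz = "Rba z" and ?Rz = "Ra z" and ?x = "idt x"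
    and ?y = "idt y"
  note [simp] = x y z
  define U where "U = Arrow z' z u"
  define G where "G = Arrow (z \<otimes> x) (y \<otimes> z') \<gamma>"
  define T where "T = Arrow (cj z') (cj z) (transposed z z' u)"
  define Y where "Y = ((dag ?Rz ** ?x ** ?cz') \<bullet> (?cz ** dag G ** ?cz')) \<bullet>
    (?cz ** ?y ** ?Sz')"
  have [simp]: "arr U" "src U = z'" "tgt U = z" "arr G" "src G = z \<otimes> x" "tgt G = y \<otimes> z'"
    "src T = cj z'" "tgt T = cj z"
    using u g by (simp_all add: U_def G_def T_def arr_Arrow)
  note T = transposed_arrows[OF z u, folded U_def T_def]
  note [simp] = T(1)
  have Y: "arr Y" "src Y = cj z \<otimes> y" "tgt Y = x \<otimes> cj z'" "mor Y = sharp x y z z' \<gamma>"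
    subgoal unfolding Y_def by simp
    subgoal unfolding Y_def by simp
    subgoal unfolding Y_def by simp
    subgoal unfolding Y_def sharp_def by (simp only: G_def arrow_mor arrow.sel Ra_simps)
    done
  have Y': "Y = (dag ?Rz ** ?x ** ?cz') \<bullet> (?cz ** dag G ** ?cz') \<bullet>
      (?cz ** ?y ** ?Sz')"
    unfolding Y_def by simp
  have "((dag ?Rz ** ?x ** ?cz) \<bullet>
      (?cz ** dag (((?y ** U) \<bullet> G) \<bullet> (?z ** ?x)) ** ?cz)) \<bullet> (?cz ** ?y ** ?Sz)
    = ((?x ** T) \<bullet> Y) \<bullet> (?cz ** ?y)" (is "?L = ?M")
  proof -
    have "?L = (dag ?Rz ** ?x ** ?cz) \<bullet> (?cz ** (dag G \<bullet> (?y ** dag U)) ** ?cz) \<bullet>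
        (?cz ** ?y ** ?Sz)"
      by simp
    also have "(?cz ** (dag G \<bullet> (?y ** dag U)) ** ?cz)
        = (?cz ** dag G ** ?cz) \<bullet> (?cz ** ?y ** dag U ** ?cz)"
      using interchange[of "?y ** dag U" "dag G" "?cz" "?cz"] by (simp add: interchange)
    also have "(dag ?Rz ** ?x ** ?cz) \<bullet>
        ((?cz ** dag G ** ?cz) \<bullet> (?cz ** ?y ** dag U ** ?cz)) \<bullet>
        (?cz ** ?y ** ?Sz)
      = (dag ?Rz ** ?x ** ?cz) \<bullet> (?cz ** dag G ** ?cz) \<bullet>
        (?cz ** ?y ** ((dag U ** ?cz) \<bullet> ?Sz))"
      by (simp add: interchange)
    also have "?cz ** ?y ** ((dag U ** ?cz) \<bullet> ?Sz)
        = (?cz ** ?y ** ?z' ** T) \<bullet> (?cz ** ?y ** ?Sz')"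
      unfolding T(2)[symmetric] by (simp add: interchange)
    also have "(dag ?Rz ** ?x ** ?cz) \<bullet> (?cz ** dag G ** ?cz) \<bullet>
        (?cz ** ?y ** ?z' ** T) \<bullet> (?cz ** ?y ** ?Sz')
      = (dag ?Rz ** ?x ** ?cz) \<bullet> ((?cz ** dag G ** ?cz) \<bullet>
        (?cz ** ?y ** ?z' ** T)) \<bullet> (?cz ** ?y ** ?Sz')"
      by simp
    also have "(?cz ** dag G ** ?cz) \<bullet> (?cz ** ?y ** ?z' ** T)
      = (?cz ** ?z ** ?x ** T) \<bullet> (?cz ** dag G ** ?cz')"
      using slide[of "?cz ** dag G" T] by simp
    also have "(dag ?Rz ** ?x ** ?cz) \<bullet> ((?cz ** ?z ** ?x ** T) \<bullet>
        (?cz ** dag G ** ?cz')) \<bullet> (?cz ** ?y ** ?Sz')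
      = ((dag ?Rz ** ?x ** ?cz) \<bullet> (?cz ** ?z ** ?x ** T)) \<bullet>
        (?cz ** dag G ** ?cz') \<bullet> (?cz ** ?y ** ?Sz')"
      by simp
    also have "(dag ?Rz ** ?x ** ?cz) \<bullet> (?cz ** ?z ** ?x ** T)
      = (?x ** T) \<bullet> (dag ?Rz ** ?x ** ?cz')"
      using slide[of "dag ?Rz ** ?x" T] by simp
    also have "((?x ** T) \<bullet> (dag ?Rz ** ?x ** ?cz')) \<bullet>
        (?cz ** dag G ** ?cz') \<bullet> (?cz ** ?y ** ?Sz') = (?x ** T) \<bullet> Y"
      unfolding Y' by simp
    also have "\<dots> = ?M" using Y by simp
    finally show ?thesis .
  qed
  from arg_cong[OF this, of mor]
  have 1: "sharp x y z z (sandwich x y u \<gamma> (idm z)) = sandwich y x (transposed z z' u) (mor Y) (idm (cj z))"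
    by (simp only: sharp_def sandwich_def G_def U_def T_def arrow_mor arrow.sel Ra_simps)
  have "((dag ?Rz' ** ?x ** ?cz') \<bullet>
      (?cz' ** dag (((?y ** ?z') \<bullet> G) \<bullet> (U ** ?x)) ** ?cz')) \<bullet> (?cz' ** ?y ** ?Sz')
    = ((?x ** ?cz') \<bullet> Y) \<bullet> (T ** ?y)" (is "?L = ?M")
  proof -
    have "?L = (dag ?Rz' ** ?x ** ?cz') \<bullet> (?cz' ** ((dag U ** ?x) \<bullet> dag G) ** ?cz') \<bullet>
        (?cz' ** ?y ** ?Sz')"
      by simp
    also have "(?cz' ** ((dag U ** ?x) \<bullet> dag G) ** ?cz')
        = (?cz' ** dag U ** ?x ** ?cz') \<bullet> (?cz' ** dag G ** ?cz')"
      using interchange[of "dag G" "dag U ** ?x" "?cz'" "?cz'"] by (simp add: interchange)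
    also have "(dag ?Rz' ** ?x ** ?cz') \<bullet> ((?cz' ** dag U ** ?x ** ?cz') \<bullet>
        (?cz' ** dag G ** ?cz')) \<bullet> (?cz' ** ?y ** ?Sz')
      = ((dag ?Rz' ** ?x ** ?cz') \<bullet> (?cz' ** dag U ** ?x ** ?cz')) \<bullet>
        (?cz' ** dag G ** ?cz') \<bullet> (?cz' ** ?y ** ?Sz')"
      by simp
    also have "(dag ?Rz' ** ?x ** ?cz') \<bullet> (?cz' ** dag U ** ?x ** ?cz')
      = (dag ?Rz \<bullet> (T ** ?z)) ** ?x ** ?cz'"
      unfolding T(3) using interchange[of "?cz' ** dag U" "dag ?Rz'" "?x ** ?cz'" "?x ** ?cz'"]
      by simp
    also have "\<dots> = (dag ?Rz ** ?x ** ?cz') \<bullet> (T ** ?z ** ?x ** ?cz')"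
      using interchange[of "T ** ?z" "dag ?Rz" "?x ** ?cz'" "?x ** ?cz'"]
      by simp
    also have "((dag ?Rz ** ?x ** ?cz') \<bullet> (T ** ?z ** ?x ** ?cz')) \<bullet>
        (?cz' ** dag G ** ?cz') \<bullet> (?cz' ** ?y ** ?Sz')
      = (dag ?Rz ** ?x ** ?cz') \<bullet> ((T ** ?z ** ?x ** ?cz') \<bullet>
        (?cz' ** dag G ** ?cz')) \<bullet> (?cz' ** ?y ** ?Sz')"
      by simp
    also have "(T ** ?z ** ?x ** ?cz') \<bullet> (?cz' ** dag G ** ?cz')
      = (?cz ** dag G ** ?cz') \<bullet> (T ** ?y ** ?z' ** ?cz')"
      using slide[of T "dag G ** ?cz'"] by simp
    also have "(dag ?Rz ** ?x ** ?cz') \<bullet> ((?cz ** dag G ** ?cz') \<bullet>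
        (T ** ?y ** ?z' ** ?cz')) \<bullet> (?cz' ** ?y ** ?Sz')
      = (dag ?Rz ** ?x ** ?cz') \<bullet> (?cz ** dag G ** ?cz') \<bullet>
        (T ** ?y ** ?z' ** ?cz') \<bullet> (?cz' ** ?y ** ?Sz')"
      by simp
    also have "(T ** ?y ** ?z' ** ?cz') \<bullet> (?cz' ** ?y ** ?Sz')
      = (?cz ** ?y ** ?Sz') \<bullet> (T ** ?y)"
      using slide[of T "?y ** ?Sz'"] by simp
    also have "(dag ?Rz ** ?x ** ?cz') \<bullet> (?cz ** dag G ** ?cz') \<bullet>
        (?cz ** ?y ** ?Sz') \<bullet> (T ** ?y) = Y \<bullet> (T ** ?y)"
      unfolding Y' by simp
    also have "\<dots> = ?M" using Y by simp
    finally show ?thesis .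
  qed
  from arg_cong[OF this, of mor]
  have 2: "sharp x y z' z' (sandwich x y (idm z') \<gamma> u) = sandwich y x (idm (cj z')) (mor Y) (transposed z z' u)"
    by (simp only: sharp_def sandwich_def G_def U_def T_def arrow_mor arrow.sel Ra_simps)
  have t: "transposed z z' u \<in> hom (cj z') (cj z)" "mor Y \<in> hom (cj z \<otimes> y) (x \<otimes> cj z')"
    using T(1) Y by (simp_all add: T_def arr_def)
  show ?thesis
    unfolding 1 2 using Psi_trace[OF y x _ _ t] by simp
qed

theorem tube_star_Psi:
  assumes z: "z \<in> Ob C" "\<gamma> \<in> hom (z \<otimes> x) (y \<otimes> z)"
  shows "tube_star x y (Psi x y z \<gamma>) = Psi y x (cj z) (sharp x y z z \<gamma>)"
proof -
  have wd: "Psi y x (cj z) (sharp x y z z \<gamma>) = Psi y x (cj z') (sharp x y z' z' \<gamma>')"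
    if o: "z \<in> Ob C" "\<gamma> \<in> hom (z \<otimes> x) (y \<otimes> z)" "z' \<in> Ob C" "\<gamma>' \<in> hom (z' \<otimes> x) (y \<otimes> z')"
      and eq: "Psi x y z \<gamma> = Psi x y z' \<gamma>'" for z \<gamma> z' \<gamma>'
  proof
    fix v
    define F where "F z \<gamma> = Psi y x (cj z) (sharp x y z z \<gamma>) v" for z \<gamma>
    have "F z \<gamma> = F z' \<gamma>'"
    proof (rule Psi_determines[OF x y _ _ o eq])
      fix z \<gamma> \<gamma>' assume a: "z \<in> Ob C" "\<gamma> \<in> hom (z \<otimes> x) (y \<otimes> z)" "\<gamma>' \<in> hom (z \<otimes> x) (y \<otimes> z)"
      show "F z (\<gamma> + \<gamma>') = F z \<gamma> + F z \<gamma>'"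
        unfolding F_def sharp_add[OF a(1,1,2,3)]
        using Psi_add[OF y x conjugate_arrows(1)[OF a(1)] sharp_factors(5)[OF a(1,1,2)] sharp_factors(5)[OF a(1,1,3)]] .
    next
      fix z z' u \<gamma> assume "z \<in> Ob C" "z' \<in> Ob C" "u \<in> hom z' z" "\<gamma> \<in> hom (z \<otimes> x) (y \<otimes> z')"
      then show "F z (sandwich x y u \<gamma> (idm z)) = F z' (sandwich x y (idm z') \<gamma> u)"
        unfolding F_def by (simp add: sharp_trace)
    qed
    then show "Psi y x (cj z) (sharp x y z z \<gamma>) v = Psi y x (cj z') (sharp x y z' z' \<gamma>') v"
      by (simp add: F_def)
  qed
  show ?thesis
    unfolding tube_star_def sharp_def[symmetric]
  proof (rule the_equality)
    show "\<exists>w\<in>Ob C. \<exists>\<delta>\<in>hom (w \<otimes> x) (y \<otimes> w). Psi x y z \<gamma> = Psi x y w \<delta> \<and>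
        Psi y x (cj z) (sharp x y z z \<gamma>) = Psi y x (cj w) (sharp x y w w \<delta>)"
      using z by blast
  next
    fix c
    assume "\<exists>w\<in>Ob C. \<exists>\<delta>\<in>hom (w \<otimes> x) (y \<otimes> w). Psi x y z \<gamma> = Psi x y w \<delta> \<and>
        c = Psi y x (cj w) (sharp x y w w \<delta>)"
    then obtain w \<delta> where w: "w \<in> Ob C" "\<delta> \<in> hom (w \<otimes> x) (y \<otimes> w)"
      "Psi x y z \<gamma> = Psi x y w \<delta>" "c = Psi y x (cj w) (sharp x y w w \<delta>)"
      by blast
    show "c = Psi y x (cj z) (sharp x y z z \<gamma>)"
      using wd[OF z w(1-3)] w(4) by simp
  qed
qed

end

end

section \<open>Sums of squares\<close>

context tube_category
begin

interpretation V: vector_space "scale C"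
  by (rule vector_space_scale)

lemma Psi_tube_space:
  assumes "x \<in> Ob C" "y \<in> Ob C" "z \<in> Ob C" "\<gamma> \<in> hom (z \<otimes> x) (y \<otimes> z)"
  shows "Psi x y z \<gamma> \<in> tube_space x y"
proof -
  have "{w. Psi x y z \<gamma> w \<noteq> 0} \<subseteq> constituents z"
  proof
    fix w assume w: "w \<in> {w. Psi x y z \<gamma> w \<noteq> 0}"
    then have "w \<in> Irr" by (auto simp: Psi_def split: if_splits)
    with w show "w \<in> constituents z"
      using basis_empty[OF \<open>w \<in> Irr\<close> assms(3)] by (cases "w \<in> constituents z") (auto simp: Psi_basis)
  qed
  then have "finite {w. Psi x y z \<gamma> w \<noteq> 0}"
    using finite_constituents[OF assms(3)] finite_subset by blast
  then show ?thesis
    using Psi_in[OF assms] by (auto simp: tube_space_def Psi_def)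
qed

text \<open>The element \<open>a a\<^sup>*\<close> for \<open>a = \<Psi>\<^sup>z(\<gamma>)\<close>, written on the representatives.\<close>

definition square :: "'o \<Rightarrow> 'o \<Rightarrow> 'm \<Rightarrow> 'o \<Rightarrow> 'm" where
  "square x z \<gamma> = Psi \<one> \<one> (z \<otimes> cj z) (tube_prod z \<gamma> (cj z) (sharp x \<one> z z \<gamma>))"

lemma square_in:
  assumes "x \<in> Ob C" "z \<in> Ob C" "\<gamma> \<in> hom (z \<otimes> x) (\<one> \<otimes> z)"
  shows "tube_prod z \<gamma> (cj z) (sharp x \<one> z z \<gamma>) \<in> hom ((z \<otimes> cj z) \<otimes> \<one>) (\<one> \<otimes> (z \<otimes> cj z))"
  using tube_prod_factors(3)[of \<one> x \<one> z z "cj z" "cj z", OF _ _ _ _ _ _ _ assms(3)]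
    sharp_factors(5)[of x \<one> z z \<gamma>] assms
  by simp

lemma square_eq:
  assumes "x \<in> Ob C" "z \<in> Ob C" "\<gamma> \<in> hom (z \<otimes> x) (\<one> \<otimes> z)"
  shows "tube_mult \<one> x \<one> (Psi x \<one> z \<gamma>) (tube_star x \<one> (Psi x \<one> z \<gamma>)) = square x z \<gamma>"
  unfolding square_def tube_star_Psi[OF assms(1) unit_in assms(2,3)]
  using tube_mult_Psi[OF unit_in assms(1) unit_in assms(2) _ assms(3), of "cj z" "sharp x \<one> z z \<gamma>"]
    sharp_factors(5)[OF assms(1) unit_in assms(2,2,3)] assms(2) by simp

lemma square_scale:
  assumes "x \<in> Ob C" "z \<in> Ob C" "\<gamma> \<in> hom (z \<otimes> x) (\<one> \<otimes> z)"
  shows "square x z (c \<odot> \<gamma>) v = (c * cnj c) \<odot> square x z \<gamma> v"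
proof -
  have s: "sharp x \<one> z z \<gamma> \<in> hom (cj z \<otimes> \<one>) (x \<otimes> cj z)"
    using sharp_factors(5)[OF assms(1) unit_in assms(2,2,3)] .
  have z: "cj z \<in> Ob C" "z \<otimes> cj z \<in> Ob C" using assms by simp_all
  have "tube_prod z (c \<odot> \<gamma>) (cj z) (sharp x \<one> z z (c \<odot> \<gamma>))
      = (c * cnj c) \<odot> tube_prod z \<gamma> (cj z) (sharp x \<one> z z \<gamma>)"
    unfolding sharp_scale[OF assms(1) unit_in assms(2,2,3)]
    using tube_prod_scale[OF unit_in assms(1) unit_in assms(2) z(1) _ s]
      hom_scale[OF _ _ assms(3), of c] assms by simp
  then show ?thesis
    unfolding square_def using Psi_scale[OF unit_in unit_in z(2) square_in[OF assms]] by simp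
qed

text \<open>Squares with a chosen representative \<open>(z, \<gamma>)\<close>: rescaling \<open>\<gamma>\<close> rescales the square, so that this set
  is visibly a convex cone.\<close>

inductive_set square_cone :: "('o \<Rightarrow> 'm) set" where
  zero: "(\<lambda>_. 0) \<in> square_cone"
| step: "\<lbrakk>f \<in> square_cone; x \<in> Irr; z \<in> Ob C; \<gamma> \<in> hom (z \<otimes> x) (\<one> \<otimes> z)\<rbrakk>
    \<Longrightarrow> (\<lambda>v. f v + square x z \<gamma> v) \<in> square_cone"

lemma square_in_cone:
  "x \<in> Irr \<Longrightarrow> z \<in> Ob C \<Longrightarrow> \<gamma> \<in> hom (z \<otimes> x) (\<one> \<otimes> z) \<Longrightarrow> square x z \<gamma> \<in> square_cone"
  using square_cone.step[OF square_cone.zero, of x z \<gamma>] by simp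

lemma square_cone_add:
  assumes "f \<in> square_cone" "g \<in> square_cone"
  shows "(\<lambda>v. f v + g v) \<in> square_cone"
  using assms(2)
proof induction
  case zero
  then show ?case using assms(1) by simp
next
  case (step g x z \<gamma>)
  then show ?case using square_cone.step[OF step.IH step.hyps(2-4)] by (simp add: add.assoc)
qed

lemma square_cone_scale:
  assumes "f \<in> square_cone" "r \<ge> 0"
  shows "(\<lambda>v. complex_of_real r \<odot> f v) \<in> square_cone"
  using assms(1)
proof induction
  case zero
  then show ?case using square_cone.zero by simp
next
  case (step f x z \<gamma>)
  have x: "x \<in> Ob C" using Irr_Ob step by blast
  define c where "c = complex_of_real (sqrt r)"
  have "c * cnj c = complex_of_real r"
    using assms(2) by (simp add: c_def flip: of_real_mult)
  moreover have "c \<odot> \<gamma> \<in> hom (z \<otimes> x) (\<one> \<otimes> z)"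
    using step x by (intro hom_scale) simp_all
  ultimately show ?case
    using square_cone.step[OF step.IH step.hyps(2,3), of "c \<odot> \<gamma>"] square_scale[OF x step.hyps(3,4), of c]
    by (simp add: V.scale_right_distrib)
qed

lemma square_cone_sum:
  assumes "\<And>i. i \<in> A \<Longrightarrow> f i \<in> square_cone"
  shows "(\<lambda>v. \<Sum>i\<in>A. f i v) \<in> square_cone"
  using assms
  by (induction A rule: infinite_finite_induct) (simp_all add: square_cone.zero square_cone_add)

lemma square_cone_sum_of_squares:
  assumes "f \<in> square_cone"
  shows "\<exists>(n::nat) x a. (\<forall>i<n. x i \<in> Irr \<and> a i \<in> tube_space (x i) \<one>) \<and>
    f = (\<lambda>v. \<Sum>i<n. tube_mult \<one> (x i) \<one> (a i) (tube_star (x i) \<one> (a i)) v)"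
  using assms
proof induction
  case zero
  show ?case by (rule exI[of _ 0]) simp
next
  case (step f x z \<gamma>)
  have xO: "x \<in> Ob C" using Irr_Ob step by blast
  obtain n :: nat and xs a where IH: "\<forall>i<n. xs i \<in> Irr \<and> a i \<in> tube_space (xs i) \<one>"
    "f = (\<lambda>v. \<Sum>i<n. tube_mult \<one> (xs i) \<one> (a i) (tube_star (xs i) \<one> (a i)) v)"
    using step.IH by blast
  define xs' where "xs' = xs(n := x)"
  define a' where "a' = a(n := Psi x \<one> z \<gamma>)"
  have "\<forall>i<Suc n. xs' i \<in> Irr \<and> a' i \<in> tube_space (xs' i) \<one>"
    using IH(1) step.hyps Psi_tube_space[OF xO unit_in step.hyps(3,4)]
    by (auto simp: xs'_def a'_def less_Suc_eq)
  moreover have "(\<lambda>v. f v + square x z \<gamma> v)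
      = (\<lambda>v. \<Sum>i<Suc n. tube_mult \<one> (xs' i) \<one> (a' i) (tube_star (xs' i) \<one> (a' i)) v)"
    unfolding IH(2) square_eq[OF xO step.hyps(3,4), symmetric]
    by (simp add: xs'_def a'_def)
  ultimately show ?case by blast
qed


section \<open>Classes of objects\<close>

definition obj_class :: "'o \<Rightarrow> 'o \<Rightarrow> 'm" where
  "obj_class z = Psi \<one> \<one> z (idm z)"

lemma sandwich_unit:
  assumes "z \<in> Ob C" "z' \<in> Ob C" "w \<in> Ob C" "w' \<in> Ob C"
    "\<gamma> \<in> hom z z'" "\<tau> \<in> hom z' w'" "\<sigma> \<in> hom w z"
  shows "sandwich \<one> \<one> \<tau> \<gamma> \<sigma> = \<tau> \<cdot> \<gamma> \<cdot> \<sigma>"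
  unfolding sandwich_def
  using mtens_unit_left[OF assms(2,4,6)] mtens_unit_right[OF assms(3,1,7)] by simp

text \<open>For trivial \<open>x\<close> and \<open>y\<close> the trace property is cyclicity under composition.\<close>

lemma Psi_unit_trace:
  assumes "z \<in> Ob C" "z' \<in> Ob C" "u \<in> hom z' z" "\<gamma> \<in> hom z z'"
  shows "Psi \<one> \<one> z (u \<cdot> \<gamma>) = Psi \<one> \<one> z' (\<gamma> \<cdot> u)"
  using Psi_trace[OF unit_in unit_in assms(1-3), of \<gamma>] assms
    sandwich_unit[OF assms(1,2,1,1,4,3) ident_in[OF assms(1)]]
    sandwich_unit[OF assms(1,2,2,2,4) ident_in[OF assms(2)] assms(3)]
    comp_ident_left[OF assms(1,2,4)] comp_ident_right[OF assms(1,1) comp_in[OF assms(1,2,1,4,3)]]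
  by simp

lemma obj_class_iso:
  assumes "z \<in> Ob C" "z' \<in> Ob C" "iso z z'"
  shows "obj_class z = obj_class z'"
proof -
  obtain f g where "f \<in> hom z z'" "g \<in> hom z' z" "g \<cdot> f = idm z" "f \<cdot> g = idm z'"
    using assms(3) unfolding iso_def by blast
  then show ?thesis
    using Psi_unit_trace[OF assms(1,2), of g f] by (simp add: obj_class_def)
qed

lemma tube_prod_ident:
  assumes "z \<in> Ob C" "z' \<in> Ob C"
  shows "tube_prod z (idm z) z' (idm z') = idm (z \<otimes> z')"
  unfolding tube_prod_def using assms mtens_ident[OF assms] comp_ident_left[OF _ _ ident_in, of "z \<otimes> z'"]
  by simp

lemma sharp_ident:
  assumes z: "z \<in> Ob C"
  shows "sharp \<one> \<one> z z (idm z) = idm (cj z)"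
proof -
  note [simp] = z
  have "((dag (Ra z) ** idt \<one> ** idt (cj z)) \<bullet> (idt (cj z) ** dag (idt z) ** idt (cj z))) \<bullet>
      (idt (cj z) ** idt \<one> ** Rba z) = idt (cj z)"
    using cmp_idt(1)[of "dag (Ra z) ** idt (cj z)" "cj z \<otimes> z \<otimes> cj z"] by simp
  from arg_cong[OF this, of mor] show ?thesis
    by (simp only: sharp_def arrow_mor Ra_simps)
qed

lemma obj_class_conj_unit: "obj_class (cj \<one>) = obj_class \<one>"
proof -
  have r: "R \<one> \<in> hom \<one> (cj \<one>)" "Rb \<one> \<in> hom \<one> (cj \<one>)"
    using R_in[of \<one>] by simp_all
  then have s: "star (R \<one>) \<in> hom (cj \<one>) \<one>" "star (Rb \<one>) \<in> hom (cj \<one>) \<one>"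
    by (simp_all add: star_in)
  have "R \<one> \<cdot> star (Rb \<one>) = idm (cj \<one>)"
  proof -
    have "(idt (cj \<one>) ** dag (Rba \<one>)) \<bullet> (Ra \<one> ** idt (cj \<one>)) = Ra \<one> \<bullet> dag (Rba \<one>)"
      using slide[of "Ra \<one>" "dag (Rba \<one>)"] slide[of "Ra \<one> " "dag (Rba \<one>)"] by simp
    then have "Ra \<one> \<bullet> dag (Rba \<one>) = idt (cj \<one>)" by simp
    from arg_cong[OF this, of mor] show ?thesis by (simp add: arrow_mor)
  qed
  moreover have "star (R \<one>) \<cdot> Rb \<one> = idm \<one>"
  proof -
    have "(idt \<one> ** dag (Ra \<one>)) \<bullet> (Rba \<one> ** idt \<one>) = dag (Ra \<one>) \<bullet> Rba \<one>"
      by simp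
    then have "dag (Ra \<one>) \<bullet> Rba \<one> = idt \<one>" using conjugate_arrows(5)[of \<one>] by simp
    from arg_cong[OF this, of mor] show ?thesis by (simp add: arrow_mor)
  qed
  then have "star (Rb \<one>) \<cdot> R \<one> = idm \<one>"
    using star_comp[of \<one> "cj \<one>" \<one> "Rb \<one>" "star (R \<one>)"] star_star[of \<one> "cj \<one>" "R \<one>"] r s
    by (simp add: star_ident)
  ultimately have "iso (cj \<one>) \<one>"
    unfolding iso_def using r s by blast
  then show ?thesis by (intro obj_class_iso) simp_all
qed

text \<open>The product \<open>[z] [z']\<^sup>*\<close> can be computed on any representatives of the two classes. It is
  applied to representatives that live on a common object \<open>s\<close>.\<close>

lemma mult_star_classes:
  assumes s: "s \<in> Ob C" and z: "z \<in> Ob C" "z' \<in> Ob C" and X: "X \<in> hom s s" "X' \<in> hom s s"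
    and eq: "Psi \<one> \<one> s X = obj_class z" "Psi \<one> \<one> s X' = obj_class z'"
  shows "Psi \<one> \<one> (s \<otimes> cj s) (tube_prod s X (cj s) (sharp \<one> \<one> s s X')) = obj_class (z \<otimes> cj z')"
proof -
  have h: "X \<in> hom (s \<otimes> \<one>) (\<one> \<otimes> s)" "X' \<in> hom (s \<otimes> \<one>) (\<one> \<otimes> s)"
    "idm z \<in> hom (z \<otimes> \<one>) (\<one> \<otimes> z)" "idm z' \<in> hom (z' \<otimes> \<one>) (\<one> \<otimes> z')"
    "idm (cj z') \<in> hom (cj z' \<otimes> \<one>) (\<one> \<otimes> cj z')"
    using X s z by (simp_all add: ident_in)
  have c: "cj s \<in> Ob C" "cj z' \<in> Ob C" using s z by simp_all
  have "Psi \<one> \<one> (s \<otimes> cj s) (tube_prod s X (cj s) (sharp \<one> \<one> s s X'))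
      = tube_mult \<one> \<one> \<one> (Psi \<one> \<one> s X) (tube_star \<one> \<one> (Psi \<one> \<one> s X'))"
    unfolding tube_star_Psi[OF unit_in unit_in s h(2)]
    using tube_mult_Psi[OF unit_in unit_in unit_in s c(1) h(1) sharp_factors(5)[OF unit_in unit_in s s h(2)]]
    by simp
  also have "\<dots> = obj_class (z \<otimes> cj z')"
    unfolding eq unfolding obj_class_def tube_star_Psi[OF unit_in unit_in z(2) h(4)] sharp_ident[OF z(2)]
      tube_mult_Psi[OF unit_in unit_in unit_in z(1) c(2) h(3,5)] tube_prod_ident[OF z(1) c(2)] ..
  finally show ?thesis .
qed

lemma obj_class_tensor_conj_unit:
  assumes "w \<in> Ob C"
  shows "obj_class (w \<otimes> cj \<one>) = obj_class w"
proof -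
  have h: "idm w \<in> hom (w \<otimes> \<one>) (\<one> \<otimes> w)" "idm (cj \<one>) \<in> hom (cj \<one> \<otimes> \<one>) (\<one> \<otimes> cj \<one>)"
    "idm \<one> \<in> hom (\<one> \<otimes> \<one>) (\<one> \<otimes> \<one>)"
    using assms by (simp_all add: ident_in)
  have c: "cj \<one> \<in> Ob C" by simp
  have "obj_class (w \<otimes> cj \<one>) = tube_mult \<one> \<one> \<one> (obj_class w) (obj_class (cj \<one>))"
    unfolding obj_class_def tube_mult_Psi[OF unit_in unit_in unit_in assms c h(1,2)] tube_prod_ident[OF assms c] ..
  also have "\<dots> = obj_class (w \<otimes> \<one>)"
    unfolding obj_class_conj_unit
    unfolding obj_class_def tube_mult_Psi[OF unit_in unit_in unit_in assms unit_in h(1,3)] tube_prod_ident[OF assms unit_in] ..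
  finally show ?thesis using assms by simp
qed

text \<open>This is \<open>(1 + c [w]) (1 + c [w])\<^sup>*\<close>. Its factor \<open>1 + c [w]\<close> is represented on the direct sum \<open>s\<close>
  of \<open>\<one>\<close> and \<open>w\<close> by \<open>P + c \<odot> Q\<close>, where \<open>P\<close> and \<open>Q\<close> are the projections onto the summands.\<close>

lemma square_unit_plus_class:
  assumes w: "w \<in> Ob C"
  shows "(\<lambda>v. obj_class \<one> v + c \<odot> obj_class w v + cnj c \<odot> obj_class (cj w) v
    + (c * cnj c) \<odot> obj_class (w \<otimes> cj w) v) \<in> square_cone"
proof -
  obtain s u v where s: "s \<in> Ob C" and u: "u \<in> hom \<one> s" "star u \<cdot> u = idm \<one>"
    and v: "v \<in> hom w s" "star v \<cdot> v = idm w"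
    using direct_sums[OF unit_in w] by blast
  define P where "P = u \<cdot> star u"
  define Q where "Q = v \<cdot> star v"
  have su: "star u \<in> hom s \<one>" "star v \<in> hom s w"
    using star_in[OF unit_in s u(1)] star_in[OF w s v(1)] by auto
  have PQ: "P \<in> hom s s" "Q \<in> hom s s"
    unfolding P_def Q_def using comp_in[OF s unit_in s su(1) u(1)] comp_in[OF s w s su(2) v(1)] by auto
  have cP: "Psi \<one> \<one> s P = obj_class \<one>"
    unfolding P_def using Psi_unit_trace[OF s unit_in u(1) su(1)] u(2) by (simp add: obj_class_def)
  have cQ: "Psi \<one> \<one> s Q = obj_class w"
    unfolding Q_def using Psi_unit_trace[OF s w v(1) su(2)] v(2) by (simp add: obj_class_def)
  define S where "S X Y = tube_prod s X (cj s) (sharp \<one> \<one> s s Y)" for X Y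
  have o: "\<one> \<in> Ob C" "s \<in> Ob C" "cj s \<in> Ob C" "s \<otimes> cj s \<in> Ob C" using s by simp_all
  have h: "X \<in> hom (s \<otimes> \<one>) (\<one> \<otimes> s)" if "X \<in> hom s s" for X using that s by simp
  note sh = sharp_factors(5)[OF o(1,1,2,2) h]
  have Sin: "S X Y \<in> hom ((s \<otimes> cj s) \<otimes> \<one>) (\<one> \<otimes> (s \<otimes> cj s))" if "X \<in> hom s s" "Y \<in> hom s s" for X Y
    unfolding S_def using tube_prod_factors(3)[OF o(1,1,1,2,2,3,3) h[OF that(1)] sh[OF that(2)]] s by simp
  have cQ_in: "c \<odot> Q \<in> hom s s" using hom_scale[OF s s PQ(2)] .
  have PcQ: "P + c \<odot> Q \<in> hom s s" using hom_add[OF s s PQ(1) cQ_in] .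
  have S1: "S (P + c \<odot> Q) Y = S P Y + c \<odot> S Q Y" if "Y \<in> hom s s" for Y
    unfolding S_def
    using tube_prod_add(1)[OF o(1,1,1,2,3) h[OF PQ(1)] sh[OF that] h[OF cQ_in]]
      tube_prod_scale(1)[OF o(1,1,1,2,3) h[OF PQ(2)] sh[OF that]] by simp
  have S2: "S X (P + c \<odot> Q) = S X P + cnj c \<odot> S X Q" if "X \<in> hom s s" for X
  proof -
    have "cnj c \<odot> sharp \<one> \<one> s s Q \<in> hom (cj s \<otimes> \<one>) (\<one> \<otimes> cj s)"
      using sh[OF PQ(2)] o by (intro hom_scale) simp_all
    then show ?thesis
      unfolding S_def sharp_add[OF o(1,1,2,2) h[OF PQ(1)] h[OF cQ_in]] sharp_scale[OF o(1,1,2,2) h[OF PQ(2)]]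
      using tube_prod_add(2)[OF o(1,1,1,2,3) h[OF that] sh[OF PQ(1)]]
        tube_prod_scale(2)[OF o(1,1,1,2,3) h[OF that] sh[OF PQ(2)]] by simp
  qed
  note Sin' = Sin[OF PQ(1,1)] Sin[OF PQ(1,2)] Sin[OF PQ(2,1)] Sin[OF PQ(2,2)]
  have oo: "(s \<otimes> cj s) \<otimes> \<one> \<in> Ob C" "\<one> \<otimes> (s \<otimes> cj s) \<in> Ob C" using o by simp_all
  have expand: "S (P + c \<odot> Q) (P + c \<odot> Q) = (S P P + cnj c \<odot> S P Q) + c \<odot> (S Q P + cnj c \<odot> S Q Q)"
    using S1[OF PcQ] S2[OF PQ(1)] S2[OF PQ(2)] by simp
  note sc = hom_scale[OF oo] and ad = hom_add[OF oo] and Pa = Psi_add[OF o(1,1,4)] and Ps = Psi_scale[OF o(1,1,4)]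
  have "square \<one> s (P + c \<odot> Q) t
      = obj_class \<one> t + c \<odot> obj_class w t + cnj c \<odot> obj_class (cj w) t
        + (c * cnj c) \<odot> obj_class (w \<otimes> cj w) t" for t
  proof -
    have "square \<one> s (P + c \<odot> Q) t = Psi \<one> \<one> (s \<otimes> cj s) (S (P + c \<odot> Q) (P + c \<odot> Q)) t"
      by (simp add: square_def S_def)
    also have "\<dots> = (Psi \<one> \<one> (s \<otimes> cj s) (S P P) t + cnj c \<odot> Psi \<one> \<one> (s \<otimes> cj s) (S P Q) t)
        + c \<odot> (Psi \<one> \<one> (s \<otimes> cj s) (S Q P) t + cnj c \<odot> Psi \<one> \<one> (s \<otimes> cj s) (S Q Q) t)"
      unfolding expand
      using Pa[OF ad[OF Sin'(1) sc[OF Sin'(2)]] sc[OF ad[OF Sin'(3) sc[OF Sin'(4)]]]]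
        Pa[OF Sin'(1) sc[OF Sin'(2)]] Ps[OF ad[OF Sin'(3) sc[OF Sin'(4)]]]
        Pa[OF Sin'(3) sc[OF Sin'(4)]] Ps[OF Sin'(2)] Ps[OF Sin'(4)] by simp
    also have "\<dots> = (obj_class (\<one> \<otimes> cj \<one>) t + cnj c \<odot> obj_class (\<one> \<otimes> cj w) t)
        + c \<odot> (obj_class (w \<otimes> cj \<one>) t + cnj c \<odot> obj_class (w \<otimes> cj w) t)"
      unfolding S_def mult_star_classes[OF s unit_in unit_in PQ(1,1) cP cP]
        mult_star_classes[OF s unit_in w PQ(1,2) cP cQ] mult_star_classes[OF s w unit_in PQ(2,1) cQ cP]
        mult_star_classes[OF s w w PQ(2,2) cQ cQ] ..
    finally show ?thesis
      using w by (simp add: obj_class_tensor_conj_unit obj_class_conj_unit V.scale_right_distrib algebra_simps)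
  qed
  then show ?thesis
    using square_in_cone[OF unit_Irr s h[OF PcQ]] by (metis (no_types, lifting) ext)
qed


section \<open>Rotation of endomorphisms and Frobenius reciprocity\<close>

text \<open>The image of \<open>\<xi> : x \<rightarrow> cj w \<otimes> w\<close> under Frobenius reciprocity, a morphism \<open>w \<otimes> x \<rightarrow> w\<close>.\<close>

definition frobenius_mate :: "'o \<Rightarrow> 'm \<Rightarrow> 'm" where
  "frobenius_mate w \<xi> = (star (Rb w) \<boxtimes> idm w) \<cdot> (idm w \<boxtimes> \<xi>)"

text \<open>A one-click rotation: the strand \<open>cj w\<close> at the top of \<open>T\<close> is bent down on the left, and the
  strand \<open>w\<close> at its bottom is bent up on the right. It exchanges \<open>1\<close> and \<open>R R\<^sup>*\<close> up to the passage from \<open>cj w \<otimes> w\<close>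
  to \<open>w \<otimes> cj w\<close>, but it does not preserve composition.\<close>

definition bend :: "'o \<Rightarrow> 'm \<Rightarrow> 'm" where
  "bend w T = (star (Rb w) \<boxtimes> idm w \<boxtimes> idm (cj w)) \<cdot> (idm w \<boxtimes> T \<boxtimes> idm (cj w)) \<cdot>
     (idm w \<boxtimes> idm (cj w) \<boxtimes> Rb w)"

context
  fixes w
  assumes w: "w \<in> Ob C"
begin

lemma bend_factors:
  assumes "T \<in> hom (cj w \<otimes> w) (cj w \<otimes> w)"
  shows "idm w \<boxtimes> idm (cj w) \<boxtimes> Rb w \<in> hom (w \<otimes> cj w) (w \<otimes> cj w \<otimes> w \<otimes> cj w)"
    and "idm w \<boxtimes> T \<boxtimes> idm (cj w) \<in> hom (w \<otimes> cj w \<otimes> w \<otimes> cj w) (w \<otimes> cj w \<otimes> w \<otimes> cj w)"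
    and "star (Rb w) \<boxtimes> idm w \<boxtimes> idm (cj w) \<in> hom (w \<otimes> cj w \<otimes> w \<otimes> cj w) (w \<otimes> cj w)"
    and "(star (Rb w) \<boxtimes> idm w \<boxtimes> idm (cj w)) \<cdot> (idm w \<boxtimes> T \<boxtimes> idm (cj w)) \<in> hom (w \<otimes> cj w \<otimes> w \<otimes> cj w) (w \<otimes> cj w)"
    and "bend w T \<in> hom (w \<otimes> cj w) (w \<otimes> cj w)"
proof -
  let ?cw = "idt (cj w)" and ?w = "idt w" and ?Sw = "Rba w"
  note [simp] = w
  define A where "A = Arrow (cj w \<otimes> w) (cj w \<otimes> w) T"
  have [simp]: "arr A" "src A = cj w \<otimes> w" "tgt A = cj w \<otimes> w" "mor A = T"
    using assms by (simp_all add: A_def arr_Arrow)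
  have 1: "arr (?w ** ?cw ** ?Sw)" "arr (?w ** A ** ?cw)"
    "arr (dag ?Sw ** ?w ** ?cw)"
    "arr ((dag ?Sw ** ?w ** ?cw) \<bullet> (?w ** A ** ?cw))"
    "arr (((dag ?Sw ** ?w ** ?cw) \<bullet> (?w ** A ** ?cw)) \<bullet> (?w ** ?cw ** ?Sw))"
    by simp_all
  from 1[unfolded arr_def arrow_mor] show
    "idm w \<boxtimes> idm (cj w) \<boxtimes> Rb w \<in> hom (w \<otimes> cj w) (w \<otimes> cj w \<otimes> w \<otimes> cj w)"
    "idm w \<boxtimes> T \<boxtimes> idm (cj w) \<in> hom (w \<otimes> cj w \<otimes> w \<otimes> cj w) (w \<otimes> cj w \<otimes> w \<otimes> cj w)"
    "star (Rb w) \<boxtimes> idm w \<boxtimes> idm (cj w) \<in> hom (w \<otimes> cj w \<otimes> w \<otimes> cj w) (w \<otimes> cj w)"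
    "(star (Rb w) \<boxtimes> idm w \<boxtimes> idm (cj w)) \<cdot> (idm w \<boxtimes> T \<boxtimes> idm (cj w)) \<in> hom (w \<otimes> cj w \<otimes> w \<otimes> cj w) (w \<otimes> cj w)"
    "bend w T \<in> hom (w \<otimes> cj w) (w \<otimes> cj w)"
    by (simp_all add: bend_def)
qed

lemma bend_add:
  assumes T: "T \<in> hom (cj w \<otimes> w) (cj w \<otimes> w)" "T' \<in> hom (cj w \<otimes> w) (cj w \<otimes> w)"
  shows "bend w (T + T') = bend w T + bend w T'"
proof -
  have o: "w \<otimes> cj w \<in> Ob C" "w \<otimes> cj w \<otimes> w \<otimes> cj w \<in> Ob C" "cj w \<in> Ob C" "cj w \<otimes> w \<in> Ob C"
    "(cj w \<otimes> w) \<otimes> cj w \<in> Ob C"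
    using w by simp_all
  note i = ident_in[OF o(3)]
  note f = bend_factors[OF T(1)] and f' = bend_factors[OF T(2)]
  have "idm w \<boxtimes> (T + T') \<boxtimes> idm (cj w) = idm w \<boxtimes> T \<boxtimes> idm (cj w) + idm w \<boxtimes> T' \<boxtimes> idm (cj w)"
    unfolding mtens_add_left[OF o(4,4,3,3) T i]
    by (rule mtens_add_right[OF w w o(5,5) ident_in[OF w] mtens_in[OF o(4,4,3,3) T(1) i]
          mtens_in[OF o(4,4,3,3) T(2) i]])
  then show ?thesis
    unfolding bend_def
    using comp_add_right[OF o(2,2,1) f(2) f'(2) f(3)] comp_add_left[OF o(1,2,1) f(1,4) f'(4)] by simp
qed

lemma bend_scale:
  assumes T: "T \<in> hom (cj w \<otimes> w) (cj w \<otimes> w)"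
  shows "bend w (c \<odot> T) = c \<odot> bend w T"
proof -
  have o: "w \<otimes> cj w \<in> Ob C" "w \<otimes> cj w \<otimes> w \<otimes> cj w \<in> Ob C" "cj w \<in> Ob C" "cj w \<otimes> w \<in> Ob C"
    "(cj w \<otimes> w) \<otimes> cj w \<in> Ob C"
    using w by simp_all
  note i = ident_in[OF o(3)]
  note f = bend_factors[OF T(1)]
  have "idm w \<boxtimes> (c \<odot> T) \<boxtimes> idm (cj w) = c \<odot> (idm w \<boxtimes> T \<boxtimes> idm (cj w))"
    unfolding mtens_scale_left[OF o(4,4,3,3) T i]
    by (rule mtens_scale_right[OF w w o(5,5) ident_in[OF w] mtens_in[OF o(4,4,3,3) T i]])
  then show ?thesis
    unfolding bend_def
    using comp_scale_right[OF o(2,2,1) f(2,3)] comp_scale_left[OF o(1,2,1) f(1,4)] by simp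
qed

text \<open>After straightening one zigzag, \<open>sharp\<close> of the mate of \<open>\<xi>\<close> is \<open>star \<xi>\<close> with its strand \<open>w\<close> bent around, so
  in the product \<open>\<xi>\<close> and \<open>star \<xi>\<close> stand on top of each other.\<close>

lemma bend_frobenius_mate:
  assumes x: "x \<in> Ob C" and xi: "\<xi> \<in> hom x (cj w \<otimes> w)"
  shows "frobenius_mate w \<xi> \<in> hom (w \<otimes> x) (\<one> \<otimes> w)"
    and "tube_prod w (frobenius_mate w \<xi>) (cj w) (sharp x \<one> w w (frobenius_mate w \<xi>)) = bend w (\<xi> \<cdot> star \<xi>)"
proof -
  let ?cw = "idt (cj w)" and ?w = "idt w" and ?Sw = "Rba w" and ?Rw = "Ra w" and ?x = "idt x"
  note [simp] = w x
  define X where "X = Arrow x (cj w \<otimes> w) \<xi>"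
  have [simp]: "arr X" "src X = x" "tgt X = cj w \<otimes> w" using xi by (simp_all add: X_def arr_Arrow)
  define F where "F = (dag ?Sw ** ?w) \<bullet> (?w ** X)"
  have [simp]: "arr F" "src F = w \<otimes> x" "tgt F = w" by (simp_all add: F_def)
  have F: "mor F = frobenius_mate w \<xi>" by (simp only: F_def frobenius_mate_def X_def arrow_mor arrow.sel Ra_simps)
  show "frobenius_mate w \<xi> \<in> hom (w \<otimes> x) (\<one> \<otimes> w)"
    using \<open>arr F\<close>[unfolded arr_def] F by simp
  have dF: "dag F = (?w ** dag X) \<bullet> (?Sw ** ?w)"
    by (simp add: F_def)
  define H where "H = ((dag ?Rw ** ?x ** ?cw) \<bullet> (?cw ** dag F ** ?cw)) \<bullet>
      (?cw ** idt \<one> ** ?Sw)"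
  have mH: "mor H = sharp x \<one> w w (frobenius_mate w \<xi>)"
    by (simp only: H_def sharp_def F arrow_mor Ra_simps)
  have H: "H = (dag X ** ?cw) \<bullet> (?cw ** ?Sw)"
  proof -
    have "H = (dag ?Rw ** ?x ** ?cw) \<bullet> (?cw ** dag F ** ?cw) \<bullet> (?cw ** ?Sw)"
      unfolding H_def by simp
    also have "?cw ** dag F ** ?cw
        = (?cw ** ?w ** dag X ** ?cw) \<bullet> (?cw ** ?Sw ** ?w ** ?cw)"
      unfolding dF using interchange[of "?Sw ** ?w" "?w ** dag X" "?cw" "?cw"]
      by (simp add: interchange)
    also have "(dag ?Rw ** ?x ** ?cw) \<bullet> ((?cw ** ?w ** dag X ** ?cw) \<bullet>
        (?cw ** ?Sw ** ?w ** ?cw)) \<bullet> (?cw ** ?Sw)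
      = ((dag ?Rw ** ?x ** ?cw) \<bullet> (?cw ** ?w ** dag X ** ?cw)) \<bullet>
        ((?cw ** ?Sw ** ?w ** ?cw) \<bullet> (?cw ** ?Sw))"
      by simp
    also have "(dag ?Rw ** ?x ** ?cw) \<bullet> (?cw ** ?w ** dag X ** ?cw)
      = (dag X ** ?cw) \<bullet> (dag ?Rw ** ?cw ** ?w ** ?cw)"
      using slide[of "dag ?Rw" "dag X ** ?cw"] by simp
    also have "(?cw ** ?Sw ** ?w ** ?cw) \<bullet> (?cw ** ?Sw)
      = (?cw ** ?w ** ?cw ** ?Sw) \<bullet> (?cw ** ?Sw)"
      using slide[of "?Sw" "?Sw"] by (simp add: interchange)
    also have "((dag X ** ?cw) \<bullet> (dag ?Rw ** ?cw ** ?w ** ?cw)) \<bullet>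
        ((?cw ** ?w ** ?cw ** ?Sw) \<bullet> (?cw ** ?Sw))
      = (dag X ** ?cw) \<bullet> ((dag ?Rw ** ?cw ** ?w ** ?cw) \<bullet>
        (?cw ** ?w ** ?cw ** ?Sw)) \<bullet> (?cw ** ?Sw)"
      by simp
    also have "(dag ?Rw ** ?cw ** ?w ** ?cw) \<bullet> (?cw ** ?w ** ?cw ** ?Sw)
      = (?cw ** ?Sw) \<bullet> (dag ?Rw ** ?cw)"
      using slide[of "dag ?Rw ** ?cw" "?Sw"] by simp
    also have "(dag X ** ?cw) \<bullet> ((?cw ** ?Sw) \<bullet> (dag ?Rw ** ?cw)) \<bullet> (?cw ** ?Sw)
      = (dag X ** ?cw) \<bullet> (?cw ** ?Sw)"
      by simp
    finally show ?thesis .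
  qed
  have "(F ** ?cw) \<bullet> (?w ** H)
      = ((dag ?Sw ** ?w ** ?cw) \<bullet> (?w ** (X \<bullet> dag X) ** ?cw)) \<bullet> (?w ** ?cw ** ?Sw)"
  proof -
    have "F ** ?cw = (dag ?Sw ** ?w ** ?cw) \<bullet> (?w ** X ** ?cw)"
      unfolding F_def using interchange[of "?w ** X" "dag ?Sw ** ?w" "?cw" "?cw"] by simp
    moreover have "?w ** H = (?w ** dag X ** ?cw) \<bullet> (?w ** ?cw ** ?Sw)"
      unfolding H by (simp add: interchange)
    moreover have "?w ** (X \<bullet> dag X) ** ?cw = (?w ** X ** ?cw) \<bullet> (?w ** dag X ** ?cw)"
      by (simp add: interchange)
    ultimately show ?thesis by simp
  qed
  from arg_cong[OF this, of mor] mH F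
  show "tube_prod w (frobenius_mate w \<xi>) (cj w) (sharp x \<one> w w (frobenius_mate w \<xi>)) = bend w (\<xi> \<cdot> star \<xi>)"
    by (simp only: tube_prod_def bend_def X_def arrow_mor arrow.sel Ra_simps)
qed

lemma bend_ident: "bend w (idm (cj w \<otimes> w)) = Rb w \<cdot> star (Rb w)"
proof -
  note [simp] = w
  have "((dag (Rba w) ** idt w ** idt (cj w)) \<bullet> (idt w ** idt (cj w \<otimes> w) ** idt (cj w))) \<bullet>
      (idt w ** idt (cj w) ** Rba w) = Rba w \<bullet> dag (Rba w)"
    using slide[of "dag (Rba w)" "Rba w"]
      cmp_idt(1)[of "dag (Rba w) ** idt w ** idt (cj w)" "w \<otimes> cj w \<otimes> w \<otimes> cj w"] by simp
  from arg_cong[OF this, of mor] show ?thesis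
    by (simp only: bend_def arrow_mor Ra_simps)
qed

lemma bend_R: "bend w (R w \<cdot> star (R w)) = idm (w \<otimes> cj w)"
proof -
  let ?cw = "idt (cj w)" and ?w = "idt w" and ?Sw = "Rba w" and ?Rw = "Ra w"
  note [simp] = w
  have "((dag ?Sw ** ?w ** ?cw) \<bullet> (?w ** (?Rw \<bullet> dag ?Rw) ** ?cw)) \<bullet>
      (?w ** ?cw ** ?Sw) = idt (w \<otimes> cj w)"
  proof -
    have "?w ** (?Rw \<bullet> dag ?Rw) ** ?cw = (?w ** ?Rw ** ?cw) \<bullet> (?w ** dag ?Rw ** ?cw)"
      using interchange[of "dag ?Rw" "?Rw" "?cw" "?cw"]
        interchange[of "?w" "?w" "dag ?Rw ** ?cw" "?Rw ** ?cw"] by simp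
    moreover have "(dag ?Sw ** ?w ** ?cw) \<bullet> (?w ** ?Rw ** ?cw) = ?w ** ?cw"
      using interchange[of "?w ** ?Rw" "dag ?Sw ** ?w" "?cw" "?cw"] by simp
    moreover have "(?w ** dag ?Rw ** ?cw) \<bullet> (?w ** ?cw ** ?Sw) = ?w ** ?cw"
      using interchange[of "?w" "?w" "?cw ** ?Sw" "dag ?Rw ** ?cw"] by simp
    moreover have "((dag ?Sw ** ?w ** ?cw) \<bullet> ((?w ** ?Rw ** ?cw) \<bullet> (?w ** dag ?Rw ** ?cw))) \<bullet>
        (?w ** ?cw ** ?Sw) = ((dag ?Sw ** ?w ** ?cw) \<bullet> (?w ** ?Rw ** ?cw)) \<bullet>
        ((?w ** dag ?Rw ** ?cw) \<bullet> (?w ** ?cw ** ?Sw))"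
      by simp
    ultimately show ?thesis by simp
  qed
  from arg_cong[OF this, of mor] show ?thesis
    by (simp only: bend_def arrow_mor Ra_simps)
qed

end

end

context tube_category
begin

interpretation V: vector_space "scale C"
  by (rule vector_space_scale)

text \<open>An endomorphism \<open>f\<close> of \<open>cj w\<close> is transposed to an endomorphism \<open>G\<close> of \<open>w\<close>, which is a scalar, and
  transposing back recovers \<open>f\<close>.\<close>

lemma conj_simple:
  assumes "simple w"
  shows "simple (cj w)"
proof -
  let ?cw = "idt (cj w)" and ?w = "idt w" and ?Sw = "Rba w" and ?Rw = "Ra w"
  note w = simple_Ob[OF assms]
  note [simp] = w
  have c: "cj w \<in> Ob C" "cj w \<otimes> w \<in> Ob C" by simp_all
  have nz: "idm (cj w) \<noteq> 0"
  proof
    assume z: "idm (cj w) = 0"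
    have "idm (cj w \<otimes> w) = 0"
      using mtens_ident[OF c(1) w] mtens_zero_left[OF c(1,1) w w ident_in[OF w]] z by simp
    then show False
      using ident_zero_imp_hom_zero[OF unit_in c(2) R_in(1)[OF w]] R_nonzero[OF w simple_ident[OF assms]]
      by simp
  qed
  have "\<exists>k. f = k \<odot> idm (cj w)" if f: "f \<in> hom (cj w) (cj w)" for f
  proof -
    define F where "F = Arrow (cj w) (cj w) f"
    have [simp]: "arr F" "src F = cj w" "tgt F = cj w" "mor F = f" using f by (simp_all add: F_def arr_Arrow)
    define G where "G = (dag ?Sw ** ?w) \<bullet> (?w ** F ** ?w) \<bullet> (?w ** ?Rw)"
    have [simp]: "arr G" "src G = w" "tgt G = w" by (simp_all add: G_def)
    have "(?cw ** dag ?Sw) \<bullet> (((?cw ** G) \<bullet> ?Rw) ** ?cw) = F"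
    proof -
      have "(?cw ** G) \<bullet> ?Rw = (F ** ?w) \<bullet> ?Rw"
      proof -
        have "?cw ** G = (?cw ** dag ?Sw ** ?w) \<bullet> (?cw ** ?w ** F ** ?w) \<bullet>
            (?cw ** ?w ** ?Rw)"
          unfolding G_def by (simp add: interchange)
        then have "(?cw ** G) \<bullet> ?Rw = (?cw ** dag ?Sw ** ?w) \<bullet>
            (?cw ** ?w ** F ** ?w) \<bullet> (?cw ** ?w ** ?Rw) \<bullet> ?Rw"
          by simp
        also have "(?cw ** ?w ** ?Rw) \<bullet> ?Rw = (?Rw ** ?cw ** ?w) \<bullet> ?Rw"
          using slide[of "?Rw" "?Rw"] by simp
        also have "(?cw ** ?w ** F ** ?w) \<bullet> (?Rw ** ?cw ** ?w) \<bullet> ?Rw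
          = ((?cw ** ?w ** F ** ?w) \<bullet> (?Rw ** ?cw ** ?w)) \<bullet> ?Rw"
          by simp
        also have "(?cw ** ?w ** F ** ?w) \<bullet> (?Rw ** ?cw ** ?w)
          = (?Rw ** ?cw ** ?w) \<bullet> (F ** ?w)"
          using slide[of "?Rw" "F ** ?w"] by simp
        also have "(?cw ** dag ?Sw ** ?w) \<bullet> ((?Rw ** ?cw ** ?w) \<bullet> (F ** ?w)) \<bullet> ?Rw
          = ((?cw ** dag ?Sw ** ?w) \<bullet> (?Rw ** ?cw ** ?w)) \<bullet> (F ** ?w) \<bullet> ?Rw"
          by simp
        also have "(?cw ** dag ?Sw ** ?w) \<bullet> (?Rw ** ?cw ** ?w) = ?cw ** ?w"
          using interchange[of "?Rw ** ?cw" "?cw ** dag ?Sw" "?w" "?w"] by simp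
        finally show ?thesis by simp
      qed
      then have "((?cw ** G) \<bullet> ?Rw) ** ?cw = (F ** ?w ** ?cw) \<bullet> (?Rw ** ?cw)"
        using interchange[of "?Rw" "F ** ?w" "?cw" "?cw"] by simp
      then have "(?cw ** dag ?Sw) \<bullet> (((?cw ** G) \<bullet> ?Rw) ** ?cw)
        = ((?cw ** dag ?Sw) \<bullet> (F ** ?w ** ?cw)) \<bullet> (?Rw ** ?cw)"
        by simp
      also have "(?cw ** dag ?Sw) \<bullet> (F ** ?w ** ?cw) = F \<bullet> (?cw ** dag ?Sw)"
        using slide[of F "dag ?Sw"] by simp
      finally show ?thesis by simp
    qed
    from arg_cong[OF this, of mor]
    have rec: "f = (idm (cj w) \<boxtimes> star (Rb w)) \<cdot> (((idm (cj w) \<boxtimes> mor G) \<cdot> R w) \<boxtimes> idm (cj w))"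
      by (simp only: arrow_mor Ra_simps \<open>mor F = f\<close>)
    have "mor G \<in> hom w w" using \<open>arr G\<close> by (simp add: arr_def)
    then obtain k where k: "mor G = k \<odot> idm w"
      using assms by (auto simp: simple_def)
    note i = ident_in[OF c(1)] ident_in[OF w]
    have id2: "idm (cj w) \<boxtimes> idm w \<in> hom (cj w \<otimes> w) (cj w \<otimes> w)"
      using mtens_in[OF c(1,1) w w i] .
    have "(idm (cj w) \<boxtimes> mor G) \<cdot> R w = k \<odot> R w"
      unfolding k mtens_scale_right[OF c(1,1) w w i] comp_scale_left[OF unit_in c(2,2) R_in(1)[OF w] id2]
      by (simp only: mtens_ident[OF c(1) w] comp_ident_left[OF unit_in c(2) R_in(1)[OF w]])
    then have "f = (idm (cj w) \<boxtimes> star (Rb w)) \<cdot> (k \<odot> (R w \<boxtimes> idm (cj w)))"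
      using rec mtens_scale_left[OF unit_in c(2,1,1) R_in(1)[OF w] i(1)] by simp
    also have "\<dots> = k \<odot> ((idm (cj w) \<boxtimes> star (Rb w)) \<cdot> (R w \<boxtimes> idm (cj w)))"
      using mtens_in[OF unit_in c(2,1,1) R_in(1)[OF w] i(1)]
        mtens_in[OF c(1,1) _ unit_in i(1) star_in[OF unit_in _ R_in(2)[OF w]]]
      by (intro comp_scale_right[of "cj w" "cj w \<otimes> w \<otimes> cj w" "cj w"]) simp_all
    also have "\<dots> = k \<odot> idm (cj w)"
      using solution[OF w] by (simp add: conjugate_solution_def)
    finally show ?thesis by blast
  qed
  then have "hom (cj w) (cj w) = range (\<lambda>k. k \<odot> idm (cj w))"
    using hom_scale[OF c(1,1) ident_in[OF c(1)]] by auto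
  then show ?thesis using nz by (simp add: simple_def)
qed

lemma Psi_sum:
  assumes "x \<in> Ob C" "y \<in> Ob C" "z \<in> Ob C" "\<And>i. i \<in> A \<Longrightarrow> \<gamma> i \<in> hom (z \<otimes> x) (y \<otimes> z)"
  shows "Psi x y z (sum \<gamma> A) v = (\<Sum>i\<in>A. Psi x y z (\<gamma> i) v)"
proof -
  have z0: "Psi x y z 0 v = 0"
    using Psi_add[OF assms(1-3), of 0 0 v] hom_zero[of "z \<otimes> x" "y \<otimes> z"] assms(1-3) by simp
  show ?thesis
    using assms(4)
  proof (induction A rule: infinite_finite_induct)
    case (insert i A)
    have "sum \<gamma> A \<in> hom (z \<otimes> x) (y \<otimes> z)"
      using insert.prems assms by (intro hom_sum) auto
    then show ?case
      using insert Psi_add[OF assms(1-3), of "\<gamma> i" "sum \<gamma> A" v] by simp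
  qed (simp_all add: z0)
qed

lemma bend_sum:
  assumes w: "w \<in> Ob C" and T: "\<And>i. i \<in> A \<Longrightarrow> T i \<in> hom (cj w \<otimes> w) (cj w \<otimes> w)"
  shows "bend w (sum T A) = (\<Sum>i\<in>A. bend w (T i))"
proof -
  have o: "cj w \<otimes> w \<in> Ob C" using w by simp
  have z0: "bend w 0 = 0"
    using bend_add[OF w hom_zero[OF o o] hom_zero[OF o o]] by simp
  show ?thesis
    using T
  proof (induction A rule: infinite_finite_induct)
    case (insert i A)
    then show ?case using bend_add[OF w, of "T i" "sum T A"] hom_sum[OF o o, of A T] by simp
  qed (simp_all add: z0)
qed

text \<open>The range of \<open>q\<close> is a sum of simple objects, which writes \<open>q\<close> as a sum of terms \<open>\<xi> \<cdot> star \<xi>\<close> with simple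
  source; each of them contributes one square.\<close>

lemma bend_projection_in_cone:
  assumes w: "w \<in> Ob C" and q: "projection (cj w \<otimes> w) q"
  shows "Psi \<one> \<one> (w \<otimes> cj w) (bend w q) \<in> square_cone"
proof -
  define z where "z = cj w \<otimes> w"
  have o: "z \<in> Ob C" "cj w \<in> Ob C" "w \<otimes> cj w \<in> Ob C" using w by (simp_all add: z_def)
  obtain s v where s: "s \<in> Ob C" and v: "v \<in> hom s z" "v \<cdot> star v = q"
    using subobjects[OF o(1), of q] q by (auto simp: projection_def z_def)
  have sv: "star v \<in> hom z s" using star_in[OF s o(1) v(1)] .
  define J where "J = constituents s"
  have J: "finite J" "J \<subseteq> Irr"
    using finite_constituents[OF s] by (auto simp: J_def constituents_def)
  define S where "S = (SIGMA u:J. basis u s)"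
  have S: "u \<in> Irr" "u \<in> Ob C" "\<alpha> \<in> hom u s" "star \<alpha> \<in> hom s u" "v \<cdot> \<alpha> \<in> hom u z"
    "\<alpha> \<cdot> star \<alpha> \<in> hom s s" if "(u, \<alpha>) \<in> S" for u \<alpha>
  proof -
    show u: "u \<in> Irr" "u \<in> Ob C" "\<alpha> \<in> hom u s" "star \<alpha> \<in> hom s u"
      using that J Irr_Ob basis(2,3)[OF _ s] by (auto simp: S_def)
    show "v \<cdot> \<alpha> \<in> hom u z" using comp_in[OF u(2) s o(1) u(3) v(1)] .
    show "\<alpha> \<cdot> star \<alpha> \<in> hom s s" using comp_in[OF s u(2) s u(4,3)] .
  qed
  have "(\<Sum>(u, \<alpha>)\<in>S. \<alpha> \<cdot> star \<alpha>) = (\<Sum>u\<in>J. \<Sum>\<alpha>\<in>basis u s. \<alpha> \<cdot> star \<alpha>)"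
    unfolding S_def using J basis(1)[OF _ s] by (intro sum.Sigma[symmetric]) auto
  also have "\<dots> = idm s"
    using ident_decomposition[OF s J(1) _ J(2)] by (simp add: J_def)
  finally have "q = v \<cdot> ((\<Sum>i\<in>S. snd i \<cdot> star (snd i)) \<cdot> star v)"
    using v comp_ident_left[OF o(1) s sv] by (simp add: case_prod_beta)
  also have "\<dots> = v \<cdot> (\<Sum>i\<in>S. (snd i \<cdot> star (snd i)) \<cdot> star v)"
    using comp_sum_left[OF o(1) s s sv, of S "\<lambda>i. snd i \<cdot> star (snd i)"] S(6) by force
  also have "\<dots> = (\<Sum>i\<in>S. v \<cdot> ((snd i \<cdot> star (snd i)) \<cdot> star v))"
    using comp_in[OF o(1) s s sv S(6)] by (intro comp_sum_right[OF o(1) s o(1) v(1)]) auto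
  also have "\<dots> = (\<Sum>i\<in>S. (v \<cdot> snd i) \<cdot> star (v \<cdot> snd i))"
  proof (intro sum.cong refl)
    fix i assume "i \<in> S"
    moreover obtain u \<alpha> where i: "i = (u, \<alpha>)" by (cases i)
    ultimately have "(u, \<alpha>) \<in> S" by simp
    note t = S[OF this]
    have "(v \<cdot> \<alpha>) \<cdot> star (v \<cdot> \<alpha>) = v \<cdot> (\<alpha> \<cdot> (star \<alpha> \<cdot> star v))"
      unfolding star_comp[OF t(2) s o(1) t(3) v(1)]
      using comp_assoc[OF o(1) t(2) s o(1) comp_in[OF o(1) s t(2) sv t(4)] t(3) v(1)] .
    also have "\<alpha> \<cdot> (star \<alpha> \<cdot> star v) = (\<alpha> \<cdot> star \<alpha>) \<cdot> star v"
      using comp_assoc[OF o(1) s t(2) s sv t(4,3)] by simp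
    finally show "v \<cdot> ((snd i \<cdot> star (snd i)) \<cdot> star v) = (v \<cdot> snd i) \<cdot> star (v \<cdot> snd i)"
      by (simp add: i)
  qed
  finally have q_sum: "q = (\<Sum>i\<in>S. (v \<cdot> snd i) \<cdot> star (v \<cdot> snd i))" .
  have T: "(v \<cdot> snd i) \<cdot> star (v \<cdot> snd i) \<in> hom (cj w \<otimes> w) (cj w \<otimes> w)" if "i \<in> S" for i
    using that S(2,5) comp_in[OF o(1) _ o(1) star_in[OF _ o(1)]] unfolding z_def[symmetric]
    by (cases i) force
  have bend_q: "bend w q = (\<Sum>i\<in>S. bend w ((v \<cdot> snd i) \<cdot> star (v \<cdot> snd i)))"
    by (subst q_sum) (rule bend_sum[OF w T])
  have "Psi \<one> \<one> (w \<otimes> cj w) (bend w q) t = (\<Sum>i\<in>S. square (fst i) w (frobenius_mate w (v \<cdot> snd i)) t)" for t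
  proof -
    have "Psi \<one> \<one> (w \<otimes> cj w) (bend w q) t
        = (\<Sum>i\<in>S. Psi \<one> \<one> (w \<otimes> cj w) (bend w ((v \<cdot> snd i) \<cdot> star (v \<cdot> snd i))) t)"
      unfolding bend_q using bend_factors(5)[OF w T] o by (intro Psi_sum) simp_all
    also have "\<dots> = (\<Sum>i\<in>S. square (fst i) w (frobenius_mate w (v \<cdot> snd i)) t)"
    proof (intro sum.cong refl)
      fix i assume "i \<in> S"
      then have "fst i \<in> Ob C" "v \<cdot> snd i \<in> hom (fst i) (cj w \<otimes> w)"
        using S(2,5)[of "fst i" "snd i"] by (simp_all add: z_def)
      then show "Psi \<one> \<one> (w \<otimes> cj w) (bend w ((v \<cdot> snd i) \<cdot> star (v \<cdot> snd i))) t
          = square (fst i) w (frobenius_mate w (v \<cdot> snd i)) t"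
        unfolding square_def using bend_frobenius_mate(2)[OF w] by simp
    qed
    finally show ?thesis .
  qed
  moreover have "(\<lambda>t. \<Sum>i\<in>S. square (fst i) w (frobenius_mate w (v \<cdot> snd i)) t) \<in> square_cone"
  proof (rule square_cone_sum)
    fix i assume "i \<in> S"
    then have "fst i \<in> Irr" "fst i \<in> Ob C" "v \<cdot> snd i \<in> hom (fst i) (cj w \<otimes> w)"
      using S(1,2,5)[of "fst i" "snd i"] by (simp_all add: z_def)
    then show "(\<lambda>t. square (fst i) w (frobenius_mate w (v \<cdot> snd i)) t) \<in> square_cone"
      using square_in_cone[OF _ w bend_frobenius_mate(1)[OF w]] by simp
  qed
  ultimately show ?thesis by (metis (no_types, lifting) ext)
qed

text \<open>The bound on \<open>[w] [w]\<^sup>*\<close>, obtained from the projection \<open>q\<close> complementary to the range of \<open>R w\<close>. Rotation turns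
  \<open>1 = q + R w (R w)\<^sup>* / n\<close> into \<open>Rb w (Rb w)\<^sup>* = bend w q + 1 / n\<close>, and by cyclicity \<open>Rb w (Rb w)\<^sup>*\<close> represents
  the same element as the scalar \<open>(Rb w)\<^sup>* Rb w\<close>.\<close>

lemma unit_minus_mult_star_in_cone:
  assumes "simple w"
  shows "(\<lambda>v. complex_of_real ((norm (R w))\<^sup>2 * (norm (Rb w))\<^sup>2) \<odot> obj_class \<one> v
    - obj_class (w \<otimes> cj w) v) \<in> square_cone"
proof -
  note w = simple_Ob[OF assms]
  have o: "cj w \<otimes> w \<in> Ob C" "w \<otimes> cj w \<in> Ob C" using w by simp_all
  note r = R_in(1)[OF w] and rb = R_in(2)[OF w]
  have sr: "star (R w) \<in> hom (cj w \<otimes> w) \<one>" "star (Rb w) \<in> hom (w \<otimes> cj w) \<one>"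
    using star_in[OF unit_in o(1) r] star_in[OF unit_in o(2) rb] by auto
  define n where "n = (norm (R w))\<^sup>2"
  have rr: "star (R w) \<cdot> R w = complex_of_real n \<odot> idm \<one>"
    and rbrb: "star (Rb w) \<cdot> Rb w = complex_of_real ((norm (Rb w))\<^sup>2) \<odot> idm \<one>"
    using star_comp_simple[OF simple_unit o(1) r] star_comp_simple[OF simple_unit o(2) rb] by (simp_all add: n_def)
  have RR: "R w \<cdot> star (R w) \<in> hom (cj w \<otimes> w) (cj w \<otimes> w)"
    using comp_in[OF o(1) unit_in o(1) sr(1) r] .
  have "R w \<noteq> 0" using R_nonzero[OF w simple_ident[OF assms]] .
  then have n: "n > 0" by (simp add: n_def)
  define p where "p = complex_of_real (1 / n) \<odot> (R w \<cdot> star (R w))"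
  have RR2: "(R w \<cdot> star (R w)) \<cdot> (R w \<cdot> star (R w)) = complex_of_real n \<odot> (R w \<cdot> star (R w))"
  proof -
    have "(R w \<cdot> star (R w)) \<cdot> (R w \<cdot> star (R w)) = R w \<cdot> ((star (R w) \<cdot> R w) \<cdot> star (R w))"
      using comp_assoc[OF o(1,1) unit_in o(1) RR sr(1) r] comp_assoc[OF o(1) unit_in o(1) unit_in sr(1) r sr(1)]
      by simp
    also have "\<dots> = complex_of_real n \<odot> (R w \<cdot> star (R w))"
      unfolding rr comp_scale_left[OF o(1) unit_in unit_in sr(1) ident_in[OF unit_in]]
        comp_ident_left[OF o(1) unit_in sr(1)] comp_scale_right[OF o(1) unit_in o(1) sr(1) r] ..
    finally show ?thesis .
  qed
  have p_in: "p \<in> hom (cj w \<otimes> w) (cj w \<otimes> w)"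
    unfolding p_def using hom_scale[OF o(1,1) RR] .
  have "projection (cj w \<otimes> w) p"
    unfolding projection_def
  proof (intro conjI)
    show "p \<in> hom (cj w \<otimes> w) (cj w \<otimes> w)" by (rule p_in)
    have "p \<cdot> p = complex_of_real (1 / n) \<odot> ((R w \<cdot> star (R w)) \<cdot> p)"
      using comp_scale_left[OF o(1,1,1) p_in RR, of "complex_of_real (1 / n)"] unfolding p_def[symmetric] .
    also have "(R w \<cdot> star (R w)) \<cdot> p = complex_of_real (1 / n) \<odot> (complex_of_real n \<odot> (R w \<cdot> star (R w)))"
      unfolding p_def comp_scale_right[OF o(1,1,1) RR RR] RR2 ..
    finally show "p \<cdot> p = p" using n by (simp add: p_def)
    show "star p = p"
      unfolding p_def star_scale[OF o(1,1) RR] star_comp[OF o(1) unit_in o(1) sr(1) r]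
        star_star[OF unit_in o(1) r] by simp
  qed
  then have q: "projection (cj w \<otimes> w) (idm (cj w \<otimes> w) - p)"
    using projection_ident_minus[OF o(1)] by blast
  define q where "q = idm (cj w \<otimes> w) - p"
  have qin: "q \<in> hom (cj w \<otimes> w) (cj w \<otimes> w)" using q by (simp add: projection_def q_def)
  have cone: "Psi \<one> \<one> (w \<otimes> cj w) (bend w q) \<in> square_cone"
    using bend_projection_in_cone[OF w q] by (simp add: q_def)
  have b: "T \<in> hom (w \<otimes> cj w) (w \<otimes> cj w) \<Longrightarrow> T \<in> hom ((w \<otimes> cj w) \<otimes> \<one>) (\<one> \<otimes> (w \<otimes> cj w))" for T
    using o by simp
  have "Rb w \<cdot> star (Rb w) = bend w q + complex_of_real (1 / n) \<odot> idm (w \<otimes> cj w)"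
    using bend_add[OF w qin p_in] bend_scale[OF w RR] bend_ident[OF w] bend_R[OF w]
    by (simp add: q_def p_def)
  then have "Psi \<one> \<one> (w \<otimes> cj w) (Rb w \<cdot> star (Rb w)) t
      = Psi \<one> \<one> (w \<otimes> cj w) (bend w q) t + complex_of_real (1 / n) \<odot> obj_class (w \<otimes> cj w) t" for t
    unfolding obj_class_def
    using Psi_add[OF unit_in unit_in o(2) b b, OF bend_factors(5)[OF w qin] hom_scale[OF o(2,2) ident_in[OF o(2)]]]
      Psi_scale[OF unit_in unit_in o(2) b, OF ident_in[OF o(2)]] by simp
  moreover have "Psi \<one> \<one> (w \<otimes> cj w) (Rb w \<cdot> star (Rb w)) t = complex_of_real ((norm (Rb w))\<^sup>2) \<odot> obj_class \<one> t" for t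
    unfolding Psi_unit_trace[OF o(2) unit_in rb sr(2)] rbrb obj_class_def
    using Psi_scale[OF unit_in unit_in unit_in, of "idm \<one>"] by (simp add: ident_in)
  ultimately have eq: "Psi \<one> \<one> (w \<otimes> cj w) (bend w q) t
      = complex_of_real ((norm (Rb w))\<^sup>2) \<odot> obj_class \<one> t - complex_of_real (1 / n) \<odot> obj_class (w \<otimes> cj w) t" for t
    by (metis add_diff_cancel_right')
  have "complex_of_real n \<odot> Psi \<one> \<one> (w \<otimes> cj w) (bend w q) t
      = complex_of_real (n * (norm (Rb w))\<^sup>2) \<odot> obj_class \<one> t - obj_class (w \<otimes> cj w) t" for t
    unfolding eq V.scale_right_diff_distrib using n by simp
  then show ?thesis
    using square_cone_scale[OF cone, of n] n by (simp add: n_def)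
qed

lemma unit_in_cone: "obj_class \<one> \<in> square_cone"
proof -
  have "idm \<one> \<in> hom (\<one> \<otimes> \<one>) (\<one> \<otimes> \<one>)" by (simp add: ident_in)
  from square_in_cone[OF unit_Irr unit_in this]
  show ?thesis
    unfolding square_def sharp_ident[OF unit_in]
    using tube_prod_ident[of \<one> "cj \<one>"] obj_class_conj_unit by (simp add: obj_class_def)
qed

text \<open>Adding \<open>\<bar>c\<bar>\<^sup>2\<close> times the bound on \<open>[w] [w]\<^sup>*\<close> cancels the unwanted term of \<open>(1 + c [w]) (1 + c [w])\<^sup>*\<close>.\<close>

lemma hermitian_class_plus_unit_in_cone:
  assumes "simple w"
  shows "\<exists>r\<ge>0. (\<lambda>v. c \<odot> obj_class w v + cnj c \<odot> obj_class (cj w) v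
    + complex_of_real r \<odot> obj_class \<one> v) \<in> square_cone"
proof -
  note w = simple_Ob[OF assms]
  define K where "K = (norm (R w))\<^sup>2 * (norm (Rb w))\<^sup>2"
  define m where "m = (cmod c)\<^sup>2"
  have m: "c * cnj c = complex_of_real m" unfolding m_def by (rule complex_norm_square[symmetric])
  have "(\<lambda>v. (obj_class \<one> v + c \<odot> obj_class w v + cnj c \<odot> obj_class (cj w) v
      + complex_of_real m \<odot> obj_class (w \<otimes> cj w) v)
    + complex_of_real m \<odot> (complex_of_real K \<odot> obj_class \<one> v - obj_class (w \<otimes> cj w) v)) \<in> square_cone"
    unfolding K_def
    by (rule square_cone_add[OF square_unit_plus_class[OF w, of c, unfolded m]
          square_cone_scale[OF unit_minus_mult_star_in_cone[OF assms]]]) (simp add: m_def)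
  moreover have "(obj_class \<one> v + c \<odot> obj_class w v + cnj c \<odot> obj_class (cj w) v
      + complex_of_real m \<odot> obj_class (w \<otimes> cj w) v)
    + complex_of_real m \<odot> (complex_of_real K \<odot> obj_class \<one> v - obj_class (w \<otimes> cj w) v)
    = c \<odot> obj_class w v + cnj c \<odot> obj_class (cj w) v + complex_of_real (1 + m * K) \<odot> obj_class \<one> v" for v
    by (simp add: V.scale_right_diff_distrib V.scale_left_distrib)
  ultimately have "(\<lambda>v. c \<odot> obj_class w v + cnj c \<odot> obj_class (cj w) v
      + complex_of_real (1 + m * K) \<odot> obj_class \<one> v) \<in> square_cone"
    by (simp only:)
  moreover have "1 + m * K \<ge> 0" by (simp add: m_def K_def)
  ultimately show ?thesis by blast
qed


section \<open>The fusion algebra\<close>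

lemma fusion_to_tube_superset:
  assumes "finite S" "{w. a w \<noteq> 0} \<subseteq> S"
  shows "fusion_to_tube a v = (\<Sum>w\<in>S. a w \<odot> obj_class w v)"
  unfolding fusion_to_tube_def obj_class_def
  using assms by (intro sum.mono_neutral_left) auto

lemma irr_conj:
  assumes "x \<in> Irr"
  shows "irr_conj x \<in> Irr" "obj_class (irr_conj x) = obj_class (cj x)"
proof -
  have "\<exists>!y. y \<in> Irr \<and> iso (cj x) y"
    using irr conj_simple[OF Irr_simple[OF assms]] unfolding irr_representatives_def by blast
  then have *: "irr_conj x \<in> Irr \<and> iso (cj x) (irr_conj x)"
    unfolding irr_conj_def by (rule theI')
  then show "irr_conj x \<in> Irr" by blast
  show "obj_class (irr_conj x) = obj_class (cj x)"
    using obj_class_iso[of "cj x" "irr_conj x"] * Irr_Ob assms by simp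
qed

text \<open>Isomorphic objects have the same class, so the representative of \<open>cj x\<close> in \<open>Irr\<close> can be replaced by
  \<open>cj x\<close> itself. The sum is grouped along the fibres of \<open>irr_conj\<close>.\<close>

lemma fusion_to_tube_star:
  assumes "a \<in> fusion_algebra"
  shows "fusion_to_tube (fusion_star a) v = (\<Sum>x | a x \<noteq> 0. cnj (a x) \<odot> obj_class (cj x) v)"
proof -
  define S where "S = {x. a x \<noteq> 0}"
  have S: "finite S" "S \<subseteq> Irr" using assms by (auto simp: fusion_algebra_def S_def)
  have "{y. fusion_star a y \<noteq> 0} \<subseteq> irr_conj ` S"
  proof
    fix y assume y: "y \<in> {y. fusion_star a y \<noteq> 0}"
    have "{x. a x \<noteq> 0 \<and> irr_conj x = y} \<noteq> {}"
    proof
      assume "{x. a x \<noteq> 0 \<and> irr_conj x = y} = {}"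
      then have "fusion_star a y = 0" by (simp only: fusion_star_def sum.empty)
      with y show False by simp
    qed
    then show "y \<in> irr_conj ` S" by (auto simp: S_def)
  qed
  then have "fusion_to_tube (fusion_star a) v = (\<Sum>y\<in>irr_conj ` S. fusion_star a y \<odot> obj_class y v)"
    using S(1) by (intro fusion_to_tube_superset) auto
  also have "\<dots> = (\<Sum>y\<in>irr_conj ` S. \<Sum>x\<in>{x \<in> S. irr_conj x = y}. cnj (a x) \<odot> obj_class (cj x) v)"
  proof (intro sum.cong refl)
    fix y
    have "fusion_star a y \<odot> obj_class y v = (\<Sum>x\<in>{x \<in> S. irr_conj x = y}. cnj (a x) \<odot> obj_class y v)"
      unfolding fusion_star_def V.scale_sum_left S_def by simp
    also have "\<dots> = (\<Sum>x\<in>{x \<in> S. irr_conj x = y}. cnj (a x) \<odot> obj_class (cj x) v)"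
      using irr_conj(2) S(2) by (intro sum.cong refl) (metis (mono_tags, lifting) mem_Collect_eq subsetD)
    finally show "fusion_star a y \<odot> obj_class y v
        = (\<Sum>x\<in>{x \<in> S. irr_conj x = y}. cnj (a x) \<odot> obj_class (cj x) v)" .
  qed
  also have "\<dots> = (\<Sum>x\<in>S. cnj (a x) \<odot> obj_class (cj x) v)"
    by (rule sum.image_gen[OF S(1), symmetric])
  finally show ?thesis by (simp add: S_def)
qed

theorem unit_order_unit:
  assumes a: "a \<in> fusion_algebra" and sa: "fusion_star a = a"
  shows "\<exists>r::real. r > 0 \<and> (\<lambda>x. a x + complex_of_real r * fusion_one x) \<in> tube_cone"
proof -
  define S where "S = {x. a x \<noteq> 0}"
  have S: "finite S" "S \<subseteq> Irr" using a by (auto simp: fusion_algebra_def S_def)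
  define E where "E x r = (\<lambda>v. (a x / 2) \<odot> obj_class x v + cnj (a x / 2) \<odot> obj_class (cj x) v
      + complex_of_real r \<odot> obj_class \<one> v)" for x r
  have "\<forall>x\<in>S. \<exists>r. r \<ge> 0 \<and> E x r \<in> square_cone"
  proof
    fix x assume "x \<in> S"
    then have "simple x" using Irr_simple S(2) by blast
    from hermitian_class_plus_unit_in_cone[OF this, of "a x / 2"]
    show "\<exists>r. r \<ge> 0 \<and> E x r \<in> square_cone" unfolding E_def .
  qed
  from bchoice[OF this] obtain r where r: "\<forall>x\<in>S. r x \<ge> 0 \<and> E x (r x) \<in> square_cone" ..
  \<comment> \<open>The summand \<open>1\<close> makes the constant positive when the support is empty.\<close>
  define t where "t = 1 + sum r S"
  have t: "t > 0" using sum_nonneg[of S r] r by (simp add: t_def)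
  define b where "b = (\<lambda>x. a x + complex_of_real t * fusion_one x)"
  have b: "b \<in> fusion_algebra"
  proof -
    have "{x. b x \<noteq> 0} \<subseteq> insert \<one> S" by (auto simp: b_def fusion_one_def S_def)
    then show ?thesis
      using S unit_Irr finite_subset[of "{x. b x \<noteq> 0}" "insert \<one> S"] by (auto simp: fusion_algebra_def)
  qed
  \<comment> \<open>Averaging the expansions of \<open>a\<close> and of \<open>a\<^sup>*\<close> makes every summand self-adjoint.\<close>
  have half: "fusion_to_tube a v = (\<Sum>x\<in>S. (a x / 2) \<odot> obj_class x v + cnj (a x / 2) \<odot> obj_class (cj x) v)" for v
  proof -
    have 1: "fusion_to_tube a v = (\<Sum>x\<in>S. a x \<odot> obj_class x v)"
      using S(1) by (intro fusion_to_tube_superset) (auto simp: S_def)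
    have 2: "fusion_to_tube a v = (\<Sum>x\<in>S. cnj (a x) \<odot> obj_class (cj x) v)"
      using fusion_to_tube_star[OF a, of v] by (simp add: sa S_def)
    have "fusion_to_tube a v = (1/2) \<odot> fusion_to_tube a v + (1/2) \<odot> fusion_to_tube a v"
      by (simp flip: V.scale_left_distrib)
    also have "\<dots> = (1/2) \<odot> (\<Sum>x\<in>S. a x \<odot> obj_class x v) + (1/2) \<odot> (\<Sum>x\<in>S. cnj (a x) \<odot> obj_class (cj x) v)"
      using 1 2 by simp
    finally show ?thesis by (simp add: V.scale_sum_right sum.distrib)
  qed
  have fb: "fusion_to_tube b v = fusion_to_tube a v + complex_of_real t \<odot> obj_class \<one> v" for v
  proof -
    have f: "finite (insert \<one> S)" using S by simp
    have "fusion_to_tube b v = (\<Sum>x\<in>insert \<one> S. b x \<odot> obj_class x v)"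
      by (rule fusion_to_tube_superset[OF f]) (auto simp: b_def fusion_one_def S_def)
    also have "\<dots> = (\<Sum>x\<in>insert \<one> S. a x \<odot> obj_class x v)
        + (\<Sum>x\<in>insert \<one> S. if x = \<one> then complex_of_real t \<odot> obj_class \<one> v else 0)"
      unfolding sum.distrib[symmetric]
      by (intro sum.cong refl) (auto simp: b_def fusion_one_def V.scale_left_distrib)
    also have "(\<Sum>x\<in>insert \<one> S. a x \<odot> obj_class x v) = fusion_to_tube a v"
      by (rule fusion_to_tube_superset[OF f, symmetric]) (auto simp: S_def)
    finally show ?thesis using f by simp
  qed
  have "(\<lambda>v. (\<Sum>x\<in>S. E x (r x) v) + obj_class \<one> v) \<in> square_cone"
    using r by (intro square_cone_add square_cone_sum unit_in_cone) simp
  also have "(\<lambda>v. (\<Sum>x\<in>S. E x (r x) v) + obj_class \<one> v) = fusion_to_tube b"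
  proof
    fix v
    show "(\<Sum>x\<in>S. E x (r x) v) + obj_class \<one> v = fusion_to_tube b v"
      unfolding fb half t_def E_def sum.distrib
      by (simp add: V.scale_left_distrib V.scale_sum_left)
  qed
  finally have "b \<in> tube_cone"
    unfolding tube_cone_def using b square_cone_sum_of_squares by blast
  with t show ?thesis unfolding b_def by blast
qed

end

theorem proposition3p5:
  fixes C :: "('o, 'm::real_normed_vector) tensor_cat"
    and Irr :: "'o set" and cj :: "'o \<Rightarrow> 'o" and R Rb :: "'o \<Rightarrow> 'm"
    and a :: "'o \<Rightarrow> complex"
  assumes "rigid_cstar_tensor_category C"
    and "tensor_cat_data.simple C (unit C)"
    and "tensor_cat_data.irr_representatives C Irr"
    and "countable Irr"
    and "\<And>x. x \<in> Ob C \<Longrightarrow> tensor_cat_data.standard_solution C x (cj x) (R x) (Rb x)"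
    and "a \<in> tube_data.fusion_algebra Irr"
    and "tube_data.fusion_star C Irr cj a = a"
  shows "\<exists>r::real. r > 0 \<and>
    (\<lambda>x. a x + complex_of_real r * tube_data.fusion_one C x)
      \<in> tube_data.tube_cone C Irr cj R Rb"
proof -
  interpret rigid_cstar_tensor_category C by (rule assms(1))
  interpret tube_category C Irr cj R Rb
    using assms(2,3,5) by unfold_locales (simp_all add: standard_solution_def)
  show ?thesis by (rule unit_order_unit[OF assms(6,7)])
qed

end
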